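(* Let $f$ be a real $C^1$ function on $(0,\infty)$. For each $n\in\mathbb{N}$ consider the following conditions: (a)$_n$ $f$ is $n$-convex on $(0,\infty)$; (b)$_n$ $\liminf_{t\to\infty}f(t)/t>-\infty$ and the Loewner matrix $L_f(t_1,\dots,t_n)$ is conditionally negative definite for all $t_1,\dots,t_n\in(0,\infty)$; (c)$_n$ $\limsup_{t\searrow0}tf(t)\ge0$ and the Loewner matrix $L_{tf(t)}(t_1,\dots,t_n)$ of the function $t\mapsto tf(t)$ is conditionally positive definite for all $t_1,\dots,t_n\in(0,\infty)$. Then for every $n\in\mathbb{N}$ the following implications hold: $$ {\rm(a)}_{2n+1}\Longrightarrow{\rm(b)}_n,\quad {\rm(b)}_{4n+1}\Longrightarrow{\rm(a)}_n,\quad {\rm(a)}_{n+1}\Longrightarrow{\rm(c)}_n,\quad {\rm(c)}_{2n+1}\Longrightarrow{\rm(a)}_n. $$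
   Context: $\mathbb{N}=\{1,2,\dots\}$; $\mathbb{M}_n$ is the set of $n\times n$ complex matrices. A continuous real function $f$ on an interval $J$ is $n$-convex (matrix convex of order $n$) on $J$ if $f(\lambda A+(1-\lambda)B)\le\lambda f(A)+(1-\lambda)f(B)$ for all Hermitian $A,B\in\mathbb{M}_n$ with spectra in $J$ and all $\lambda\in(0,1)$ (functional calculus, positive semidefinite order). A Hermitian $A\in\mathbb{M}_n$ is conditionally positive definite if $\langle x,Ax\rangle\ge0$ for all $x=(x_1,\dots,x_n)^t\in\mathbb{C}^n$ with $\sum_{i=1}^nx_i=0$, and conditionally negative definite if $-A$ is conditionally positive definite. For a real $C^1$ function $g$ on an open interval, $g^{[1]}(s,t):=\frac{g(s)-g(t)}{s-t}$ if $s\ne t$ and $g^{[1]}(s,s):=g'(s)$; the Loewner matrix is $L_g(t_1,\dots,t_n):=[g^{[1]}(t_i,t_j)]_{i,j=1}^n$ (the points $t_i$ need not be distinct). *)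

theory Defs
  imports "HOL-Analysis.Analysis" "Jordan_Normal_Form.Spectral_Radius"
    "Jordan_Normal_Form.Schur_Decomposition"
begin

no_notation Finite_Cartesian_Product.vec_nth (infixl \<open>$\<close> 90)
hide_const (open) Finite_Cartesian_Product.vec Finite_Cartesian_Product.mat
hide_type (open) Finite_Cartesian_Product.vec

definition hermitian_mat :: "nat \<Rightarrow> complex mat \<Rightarrow> bool" where
  "hermitian_mat n A \<longleftrightarrow> A \<in> carrier_mat n n \<and> mat_adjoint A = A"

definition unitary_mat :: "nat \<Rightarrow> complex mat \<Rightarrow> bool" where
  "unitary_mat n U \<longleftrightarrow>
     U \<in> carrier_mat n n \<and> U * mat_adjoint U = 1\<^sub>m n \<and> mat_adjoint U * U = 1\<^sub>m n"

text \<open>The inner product, linear in its second argument, is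
  \<open>\<langle>x, A x\<rangle> = (A *\<^sub>v x) \<bullet>c x\<close>; in the order on \<open>complex\<close>, \<open>0 \<le> z\<close> means that \<open>z\<close> is real
  and nonnegative.\<close>

definition psd_mat :: "nat \<Rightarrow> complex mat \<Rightarrow> bool" where
  "psd_mat n A \<longleftrightarrow> hermitian_mat n A \<and> (\<forall>x\<in>carrier_vec n. 0 \<le> (A *\<^sub>v x) \<bullet>c x)"

definition psd_le :: "nat \<Rightarrow> complex mat \<Rightarrow> complex mat \<Rightarrow> bool" where
  "psd_le n A B \<longleftrightarrow> psd_mat n (B - A)"

text \<open>Functional calculus for Hermitian matrices:
  if \<open>A = U diag(d\<^sub>0, d\<^sub>1, \<dots>) U\<^sup>*\<close> with \<open>U\<close> unitary then \<open>f(A) = U diag(f(d\<^sub>0), f(d\<^sub>1), \<dots>) U\<^sup>*\<close>.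
  That this does not depend on the diagonalization is \<open>mat_fun_diag\<close> below.\<close>

definition mat_fun :: "(real \<Rightarrow> real) \<Rightarrow> complex mat \<Rightarrow> complex mat" where
  "mat_fun f A = (THE B. \<exists>U d. unitary_mat (dim_row A) U \<and>
     A = U * mat_diag (dim_row A) (\<lambda>i. complex_of_real (d i)) * mat_adjoint U \<and>
     B = U * mat_diag (dim_row A) (\<lambda>i. complex_of_real (f (d i))) * mat_adjoint U)"

lemma mat_adjoint_carrier [simp]:
  "A \<in> carrier_mat n m \<Longrightarrow> mat_adjoint A \<in> carrier_mat m n"
  by (auto simp: mat_adjoint_def)

lemma diagonalization_unique:
  assumes U: "unitary_mat n U" and V: "unitary_mat n V"
    and eq: "U * mat_diag n (\<lambda>i. complex_of_real (d i)) * mat_adjoint U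
           = V * mat_diag n (\<lambda>i. complex_of_real (e i)) * mat_adjoint V"
  shows "U * mat_diag n (\<lambda>i. complex_of_real (f (d i))) * mat_adjoint U
       = V * mat_diag n (\<lambda>i. complex_of_real (f (e i))) * mat_adjoint V"
proof -
  let ?D = "\<lambda>g. mat_diag n (\<lambda>i. complex_of_real (g i))"
  define W where "W = mat_adjoint V * U"
  have c: "U \<in> carrier_mat n n" "V \<in> carrier_mat n n"
    "mat_adjoint U \<in> carrier_mat n n" "mat_adjoint V \<in> carrier_mat n n"
    "W \<in> carrier_mat n n" "\<And>g. ?D g \<in> carrier_mat n n"
    using U V by (auto simp: unitary_mat_def W_def intro!: mult_carrier_mat)
  have u: "U * mat_adjoint U = 1\<^sub>m n" "mat_adjoint U * U = 1\<^sub>m n"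
    "V * mat_adjoint V = 1\<^sub>m n" "mat_adjoint V * V = 1\<^sub>m n"
    using U V by (auto simp: unitary_mat_def)
  have mult: "X * Y \<in> carrier_mat n n"
    if "X \<in> carrier_mat n n" "Y \<in> carrier_mat n n" for X Y :: "complex mat"
    using that by (rule mult_carrier_mat)
  have assoc: "X * Y * Z = X * (Y * Z)"
    if "X \<in> carrier_mat n n" "Y \<in> carrier_mat n n" "Z \<in> carrier_mat n n"
    for X Y Z :: "complex mat"
    using that by (rule assoc_mult_mat)
  have cancel: "X * (Y * Z) = Z"
    if "X * Y = 1\<^sub>m n" "X \<in> carrier_mat n n" "Y \<in> carrier_mat n n" "Z \<in> carrier_mat n n"
    for X Y Z :: "complex mat"
    using assoc[of X Y Z] that by simp
  have one: "X * 1\<^sub>m n = X" "1\<^sub>m n * X = X"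
    if "X \<in> carrier_mat n n" for X :: "complex mat"
    using that by simp_all
  have "W * ?D d = mat_adjoint V * (U * ?D d * mat_adjoint U) * U"
    using c u by (simp add: W_def assoc mult cancel one)
  also have "\<dots> = ?D e * W"
    unfolding eq using c u
    by (simp add: W_def assoc mult cancel one)
  finally have "W * ?D d = ?D e * W" .
  then have ij: "W $$ (i,j) * complex_of_real (d j) = complex_of_real (e i) * W $$ (i,j)"
    if "i < n" "j < n" for i j
    using c(5) that
    by (auto simp: mat_diag_mult_left[OF c(5)] mat_diag_mult_right[OF c(5)] mat_eq_iff)
  have "W $$ (i,j) * complex_of_real (f (d j)) = complex_of_real (f (e i)) * W $$ (i,j)"
    if "i < n" "j < n" for i j
    using ij[OF that] by (cases "W $$ (i,j) = 0") auto
  then have W: "W * ?D (\<lambda>i. f (d i)) = ?D (\<lambda>i. f (e i)) * W"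
    using c(5)
    by (auto simp: mat_diag_mult_left[OF c(5)] mat_diag_mult_right[OF c(5)] intro!: eq_matI)
  have "U = V * W"
    using c u by (simp add: W_def assoc mult cancel one)
  then have "U * ?D (\<lambda>i. f (d i)) * mat_adjoint U
      = V * (W * ?D (\<lambda>i. f (d i))) * mat_adjoint U"
    using c by (simp add: assoc mult cancel one)
  also have "\<dots> = V * ?D (\<lambda>i. f (e i)) * (W * mat_adjoint U)"
    unfolding W using c by (simp add: assoc mult cancel one)
  also have "W * mat_adjoint U = mat_adjoint V"
    using c u by (simp add: W_def assoc mult cancel one)
  finally show ?thesis .
qed

lemma mat_fun_diag:
  assumes U: "unitary_mat n U"
  shows "mat_fun f (U * mat_diag n (\<lambda>i. complex_of_real (d i)) * mat_adjoint U)
       = U * mat_diag n (\<lambda>i. complex_of_real (f (d i))) * mat_adjoint U"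
proof -
  have n: "dim_row (U * X * Y) = n" for X Y
    using U by (auto simp: unitary_mat_def)
  show ?thesis
    unfolding mat_fun_def n
    by (rule the_equality) (use U diagonalization_unique[OF U] in metis)+
qed

definition matrix_convex_on :: "nat \<Rightarrow> real set \<Rightarrow> (real \<Rightarrow> real) \<Rightarrow> bool" where
  "matrix_convex_on n J f \<longleftrightarrow> continuous_on J f \<and>
     (\<forall>A B l. hermitian_mat n A \<and> hermitian_mat n B \<and>
        spectrum A \<subseteq> complex_of_real ` J \<and> spectrum B \<subseteq> complex_of_real ` J \<and>
        0 < l \<and> l < 1 \<longrightarrow>
        psd_le n
          (mat_fun f (complex_of_real l \<cdot>\<^sub>m A + complex_of_real (1 - l) \<cdot>\<^sub>m B))
          (complex_of_real l \<cdot>\<^sub>m mat_fun f A + complex_of_real (1 - l) \<cdot>\<^sub>m mat_fun f B))"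

definition cond_positive_definite :: "nat \<Rightarrow> complex mat \<Rightarrow> bool" where
  "cond_positive_definite n A \<longleftrightarrow> hermitian_mat n A \<and>
     (\<forall>x\<in>carrier_vec n. (\<Sum>i<n. x $ i) = 0 \<longrightarrow> 0 \<le> (A *\<^sub>v x) \<bullet>c x)"

definition cond_negative_definite :: "nat \<Rightarrow> complex mat \<Rightarrow> bool" where
  "cond_negative_definite n A \<longleftrightarrow> cond_positive_definite n (- A)"

definition div_diff :: "(real \<Rightarrow> real) \<Rightarrow> real \<Rightarrow> real \<Rightarrow> real" where
  "div_diff g s t = (if s = t then deriv g s else (g s - g t) / (s - t))"

definition loewner_mat :: "nat \<Rightarrow> (real \<Rightarrow> real) \<Rightarrow> (nat \<Rightarrow> real) \<Rightarrow> complex mat" where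
  "loewner_mat n g t = mat n n (\<lambda>(i, j). complex_of_real (div_diff g (t i) (t j)))"

definition cond_a :: "(real \<Rightarrow> real) \<Rightarrow> nat \<Rightarrow> bool" where
  "cond_a f n \<longleftrightarrow> matrix_convex_on n {0<..} f"

definition cond_b :: "(real \<Rightarrow> real) \<Rightarrow> nat \<Rightarrow> bool" where
  "cond_b f n \<longleftrightarrow> Liminf at_top (\<lambda>t. ereal (f t / t)) > -\<infinity> \<and>
     (\<forall>t. (\<forall>i<n. t i > 0) \<longrightarrow> cond_negative_definite n (loewner_mat n f t))"

definition cond_c :: "(real \<Rightarrow> real) \<Rightarrow> nat \<Rightarrow> bool" where
  "cond_c f n \<longleftrightarrow> Limsup (at_right 0) (\<lambda>t. ereal (t * f t)) \<ge> 0 \<and>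
     (\<forall>t. (\<forall>i<n. t i > 0) \<longrightarrow> cond_positive_definite n (loewner_mat n (\<lambda>u. u * f u) t))"

end

(*
For a > 0 let K_a(s,t) = f(a) - f(s) - f[1](s,t) (a - s), which is symmetric in s and t.

The remainder f(B) - f(A) - Df(A)[B - A] is a sum of congruences of matrices [K_b(a_i,a_j)],
with b running through the eigenvalues of B and a_i those of A. Hence f is n-convex if all matrices
[K_a(t_i,t_j)] of order n are positive semidefinite; conversely (n+1)-convexity yields this by
rotating diag(t_1,...,t_n,a) slightly. On vectors with sum zero, [K_a(t_i,t_j)] is the
Loewner matrix of t f(t) minus a times that of f, so a -> 0 and a -> infinity give (c) and (b).

For the converse, a conditionally positive definite Loewner matrix of g, one of whose points
is a, gives a positive semidefinite one for k(s) = (g(a+s) - g(a) - g'(a) s) / s^2, so k is monotone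
of order 2n and s k(s), that is (g(a+s) - g(a)) / s, is n-convex. For g = t f(t) let a -> 0. For g = -f
this quotient is bounded above, hence its negative is again monotone; multiply by s once more.
*)

theory Submission
  imports Defs
begin

section \<open>Spectral decompositions\<close>

text \<open>The growth conditions exclude functions that the Loewner matrices cannot see. For
  \<open>- t^2\<close> the matrix has entries \<open>- (s + t)\<close> and vanishes on vectors with
  sum zero; for \<open>- 1 / t\<close> the function \<open>t f(t)\<close> is constant. They meet the
  matrix condition of (b) and of (c), respectively, in every order, yet neither is convex. In (b)
  growth supplies the upper bound that turns convexity into monotonicity, in (c) the nonnegative
  coefficient of a term in \<open>1 / s\<close>. Since \<open>f\<close> is only C^1, no second
  derivative of the functional calculus is at hand; an exact remainder takes its place. Nor need
  \<open>f\<close> extend to 0, so every quotient is based at some \<open>a > 0\<close>, and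
  \<open>a\<close> tends to 0 only in the end. The orders arise as follows. The base point
  \<open>a\<close> uses up one point, and the block matrix that makes convexity out of monotonicity
  halves the rest: \<open>2 n + 1\<close>. Condition (b) concerns \<open>f\<close> instead of
  \<open>t f(t)\<close>, so a second factor \<open>s\<close> and a second halving are required:
  \<open>4 n + 1\<close>. In \<open>n + 1\<close> the extra dimension holds the eigenvalue
  \<open>a\<close> that is rotated in.\<close>

text \<open>Vectors in \<open>\<complex>\<^sup>n\<close> are functions on \<open>nat\<close> of which only the values below \<open>n\<close> matter, and
  \<open>u k\<close> is the \<open>k\<close>-th vector of a family \<open>u\<close>. For an orthonormal basis \<open>u\<close>, \<open>spmat n u d\<close> is the
  Hermitian matrix \<open>A\<close> with eigenvectors \<open>u k\<close> and eigenvalues \<open>d k\<close>, and \<open>qval n u d x = \<langle>x, A x\<rangle>\<close>;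
  hence \<open>qval n u (\<lambda>k. f (d k)) x = \<langle>x, f(A) x\<rangle>\<close>.\<close>

definition cip :: "nat \<Rightarrow> (nat \<Rightarrow> complex) \<Rightarrow> (nat \<Rightarrow> complex) \<Rightarrow> complex" where
  "cip n x y = (\<Sum>i<n. cnj (x i) * y i)"

definition orthonormal :: "nat \<Rightarrow> (nat \<Rightarrow> nat \<Rightarrow> complex) \<Rightarrow> bool" where
  "orthonormal n u \<longleftrightarrow> (\<forall>k<n. \<forall>l<n. cip n (u k) (u l) = (if k = l then 1 else 0))"

definition spmat :: "nat \<Rightarrow> (nat \<Rightarrow> nat \<Rightarrow> complex) \<Rightarrow> (nat \<Rightarrow> real) \<Rightarrow> nat \<Rightarrow> nat \<Rightarrow> complex" where
  "spmat n u d i j = (\<Sum>k<n. complex_of_real (d k) * u k i * cnj (u k j))"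

definition sform :: "nat \<Rightarrow> (nat \<Rightarrow> nat \<Rightarrow> complex) \<Rightarrow> (nat \<Rightarrow> complex) \<Rightarrow> (nat \<Rightarrow> complex) \<Rightarrow> complex" where
  "sform n M x y = (\<Sum>i<n. \<Sum>j<n. cnj (x i) * M i j * y j)"

definition qval :: "nat \<Rightarrow> (nat \<Rightarrow> nat \<Rightarrow> complex) \<Rightarrow> (nat \<Rightarrow> real) \<Rightarrow> (nat \<Rightarrow> complex) \<Rightarrow> real" where
  "qval n u d x = (\<Sum>k<n. d k * (cmod (cip n (u k) x))\<^sup>2)"

lemma cnj_cip: "cnj (cip n x y) = cip n y x"
  by (simp add: cip_def mult.commute)

lemma cip_self: "cip n x x = complex_of_real (\<Sum>i<n. (cmod (x i))\<^sup>2)"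
  by (simp add: cip_def complex_norm_square mult.commute del: of_real_power)

lemma cip_mult_self: "cip n x y * cip n y x = complex_of_real ((cmod (cip n y x))\<^sup>2)"
  unfolding complex_norm_square cnj_cip by (rule mult.commute)

lemma cip_cong: "(\<And>i. i < n \<Longrightarrow> x i = x' i) \<Longrightarrow> (\<And>i. i < n \<Longrightarrow> y i = y' i) \<Longrightarrow> cip n x y = cip n x' y'"
  by (simp add: cip_def)

text \<open>A left inverse of a square matrix is also a right inverse; with the vectors
  \<open>u k\<close> as columns this turns orthonormality into completeness.\<close>

lemma orthonormal_rows:
  assumes "orthonormal n u" "i < n" "j < n"
  shows "(\<Sum>k<n. u k i * cnj (u k j)) = (if i = j then 1 else 0)"
proof -
  define U V where "U = mat n n (\<lambda>(i, k). u k i)" and "V = mat n n (\<lambda>(k, i). cnj (u k i))"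
  have c: "U \<in> carrier_mat n n" "V \<in> carrier_mat n n"
    by (auto simp: U_def V_def)
  have "V * U = 1\<^sub>m n"
    using assms(1) unfolding orthonormal_def cip_def
    by (intro eq_matI) (auto simp: U_def V_def scalar_prod_def lessThan_atLeast0)
  then have "U * V = 1\<^sub>m n"
    using c mat_mult_left_right_inverse by blast
  then have "(U * V) $$ (i, j) = (1\<^sub>m n :: complex mat) $$ (i, j)"
    by simp
  then show ?thesis
    using assms(2,3) by (simp add: U_def V_def scalar_prod_def lessThan_atLeast0)
qed

lemma sum_delta_lessThan:
  fixes g :: "nat \<Rightarrow> 'a::comm_semiring_1"
  assumes "i < n"
  shows "(\<Sum>j<n. (if i = j then 1 else 0) * g j) = g i" "(\<Sum>j<n. (if j = i then 1 else 0) * g j) = g i"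
    "(\<Sum>j<n. g j * (if i = j then 1 else 0)) = g i" "(\<Sum>j<n. g j * (if j = i then 1 else 0)) = g i"
  using assms by (simp_all add: if_distrib[where f = "\<lambda>x. x * _"] if_distrib[where f = "\<lambda>x. _ * x"] cong: if_cong)

lemma cip_cip_sum:
  "(\<Sum>k<n. d k * cip m x (u k) * cip m (u k) y) =
     (\<Sum>i<m. \<Sum>j<m. cnj (x i) * (\<Sum>k<n. d k * u k i * cnj (u k j)) * y j)"
proof -
  have "(\<Sum>k<n. d k * cip m x (u k) * cip m (u k) y)
      = (\<Sum>k<n. \<Sum>i<m. \<Sum>j<m. cnj (x i) * (d k * u k i * cnj (u k j)) * y j)"
    by (simp add: cip_def sum_distrib_left sum_distrib_right algebra_simps)
  also have "\<dots> = (\<Sum>i<m. \<Sum>k<n. \<Sum>j<m. cnj (x i) * (d k * u k i * cnj (u k j)) * y j)"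
    by (rule sum.swap)
  also have "\<dots> = (\<Sum>i<m. \<Sum>j<m. \<Sum>k<n. cnj (x i) * (d k * u k i * cnj (u k j)) * y j)"
    by (intro sum.cong refl sum.swap)
  finally show ?thesis
    by (simp add: sum_distrib_left sum_distrib_right)
qed

lemma parseval:
  assumes "orthonormal n u"
  shows "(\<Sum>k<n. cip n x (u k) * cip n (u k) y) = cip n x y"
proof -
  have "(\<Sum>k<n. cip n x (u k) * cip n (u k) y)
      = (\<Sum>i<n. \<Sum>j<n. cnj (x i) * (\<Sum>k<n. u k i * cnj (u k j)) * y j)"
    using cip_cip_sum[where d = "\<lambda>_. 1"] by simp
  also have "\<dots> = (\<Sum>i<n. \<Sum>j<n. cnj (x i) * ((if i = j then 1 else 0) * y j))"
    using orthonormal_rows[OF assms] by (intro sum.cong refl) (simp add: mult.assoc)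
  also have "\<dots> = cip n x y"
    unfolding cip_def sum_distrib_left[symmetric] by (intro sum.cong refl) (simp add: sum_delta_lessThan)
  finally show ?thesis .
qed

lemma sform_spmat:
  "sform n (spmat n u d) x y = (\<Sum>k<n. complex_of_real (d k) * cip n x (u k) * cip n (u k) y)"
  unfolding cip_cip_sum sform_def spmat_def ..

lemma sform_spmat_self: "sform n (spmat n u d) x x = complex_of_real (qval n u d x)"
proof -
  have "of_real (d k) * cip n x (u k) * cip n (u k) x = complex_of_real (d k * (cmod (cip n (u k) x))\<^sup>2)" for k
    by (simp add: mult.assoc cip_mult_self)
  then show ?thesis
    by (simp only: sform_spmat qval_def of_real_sum)
qed

lemma sform_cong: "(\<And>i j. i < n \<Longrightarrow> j < n \<Longrightarrow> M i j = M' i j) \<Longrightarrow> sform n M x y = sform n M' x y"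
  by (simp add: sform_def)

lemma sform_add: "sform n (\<lambda>i j. M i j + M' i j) x y = sform n M x y + sform n M' x y"
  by (simp add: sform_def algebra_simps sum.distrib)

lemma sform_scale: "sform n (\<lambda>i j. c * M i j) x y = c * sform n M x y"
  by (simp add: sform_def sum_distrib_left algebra_simps)

lemma qval_const:
  assumes "orthonormal n u"
  shows "qval n u (\<lambda>_. c) x = c * (\<Sum>i<n. (cmod (x i))\<^sup>2)"
proof -
  have "complex_of_real (\<Sum>k<n. (cmod (cip n (u k) x))\<^sup>2) = cip n x x"
    unfolding parseval[OF assms, of x x, symmetric] cip_mult_self by simp
  then have "(\<Sum>k<n. (cmod (cip n (u k) x))\<^sup>2) = (\<Sum>i<n. (cmod (x i))\<^sup>2)"
    unfolding cip_self of_real_eq_iff .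
  then show ?thesis
    by (simp add: qval_def sum_distrib_left[symmetric])
qed

lemma qval_mono: "(\<And>k. k < n \<Longrightarrow> d k \<le> e k) \<Longrightarrow> qval n u d x \<le> qval n u e x"
  unfolding qval_def by (intro sum_mono mult_right_mono) auto

lemma qval_add: "qval n u (\<lambda>k. d k + e k) x = qval n u d x + qval n u e x"
  by (simp add: qval_def algebra_simps sum.distrib)

lemma qval_scale: "qval n u (\<lambda>k. c * d k) x = c * qval n u d x"
  by (simp add: qval_def sum_distrib_left mult.assoc)

lemma qval_eigenvector:
  assumes "orthonormal n u" "k < n"
  shows "qval n u d (u k) = d k"
proof -
  have "qval n u d (u k) = (\<Sum>l<n. d l * (if l = k then 1 else 0))"
    using assms unfolding qval_def orthonormal_def by (intro sum.cong) auto
  then show ?thesis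
    using assms(2) by (simp add: sum_delta_lessThan)
qed

lemma norm_orthonormal:
  assumes "orthonormal n u" "k < n"
  shows "(\<Sum>i<n. (cmod (u k i))\<^sup>2) = 1"
proof -
  have "complex_of_real (\<Sum>i<n. (cmod (u k i))\<^sup>2) = complex_of_real 1"
    using assms unfolding orthonormal_def cip_self[symmetric] by simp
  then show ?thesis
    unfolding of_real_eq_iff .
qed

lemma spmat_hermitian: "cnj (spmat n u d i j) = spmat n u d j i"
  by (simp add: spmat_def algebra_simps)

lemma spmat_apply_eigenvector:
  assumes "orthonormal n u" "k < n"
  shows "(\<Sum>j<n. spmat n u d i j * u k j) = of_real (d k) * u k i"
proof -
  have "(\<Sum>j<n. spmat n u d i j * u k j) = (\<Sum>l<n. of_real (d l) * u l i * cip n (u l) (u k))"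
    unfolding spmat_def cip_def sum_distrib_left sum_distrib_right
    by (subst sum.swap) (simp add: mult.assoc)
  also have "\<dots> = (\<Sum>l<n. of_real (d l) * u l i * (if l = k then 1 else 0))"
    using assms unfolding orthonormal_def by (intro sum.cong) auto
  also have "\<dots> = of_real (d k) * u k i"
    using assms by (simp add: sum_delta_lessThan)
  finally show ?thesis .
qed

lemma orthonormal_expand:
  assumes "orthonormal n u" "i < n"
  shows "(\<Sum>k<n. u k i * cip n (u k) y) = y i"
proof -
  have "(\<Sum>k<n. u k i * cip n (u k) y) = (\<Sum>j<n. (\<Sum>k<n. u k i * cnj (u k j)) * y j)"
    unfolding cip_def sum_distrib_left sum_distrib_right
    by (subst sum.swap) (simp add: mult.assoc)
  also have "\<dots> = (\<Sum>j<n. (if i = j then 1 else 0) * y j)"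
    using orthonormal_rows[OF assms(1)] assms(2) by (intro sum.cong refl) simp
  finally show ?thesis
    using assms(2) by (simp add: sum_delta_lessThan)
qed

lemma sform_eq_cip: "sform n M x y = cip n x (\<lambda>i. \<Sum>j<n. M i j * y j)"
  by (simp add: sform_def cip_def sum_distrib_left mult.assoc)

lemma cip_scale_right: "cip n x (\<lambda>i. c * y i) = c * cip n x y"
  by (simp add: cip_def sum_distrib_left algebra_simps)

lemma cip_sum_right: "cip n x (\<lambda>i. \<Sum>l\<in>A. c l * y l i) = (\<Sum>l\<in>A. c l * cip n x (y l))"
  unfolding cip_def sum_distrib_left by (subst sum.swap) (simp add: algebra_simps)

lemma cip_sum_left: "cip n (\<lambda>i. \<Sum>l\<in>A. c l * x l i) y = (\<Sum>l\<in>A. cnj (c l) * cip n (x l) y)"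
  unfolding cip_def sum_distrib_left cnj_sum sum_distrib_right
  by (subst sum.swap) (simp add: algebra_simps)

lemma sform_sum_right: "sform n M x (\<lambda>i. \<Sum>l\<in>A. c l * y l i) = (\<Sum>l\<in>A. c l * sform n M x (y l))"
proof -
  have "sform n M x (\<lambda>i. \<Sum>l\<in>A. c l * y l i)
      = (\<Sum>i<n. \<Sum>l\<in>A. \<Sum>j<n. c l * (cnj (x i) * M i j * y l j))"
    unfolding sform_def sum_distrib_left
    by (intro sum.cong refl, subst sum.swap) (simp add: algebra_simps)
  also have "\<dots> = (\<Sum>l\<in>A. \<Sum>i<n. \<Sum>j<n. c l * (cnj (x i) * M i j * y l j))"
    by (rule sum.swap)
  finally show ?thesis
    by (simp add: sform_def sum_distrib_left)
qed

lemma cnj_sform: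
  assumes "\<And>i j. i < n \<Longrightarrow> j < n \<Longrightarrow> cnj (M i j) = M j i"
  shows "cnj (sform n M x y) = sform n M y x"
proof -
  have "cnj (sform n M x y) = (\<Sum>i<n. \<Sum>j<n. x i * M j i * cnj (y j))"
    unfolding sform_def cnj_sum using assms by (intro sum.cong refl) simp
  also have "\<dots> = sform n M y x"
    unfolding sform_def by (subst sum.swap) (simp add: algebra_simps)
  finally show ?thesis .
qed

section \<open>Diagonalization of Hermitian matrices by Householder reflections\<close>

text \<open>Column \<open>k\<close> of the reflection along \<open>w\<close>, which need not be
  normalized. For \<open>w = 0\<close> division by zero yields the identity, so the columns are
  orthonormal in every case.\<close>

definition householder :: "nat \<Rightarrow> (nat \<Rightarrow> complex) \<Rightarrow> nat \<Rightarrow> nat \<Rightarrow> complex" where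
  "householder n w k i = (if i = k then 1 else 0) - 2 * w i * cnj (w k) / cip n w w"

lemma orthonormal_householder: "orthonormal n (householder n w)"
  unfolding orthonormal_def
proof (intro allI impI)
  fix k l assume kl: "k < n" "l < n"
  define N where "N = cip n w w"
  have N: "cnj N = N" by (simp add: N_def cnj_cip)
  have "cnj (householder n w k i) * householder n w l i =
      (if i = k then 1 else 0) * (if i = l then 1 else 0)
      - 2 / N * (w i * cnj (w l) * (if i = k then 1 else 0))
      - 2 / N * (cnj (w i) * w k * (if i = l then 1 else 0))
      + 4 / N\<^sup>2 * w k * cnj (w l) * (cnj (w i) * w i)" for i
    by (simp add: householder_def N_def[symmetric] N power2_eq_square divide_inverse algebra_simps)
  then have "cip n (householder n w k) (householder n w l) =
      (\<Sum>i<n. (if i = k then 1 else 0) * (if i = l then 1 else 0))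
      - 2 / N * (\<Sum>i<n. w i * cnj (w l) * (if i = k then 1 else 0))
      - 2 / N * (\<Sum>i<n. cnj (w i) * w k * (if i = l then 1 else 0))
      + 4 / N\<^sup>2 * w k * cnj (w l) * N"
    by (simp only: cip_def N_def sum.distrib sum_subtractf sum_distrib_left)
  also have "\<dots> = (if k = l then 1 else 0) - 4 / N * (w k * cnj (w l)) + 4 / N\<^sup>2 * w k * cnj (w l) * N"
    by (simp only: sum_delta_lessThan[OF kl(1)] sum_delta_lessThan[OF kl(2)]) (simp add: algebra_simps)
  also have "\<dots> = (if k = l then 1 else 0)"
    by (cases "N = 0") (simp_all add: power2_eq_square)
  finally show "cip n (householder n w k) (householder n w l) = (if k = l then 1 else 0)" .
qed

text \<open>The last coordinate is made real by a phase factor. This is what allows a reflection to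
  carry the last unit vector to \<open>v\<close>: both vectors have norm 1, and their inner product
  has to be real.\<close>

lemma hermitian_eigenvector_exists:
  assumes herm: "\<And>i j. i < Suc n \<Longrightarrow> j < Suc n \<Longrightarrow> cnj (M i j) = M j i"
  shows "\<exists>v l. cip (Suc n) v v = 1 \<and> cnj (v n) = v n \<and>
    (\<forall>i<Suc n. (\<Sum>j<Suc n. M i j * v j) = complex_of_real l * v i)"
proof -
  define A where "A = mat (Suc n) (Suc n) (\<lambda>(i, j). M i j)"
  have A: "A \<in> carrier_mat (Suc n) (Suc n)" by (simp add: A_def)
  from spectrum_non_empty[OF A] obtain z where "z \<in> spectrum A" by auto
  then obtain y where "eigenvector A y z"
    by (auto simp: spectrum_def eigenvalue_def)
  then have y: "y \<in> carrier_vec (Suc n)" "y \<noteq> 0\<^sub>v (Suc n)" "A *\<^sub>v y = z \<cdot>\<^sub>v y"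
    using A by (auto simp: eigenvector_def)
  define v where "v i = y $ i" for i
  have ev: "(\<Sum>j<Suc n. M i j * v j) = z * v i" if "i < Suc n" for i
  proof -
    have "(A *\<^sub>v y) $ i = (z \<cdot>\<^sub>v y) $ i" by (simp add: y(3))
    then show ?thesis
      using that y(1) by (simp add: A_def v_def scalar_prod_def lessThan_atLeast0 del: sum.op_ivl_Suc)
  qed
  define r where "r = (\<Sum>i<Suc n. (cmod (v i))\<^sup>2)"
  have "r > 0"
  proof -
    obtain i where "i < Suc n" "v i \<noteq> 0"
      using y(1,2) by (auto simp: v_def vec_eq_iff)
    then show ?thesis
      unfolding r_def by (intro sum_pos2[of _ i]) auto
  qed
  have cvv: "cip (Suc n) v v = of_real r"
    by (simp only: cip_self r_def)
  have "sform (Suc n) M v v = z * of_real r"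
    unfolding sform_eq_cip cvv[symmetric] cip_scale_right[symmetric] using ev by (intro cip_cong) auto
  then have "cnj z * of_real r = z * of_real r"
    using cnj_sform[of "Suc n" M v v] herm by (metis complex_cnj_complex_of_real complex_cnj_mult)
  then have "cnj z = z" using \<open>r > 0\<close> by simp
  then have z: "z = of_real (Re z)" by (simp add: complex_eq_iff)
  define p where "p = (if v n = 0 then 1 else cnj (v n) / cmod (v n))"
  have p: "cmod p = 1" "cnj (p * v n) = p * v n"
    by (auto simp: p_def norm_divide mult.commute)
  define c where "c = p / sqrt r"
  have cc: "cnj c * c = of_real (1 / r)"
  proof -
    have "cmod c ^ 2 = 1 / r"
      using p \<open>r > 0\<close> by (simp add: c_def norm_divide power_divide)
    then show ?thesis
      by (metis complex_norm_square mult.commute)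
  qed
  let ?v = "\<lambda>i. c * v i"
  have "cip (Suc n) ?v ?v = (cnj c * c) * cip (Suc n) v v"
    unfolding cip_def sum_distrib_left by (intro sum.cong refl) (simp add: algebra_simps)
  then have "cip (Suc n) ?v ?v = 1"
    unfolding cc cvv using \<open>r > 0\<close> by (simp flip: of_real_mult)
  moreover have "cnj (?v n) = ?v n"
    using p(2) by (simp add: c_def)
  moreover have "(\<Sum>j<Suc n. M i j * ?v j) = of_real (Re z) * ?v i" if "i < Suc n" for i
  proof -
    have "(\<Sum>j<Suc n. M i j * ?v j) = c * (\<Sum>j<Suc n. M i j * v j)"
      unfolding sum_distrib_left by (intro sum.cong refl) (simp add: algebra_simps)
    then show ?thesis unfolding ev[OF that] using z by simp
  qed
  ultimately show ?thesis by blast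
qed

text \<open>Reflection along the difference of two unit vectors with real inner product exchanges
  them. Here \<open>N = 2 - 2 * v n = - 2 * cnj (w n)\<close>, so the last column is the unit vector
  plus \<open>w\<close>. If \<open>N = 0\<close>, then \<open>v\<close> is that unit vector
  already.\<close>

lemma householder_last_column:
  assumes "cip (Suc n) v v = 1" "cnj (v n) = v n" "i < Suc n"
  shows "householder (Suc n) (\<lambda>i. v i - (if i = n then 1 else 0)) n i = v i"
proof -
  define w where "w = (\<lambda>i. v i - (if i = n then 1 else 0))"
  define N where "N = cip (Suc n) w w"
  have "cnj (w i) * w i = cnj (v i) * v i - cnj (v i) * (if i = n then 1 else 0)
      - v i * (if i = n then 1 else 0) + (if i = n then 1 else 0)" for i
    by (simp add: w_def algebra_simps)
  then have "N = cip (Suc n) v v - (\<Sum>i<Suc n. cnj (v i) * (if i = n then 1 else 0))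
      - (\<Sum>i<Suc n. v i * (if i = n then 1 else 0)) + (\<Sum>i<Suc n. (if i = n then 1 else 0))"
    unfolding N_def cip_def by (simp only: sum.distrib sum_subtractf)
  also have "\<dots> = 2 - 2 * v n"
    using assms by (simp add: sum_delta_lessThan(4) del: sum.lessThan_Suc)
  finally have N: "N = 2 - 2 * v n" .
  have wn: "cnj (w n) = - N / 2"
    using assms(2) by (simp add: w_def N)
  show ?thesis
  proof (cases "N = 0")
    case False
    then show ?thesis
      unfolding w_def[symmetric] householder_def wn N_def[symmetric] by (simp add: w_def field_simps)
  next
    case True
    then have "complex_of_real (\<Sum>i<Suc n. (cmod (w i))\<^sup>2) = of_real 0"
      unfolding N_def cip_self by simp
    then have "(\<Sum>i<Suc n. (cmod (w i))\<^sup>2) = 0"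
      unfolding of_real_eq_iff .
    then have "\<forall>i\<in>{..<Suc n}. (cmod (w i))\<^sup>2 = 0"
      by (subst (asm) sum_nonneg_eq_0_iff) auto
    then have "w i = 0" using assms(3) by auto
    then show ?thesis
      unfolding w_def[symmetric] householder_def by (simp add: w_def)
  qed
qed

lemma hermitian_eigenbasis_exists:
  assumes "\<And>i j. i < n \<Longrightarrow> j < n \<Longrightarrow> cnj (M i j) = M j i"
  shows "\<exists>u d. orthonormal n u \<and> (\<forall>k<n. \<forall>i<n. (\<Sum>j<n. M i j * u k j) = complex_of_real (d k) * u k i)"
  using assms
proof (induction n arbitrary: M)
  case 0
  show ?case by (auto simp: orthonormal_def)
next
  case (Suc n)
  note herm = Suc.prems
  obtain v \<mu> where v: "cip (Suc n) v v = 1" "cnj (v n) = v n"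
    and ev: "\<And>i. i < Suc n \<Longrightarrow> (\<Sum>j<Suc n. M i j * v j) = complex_of_real \<mu> * v i"
    using hermitian_eigenvector_exists[of n M, OF herm] by blast
  define H where "H = householder (Suc n) (\<lambda>i. v i - (if i = n then 1 else 0))"
  have H: "orthonormal (Suc n) H"
    unfolding H_def by (rule orthonormal_householder)
  have Hn: "H n i = v i" if "i < Suc n" for i
    unfolding H_def using householder_last_column[OF v that] .
  have HH: "cip (Suc n) (H k) (H l) = (if k = l then 1 else 0)" if "k < Suc n" "l < Suc n" for k l
    using H that unfolding orthonormal_def by blast
  \<comment> \<open>Deflation: \<open>M'\<close> is the compression of \<open>M\<close> to the
    orthogonal complement of \<open>v\<close>, which is spanned by the first \<open>n\<close>
    columns of the reflection.\<close>
  define M' where "M' k l = sform (Suc n) M (H k) (H l)" for k l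
  have "cnj (M' k l) = M' l k" for k l
    unfolding M'_def by (rule cnj_sform) (rule herm)
  then obtain u' d' where u': "orthonormal n u'"
    and d': "\<And>k i. k < n \<Longrightarrow> i < n \<Longrightarrow> (\<Sum>j<n. M' i j * u' k j) = complex_of_real (d' k) * u' k i"
    using Suc.IH[of M'] by blast
  define u where "u k i = (if k < n then \<Sum>l<n. u' k l * H l i else v i)" for k i
  define d where "d k = (if k < n then d' k else \<mu>)" for k
  have uk: "u k = (\<lambda>i. \<Sum>l<n. u' k l * H l i)" if "k < n" for k
    using that by (auto simp: u_def)
  have cHu: "cip (Suc n) (H l) (u k) = (if l < n then u' k l else 0)" if "l < Suc n" "k < n" for l k
  proof -
    have "cip (Suc n) (H l) (u k) = (\<Sum>l'<n. u' k l' * (if l = l' then 1 else 0))"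
      unfolding uk[OF that(2)] cip_sum_right using HH that by (intro sum.cong refl) simp
    also have "\<dots> = (if l < n then u' k l else 0)"
    proof (cases "l < n")
      case True then show ?thesis by (simp add: sum_delta_lessThan)
    next
      case False then show ?thesis by (simp add: sum.neutral)
    qed
    finally show ?thesis .
  qed
  have vH: "cip (Suc n) v y = cip (Suc n) (H n) y" for y
    by (rule cip_cong) (simp_all add: Hn)
  have vu: "cip (Suc n) v (u k) = 0" if "k < n" for k
    unfolding vH using cHu[of n k] that by simp
  have uu: "cip (Suc n) (u k) (u m) = (if k = m then 1 else 0)" if "k < n" "m < n" for k m
  proof -
    have "cip (Suc n) (u k) (u m) = (\<Sum>l<n. cnj (u' k l) * cip (Suc n) (H l) (u m))"
      unfolding uk[OF that(1)] cip_sum_left ..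
    also have "\<dots> = cip n (u' k) (u' m)"
      unfolding cip_def[of n] using cHu that by (intro sum.cong refl) simp
    finally show ?thesis
      using u' that by (simp add: orthonormal_def)
  qed
  have un: "u n = v" by (auto simp: u_def)
  have "orthonormal (Suc n) u"
    unfolding orthonormal_def
  proof (intro allI impI)
    fix k m assume km: "k < Suc n" "m < Suc n"
    have "cip (Suc n) (u k) v = 0" if "k < n" for k
      using vu[OF that] cnj_cip[of "Suc n" v "u k"] by simp
    then show "cip (Suc n) (u k) (u m) = (if k = m then 1 else 0)"
      using km uu[of k m] vu[of m] v(1) by (auto simp: less_Suc_eq un)
  qed
  moreover have "(\<Sum>j<Suc n. M i j * u k j) = complex_of_real (d k) * u k i" if "k < Suc n" "i < Suc n" for k i
  proof (cases "k < n")
    case False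
    then have "k = n" using that by simp
    then show ?thesis using ev[OF that(2)] by (simp add: un d_def)
  next
    case True
    define y where "y = (\<lambda>i. \<Sum>j<Suc n. M i j * u k j)"
    have y: "cip (Suc n) (H l) y = (if l < n then of_real (d' k) * u' k l else 0)" if "l < Suc n" for l
    proof -
      have sf: "cip (Suc n) x y = sform (Suc n) M x (u k)" for x
        by (simp only: y_def sform_eq_cip)
      show ?thesis
      proof (cases "l < n")
        case l: True
        have "sform (Suc n) M (H l) (u k) = (\<Sum>l'<n. u' k l' * M' l l')"
          unfolding uk[OF True] sform_sum_right M'_def ..
        then show ?thesis using d'[OF True l] l unfolding sf by (simp add: mult.commute)
      next
        case False
        then have "l = n" using that by simp
        \<comment> \<open>The complement of an eigenvector is invariant under a Hermitian matrix, so
          the component of \<open>M\<close> applied to \<open>u k\<close> along \<open>v\<close>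
          vanishes.\<close>
        have "sform (Suc n) M v (u k) = cnj (sform (Suc n) M (u k) v)"
          using cnj_sform[of "Suc n" M "u k" v] herm by simp
        also have "sform (Suc n) M (u k) v = cip (Suc n) (u k) (\<lambda>i. of_real \<mu> * v i)"
          unfolding sform_eq_cip using ev by (intro cip_cong) auto
        also have "\<dots> = 0"
          unfolding cip_scale_right cnj_cip[of _ v "u k", symmetric] using vu[OF True] by simp
        finally show ?thesis
          using vH[of y] sf[of v] by (simp add: \<open>l = n\<close>)
      qed
    qed
    have "y i = (\<Sum>l<Suc n. H l i * cip (Suc n) (H l) y)"
      using orthonormal_expand[OF H that(2)] by simp
    also have "\<dots> = (\<Sum>l<n. H l i * (of_real (d' k) * u' k l))"
      using y by simp
    also have "\<dots> = of_real (d k) * u k i"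
      using True by (simp add: d_def u_def sum_distrib_left algebra_simps)
    finally show ?thesis by (simp only: y_def)
  qed
  ultimately show ?case by blast
qed

lemma spectral_theorem:
  assumes "\<And>i j. i < n \<Longrightarrow> j < n \<Longrightarrow> cnj (M i j) = M j i"
  shows "\<exists>u d. orthonormal n u \<and> (\<forall>i<n. \<forall>j<n. spmat n u d i j = M i j)"
proof -
  obtain u d where u: "orthonormal n u"
    and d: "\<And>k i. k < n \<Longrightarrow> i < n \<Longrightarrow> (\<Sum>j<n. M i j * u k j) = complex_of_real (d k) * u k i"
    using hermitian_eigenbasis_exists[of n M, OF assms] by blast
  have "spmat n u d i j = M i j" if "i < n" "j < n" for i j
  proof -
    have "spmat n u d i j = (\<Sum>k<n. (\<Sum>l<n. M i l * u k l) * cnj (u k j))"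
      unfolding spmat_def using d that by (intro sum.cong refl) simp
    also have "\<dots> = (\<Sum>l<n. M i l * (\<Sum>k<n. u k l * cnj (u k j)))"
      unfolding sum_distrib_left sum_distrib_right by (subst sum.swap) (simp add: mult.assoc)
    also have "\<dots> = (\<Sum>l<n. M i l * (if l = j then 1 else 0))"
      using orthonormal_rows[OF u] that by (intro sum.cong refl) simp
    finally show ?thesis using that by (simp add: sum_delta_lessThan)
  qed
  then show ?thesis using u by blast
qed

section \<open>The remainder of the first-order expansion of the functional calculus\<close>

lemma sum_rotate: "(\<Sum>k\<in>A. \<Sum>i\<in>B. \<Sum>j\<in>C. g k i j) = (\<Sum>i\<in>B. \<Sum>j\<in>C. \<Sum>k\<in>A. g k i j)"
proof -
  have "(\<Sum>k\<in>A. \<Sum>i\<in>B. \<Sum>j\<in>C. g k i j) = (\<Sum>i\<in>B. \<Sum>k\<in>A. \<Sum>j\<in>C. g k i j)"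
    by (rule sum.swap)
  also have "\<dots> = (\<Sum>i\<in>B. \<Sum>j\<in>C. \<Sum>k\<in>A. g k i j)"
    by (intro sum.cong refl sum.swap)
  finally show ?thesis .
qed

lemma Re_cnj_mult_self: "Re (cnj w * w) = (cmod w)\<^sup>2"
  by (simp add: cmod_power2) (simp add: power2_eq_square)

lemma cmod_sum_square: "(cmod (\<Sum>i\<in>A. z i))\<^sup>2 = (\<Sum>i\<in>A. \<Sum>j\<in>A. Re (cnj (z i) * z j))"
  by (simp only: Re_cnj_mult_self[symmetric] cnj_sum sum_product Re_sum)

text \<open>The deviation of \<open>f\<close> at \<open>a\<close> from the line through the points
  of its graph over \<open>s\<close> and \<open>t\<close>; for distinct points,
  \<open>(a - s) * (a - t)\<close> times the second divided difference of \<open>f\<close> at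
  \<open>a\<close>, \<open>s\<close>, \<open>t\<close>.\<close>

definition chord_rem :: "(real \<Rightarrow> real) \<Rightarrow> real \<Rightarrow> real \<Rightarrow> real \<Rightarrow> real" where
  "chord_rem f a s t = f a - f s - div_diff f s t * (a - s)"

text \<open>\<open>dk_form n f u d x M\<close> is \<open>\<langle>x, Df(A)[M] x\<rangle>\<close> for \<open>A = spmat n u d\<close>, given by the
  Daleckii--Krein formula in the eigenbasis of \<open>A\<close>.\<close>

definition dk_form :: "nat \<Rightarrow> (real \<Rightarrow> real) \<Rightarrow> (nat \<Rightarrow> nat \<Rightarrow> complex) \<Rightarrow> (nat \<Rightarrow> real) \<Rightarrow>
    (nat \<Rightarrow> complex) \<Rightarrow> (nat \<Rightarrow> nat \<Rightarrow> complex) \<Rightarrow> real" where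
  "dk_form n f u d x M = (\<Sum>i<n. \<Sum>j<n. div_diff f (d i) (d j) *
     Re (cnj (cip n (u i) x) * cip n (u j) x * sform n M (u i) (u j)))"

lemma div_diff_commute: "div_diff f s t = div_diff f t s"
  by (simp add: div_diff_def) (metis minus_diff_eq minus_divide_divide)

lemma dk_form_cong:
  "(\<And>i j. i < n \<Longrightarrow> j < n \<Longrightarrow> M i j = M' i j) \<Longrightarrow> dk_form n f u d x M = dk_form n f u d x M'"
  using sform_cong[of n M M'] by (simp add: dk_form_def)

lemma dk_form_combine:
  "dk_form n f u d x (\<lambda>i j. complex_of_real a * M i j + complex_of_real b * M' i j)
     = a * dk_form n f u d x M + b * dk_form n f u d x M'"
proof -
  have "Re (p * sform n (\<lambda>i j. complex_of_real a * M i j + complex_of_real b * M' i j) y z)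
      = a * Re (p * sform n M y z) + b * Re (p * sform n M' y z)" for p y z
    unfolding sform_add sform_scale by (simp add: algebra_simps)
  then show ?thesis
    by (simp only: dk_form_def distrib_left sum.distrib sum_distrib_left mult.left_commute)
qed

text \<open>With \<open>A = spmat n u d\<close> and \<open>B = spmat n v e\<close>, the remainder \<open>f(B) - f(A) - Df(A)[B - A]\<close>
  is the sum over the eigenvalues \<open>b\<close> of \<open>B\<close> of congruences of the matrices
  \<open>[chord_rem f b (d i) (d j)]\<close>. No estimate is involved, so this identity serves both to
  compare convexity with positivity of these matrices and to differentiate the functional calculus.\<close>

lemma qval_diff_eq:
  fixes x :: "nat \<Rightarrow> complex"
  assumes u: "orthonormal n u" and v: "orthonormal n v"
  defines "\<zeta> k i \<equiv> cip n (v k) (u i) * cip n (u i) x"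
  shows "qval n v (\<lambda>k. f (e k)) x - qval n u (\<lambda>k. f (d k)) x
      - (dk_form n f u d x (spmat n v e) - dk_form n f u d x (spmat n u d))
    = (\<Sum>k<n. \<Sum>i<n. \<Sum>j<n. chord_rem f (e k) (d i) (d j) * Re (cnj (\<zeta> k i) * \<zeta> k j))"
proof -
  define \<xi> where "\<xi> i = cip n (u i) x" for i
  define R where "R k i j = Re (cnj (\<zeta> k i) * \<zeta> k j)" for k i j
  have cz: "cnj (\<zeta> k i) * \<zeta> k j = cnj (\<xi> i) * \<xi> j * (cip n (u i) (v k) * cip n (v k) (u j))" for k i j
    by (simp add: \<zeta>_def \<xi>_def cnj_cip mult_ac)
  \<comment> \<open>All terms of the identity are moments of \<open>R\<close>: the sum over
    \<open>i\<close> and \<open>j\<close> uses completeness of \<open>u\<close>, and the sums over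
    \<open>k\<close> with weights 1 and \<open>e k\<close> use completeness of \<open>v\<close> and
    the spectral form of \<open>B\<close>.\<close>
  have r1: "(cmod (cip n (v k) x))\<^sup>2 = (\<Sum>i<n. \<Sum>j<n. R k i j)" for k
    unfolding parseval[OF u, of "v k" x, symmetric] cmod_sum_square R_def \<zeta>_def ..
  have r2: "(\<Sum>k<n. R k i j) = (if i = j then (cmod (\<xi> i))\<^sup>2 else 0)" if "i < n" "j < n" for i j
  proof -
    have "(\<Sum>k<n. cnj (\<zeta> k i) * \<zeta> k j) = cnj (\<xi> i) * \<xi> j * cip n (u i) (u j)"
      unfolding cz sum_distrib_left[symmetric] parseval[OF v] ..
    then have "(\<Sum>k<n. R k i j) = Re (cnj (\<xi> i) * \<xi> j * cip n (u i) (u j))"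
      unfolding R_def Re_sum[symmetric] by simp
    moreover have "cip n (u i) (u j) = (if i = j then 1 else 0)"
      using u that unfolding orthonormal_def by blast
    ultimately show ?thesis
      using Re_cnj_mult_self[of "\<xi> i"] by auto
  qed
  have r3: "(\<Sum>k<n. e k * R k i j) = Re (cnj (\<xi> i) * \<xi> j * sform n (spmat n v e) (u i) (u j))" for i j
  proof -
    have "e k * R k i j = Re (cnj (\<xi> i) * \<xi> j * (of_real (e k) * cip n (u i) (v k) * cip n (v k) (u j)))" for k
    proof -
      have "cnj (\<xi> i) * \<xi> j * (of_real (e k) * cip n (u i) (v k) * cip n (v k) (u j)) = of_real (e k) * (cnj (\<zeta> k i) * \<zeta> k j)"
        unfolding cz by (simp add: mult_ac)
      moreover have "r * Re z = Re (of_real r * z)" for r z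
        by simp
      ultimately show ?thesis by (simp only: R_def)
    qed
    then show ?thesis
      by (simp only: sform_spmat sum_distrib_left Re_sum)
  qed
  have r4: "sform n (spmat n u d) (u i) (u j) = (if i = j then complex_of_real (d i) else 0)"
    if "i < n" "j < n" for i j
  proof -
    have "sform n (spmat n u d) (u i) (u j)
        = (\<Sum>k<n. complex_of_real (d k) * (if i = k then 1 else 0) * (if k = j then 1 else 0))"
      unfolding sform_spmat using u that unfolding orthonormal_def by (intro sum.cong refl) auto
    then show ?thesis using that by (simp add: sum_delta_lessThan)
  qed
  have q1: "qval n v (\<lambda>k. f (e k)) x = (\<Sum>k<n. \<Sum>i<n. \<Sum>j<n. f (e k) * R k i j)"
    unfolding qval_def r1 sum_distrib_left ..
  have q2: "qval n u (\<lambda>k. f (d k)) x = (\<Sum>i<n. \<Sum>j<n. f (d i) * (\<Sum>k<n. R k i j))"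
    by (simp add: qval_def r2 \<xi>_def[symmetric] if_distrib cong: if_cong)
  have q3: "dk_form n f u d x (spmat n v e) = (\<Sum>i<n. \<Sum>j<n. div_diff f (d i) (d j) * (\<Sum>k<n. e k * R k i j))"
    unfolding r3 dk_form_def \<xi>_def ..
  have q4: "dk_form n f u d x (spmat n u d) = (\<Sum>i<n. \<Sum>j<n. div_diff f (d i) (d j) * d i * (\<Sum>k<n. R k i j))"
    unfolding dk_form_def
    by (intro sum.cong refl) (auto simp: r4 r2 \<xi>_def[symmetric] Re_cnj_mult_self[symmetric] algebra_simps)
  have "(\<Sum>k<n. \<Sum>i<n. \<Sum>j<n. chord_rem f (e k) (d i) (d j) * R k i j)
      = (\<Sum>k<n. \<Sum>i<n. \<Sum>j<n. f (e k) * R k i j) - (\<Sum>k<n. \<Sum>i<n. \<Sum>j<n. f (d i) * R k i j)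
        - ((\<Sum>k<n. \<Sum>i<n. \<Sum>j<n. div_diff f (d i) (d j) * (e k * R k i j))
           - (\<Sum>k<n. \<Sum>i<n. \<Sum>j<n. div_diff f (d i) (d j) * d i * R k i j))"
    unfolding sum_subtractf[symmetric] chord_rem_def by (intro sum.cong refl) (simp add: algebra_simps)
  also have "\<dots> = qval n v (\<lambda>k. f (e k)) x - qval n u (\<lambda>k. f (d k)) x
      - (dk_form n f u d x (spmat n v e) - dk_form n f u d x (spmat n u d))"
    unfolding q1 q2 q3 q4 sum_distrib_left
    by (simp only: sum_rotate[where g = "\<lambda>k i j. f (d i) * R k i j"]
      sum_rotate[where g = "\<lambda>k i j. div_diff f (d i) (d j) * (e k * R k i j)"]
      sum_rotate[where g = "\<lambda>k i j. div_diff f (d i) (d j) * d i * R k i j"])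
  finally show ?thesis by (simp add: R_def)
qed

section \<open>Convexity and the remainder kernel\<close>

text \<open>Diagonalizations of both matrices and of their combination are quantified, so that none
  has to be chosen. Positivity of the eigenvalues \<open>c k\<close> is presupposed here and derived
  only where matrices are translated.\<close>

definition spectral_convex :: "nat \<Rightarrow> (real \<Rightarrow> real) \<Rightarrow> bool" where
  "spectral_convex n f \<longleftrightarrow> (\<forall>u d v e w c l x. orthonormal n u \<and> orthonormal n v \<and> orthonormal n w \<and>
     (\<forall>k<n. 0 < d k \<and> 0 < e k \<and> 0 < c k) \<and> 0 < l \<and> l < 1 \<and>
     (\<forall>i<n. \<forall>j<n. spmat n w c i j = complex_of_real l * spmat n u d i j + complex_of_real (1 - l) * spmat n v e i j)
     \<longrightarrow> qval n w (\<lambda>k. f (c k)) x \<le> l * qval n u (\<lambda>k. f (d k)) x + (1 - l) * qval n v (\<lambda>k. f (e k)) x)"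

text \<open>The kernel is real and symmetric in its last two arguments, so the imaginary parts
  cancel and the sum of real parts is the full quadratic form.\<close>

definition chord_rem_psd :: "nat \<Rightarrow> (real \<Rightarrow> real) \<Rightarrow> bool" where
  "chord_rem_psd n f \<longleftrightarrow> (\<forall>d a z. (\<forall>i<n. 0 < d i) \<and> 0 < a \<longrightarrow>
     0 \<le> (\<Sum>i<n. \<Sum>j<n. chord_rem f a (d i) (d j) * Re (cnj (z i) * z j)))"

text \<open>Positive remainders put \<open>f\<close> above its tangents. With both tangents taken at
  the convex combination itself, the weighted first-order terms cancel, because
  \<open>dk_form\<close> is linear in the direction.\<close>

lemma spectral_convex_if_chord_rem_psd:
  assumes psd: "chord_rem_psd n f"
  shows "spectral_convex n f"
  unfolding spectral_convex_def
proof (intro allI impI, elim conjE)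
  fix u d v e w c and l :: real and x
  assume on: "orthonormal n u" "orthonormal n v" "orthonormal n w"
    and pos: "\<forall>k<n. 0 < d k \<and> 0 < e k \<and> 0 < c k" and l: "0 < l" "l < 1"
    and eq: "\<forall>i<n. \<forall>j<n. spmat n w c i j = complex_of_real l * spmat n u d i j + complex_of_real (1 - l) * spmat n v e i j"
  have tangent: "0 \<le> qval n v' (\<lambda>k. f (e' k)) x - qval n w (\<lambda>k. f (c k)) x
      - (dk_form n f w c x (spmat n v' e') - dk_form n f w c x (spmat n w c))"
    if "orthonormal n v'" "\<And>k. k < n \<Longrightarrow> 0 < e' k" for v' e'
    unfolding qval_diff_eq[OF on(3) that(1)]
  proof (rule sum_nonneg)
    fix k assume "k \<in> {..<n}"
    then show "0 \<le> (\<Sum>i<n. \<Sum>j<n. chord_rem f (e' k) (c i) (c j) *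
        Re (cnj (cip n (v' k) (w i) * cip n (w i) x) * (cip n (v' k) (w j) * cip n (w j) x)))"
      using that(2) pos
      by (intro psd[unfolded chord_rem_psd_def, rule_format, where z = "\<lambda>i. cip n (v' k) (w i) * cip n (w i) x"]) auto
  qed
  have "dk_form n f w c x (spmat n w c) = l * dk_form n f w c x (spmat n u d) + (1 - l) * dk_form n f w c x (spmat n v e)"
    unfolding dk_form_combine[symmetric] using eq by (intro dk_form_cong) blast
  moreover have "0 \<le> l * (qval n u (\<lambda>k. f (d k)) x - qval n w (\<lambda>k. f (c k)) x
      - (dk_form n f w c x (spmat n u d) - dk_form n f w c x (spmat n w c)))
    + (1 - l) * (qval n v (\<lambda>k. f (e k)) x - qval n w (\<lambda>k. f (c k)) x
      - (dk_form n f w c x (spmat n v e) - dk_form n f w c x (spmat n w c)))"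
    using tangent[OF on(1)] tangent[OF on(2)] pos l by (intro add_nonneg_nonneg mult_nonneg_nonneg) auto
  ultimately show "qval n w (\<lambda>k. f (c k)) x \<le> l * qval n u (\<lambda>k. f (d k)) x + (1 - l) * qval n v (\<lambda>k. f (e k)) x"
    by (simp add: algebra_simps)
qed

section \<open>First-order perturbation and the tangent inequality\<close>

lemma continuous_on_div_diff:
  assumes diff: "\<And>t. t > 0 \<Longrightarrow> (f has_real_derivative deriv f t) (at t)" and p: "p > 0"
  shows "continuous_on {0<..} (\<lambda>t. div_diff f t p)"
proof (intro continuous_at_imp_continuous_on ballI)
  fix t :: real assume "t \<in> {0<..}"
  then have t: "t > 0" by simp
  show "isCont (\<lambda>t. div_diff f t p) t"
  proof (cases "t = p")
    case True
    have "((\<lambda>y. (f y - f p) / (y - p)) \<longlongrightarrow> deriv f p) (at p)"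
      using diff[OF p] by (simp add: has_field_derivative_iff)
    moreover have "\<forall>\<^sub>F y in at p. (f y - f p) / (y - p) = div_diff f y p"
      by (simp add: eventually_at_filter div_diff_def)
    ultimately have "((\<lambda>y. div_diff f y p) \<longlongrightarrow> deriv f p) (at p)"
      by (rule Lim_transform_eventually)
    then show ?thesis
      by (simp add: True isCont_def) (simp add: div_diff_def)
  next
    case False
    have "isCont f t" using diff[OF t] by (rule DERIV_isCont)
    then have "isCont (\<lambda>y. (f y - f p) / (y - p)) t"
      using False by (intro continuous_intros) auto
    moreover have "\<forall>\<^sub>F y in nhds t. div_diff f y p = (f y - f p) / (y - p)"
      using t1_space_nhds[OF False] by eventually_elim (simp add: div_diff_def)
    ultimately show ?thesis
      by (simp add: isCont_cong)
  qed
qed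

text \<open>Beyond distance \<open>\<delta>\<close> the crude bound \<open>2 * B\<close> is at most
  \<open>2 * B / \<delta>\<close> times the distance. The linear term is the purpose: differences of
  eigenvalues can later be paid for by small overlaps of eigenvectors.\<close>

lemma continuous_on_linear_modulus:
  fixes h :: "real \<Rightarrow> real"
  assumes "continuous_on {a..b} h" "p \<in> {a..b}" "\<epsilon> > 0"
  shows "\<exists>C\<ge>0. \<forall>t\<in>{a..b}. \<bar>h t - h p\<bar> \<le> \<epsilon> + C * \<bar>t - p\<bar>"
proof -
  have "bounded (h ` {a..b})"
    using assms(1) by (intro compact_imp_bounded compact_continuous_image) auto
  then obtain B where B': "\<forall>t\<in>{a..b}. \<bar>h t\<bar> \<le> B"
    by (auto simp: bounded_iff)
  have B: "\<bar>h t\<bar> \<le> B" if "t \<in> {a..b}" for t using B' that by blast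
  have B0: "B \<ge> 0" using B[OF assms(2)] by linarith
  obtain \<delta> where \<delta>: "\<delta> > 0" "\<And>t. t \<in> {a..b} \<Longrightarrow> \<bar>t - p\<bar> < \<delta> \<Longrightarrow> \<bar>h t - h p\<bar> < \<epsilon>"
    using assms unfolding continuous_on_iff dist_real_def by blast
  have "\<bar>h t - h p\<bar> \<le> \<epsilon> + 2 * B / \<delta> * \<bar>t - p\<bar>" if "t \<in> {a..b}" for t
  proof (cases "\<bar>t - p\<bar> < \<delta>")
    case True
    then show ?thesis using \<delta>(2)[OF that] \<delta>(1) B0 by (smt (verit) divide_nonneg_pos mult_nonneg_nonneg)
  next
    case False
    have "2 * B \<le> 2 * B / \<delta> * \<bar>t - p\<bar>"
      using False \<delta>(1) B0 by (simp add: field_simps mult_left_mono)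
    then show ?thesis using B[OF that] B[OF assms(2)] assms(3) by linarith
  qed
  then show ?thesis using \<delta>(1) B0 by (intro exI[of _ "2 * B / \<delta>"]) auto
qed

lemma cmod_orthonormal_le_1:
  assumes "orthonormal n u" "k < n" "i < n"
  shows "cmod (u k i) \<le> 1"
proof -
  have "(cmod (u k i))\<^sup>2 \<le> (\<Sum>i<n. (cmod (u k i))\<^sup>2)"
    using assms(3) by (intro member_le_sum) auto
  then show ?thesis
    using norm_orthonormal[OF assms(1,2)] by (simp add: power2_le_iff_abs_le abs_square_le_1)
qed

lemma cmod_sform_orthonormal_le:
  assumes "orthonormal n u" "orthonormal n v" "k < n" "l < n"
  shows "cmod (sform n H (u k) (v l)) \<le> (\<Sum>i<n. \<Sum>j<n. cmod (H i j))"
  unfolding sform_def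
proof (intro sum_norm_le)
  fix i j assume "i \<in> {..<n}" "j \<in> {..<n}"
  then have "cmod (u k i) \<le> 1" "cmod (v l j) \<le> 1"
    using cmod_orthonormal_le_1 assms by auto
  then have "cmod (u k i) * cmod (H i j) * cmod (v l j) \<le> 1 * cmod (H i j) * 1"
    by (intro mult_mono) auto
  then show "cmod (cnj (u k i) * H i j * v l j) \<le> cmod (H i j)"
    by (simp add: norm_mult)
qed

lemma sform_eigenvector_right:
  assumes "orthonormal n v" "k < n"
  shows "sform n (spmat n v e) x (v k) = of_real (e k) * cip n x (v k)"
  unfolding sform_eq_cip spmat_apply_eigenvector[OF assms] by (rule cip_scale_right)

lemma sform_eigenvector_left:
  assumes "orthonormal n u" "k < n"
  shows "sform n (spmat n u d) (u k) x = of_real (d k) * cip n (u k) x"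
proof -
  have "sform n (spmat n u d) (u k) x = cnj (sform n (spmat n u d) x (u k))"
    using cnj_sform[of n "spmat n u d" x "u k"] spmat_hermitian by simp
  then show ?thesis
    unfolding sform_eigenvector_right[OF assms] by (simp add: cnj_cip)
qed

text \<open>The remainder is small because \<open>chord_rem\<close> has the factor \<open>e k - d i\<close>, while
  \<open>(e k - d i) \<langle>u i, v k\<rangle> = s \<langle>u i, H (v k)\<rangle>\<close>: either the eigenvalues are close or the
  eigenvectors are almost orthogonal.\<close>

lemma qval_perturbation:
  assumes diff: "\<And>t. t > 0 \<Longrightarrow> (f has_real_derivative deriv f t) (at t)"
    and u: "orthonormal n u" and a: "0 < a" and d: "\<And>k. k < n \<Longrightarrow> d k \<in> {a..b}" and \<epsilon>: "\<epsilon> > 0"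
  shows "\<exists>\<delta>>0. \<forall>v e s. orthonormal n v \<longrightarrow> (\<forall>k<n. e k \<in> {a..b}) \<longrightarrow> \<bar>s\<bar> < \<delta> \<longrightarrow>
     (\<forall>i<n. \<forall>j<n. spmat n v e i j = spmat n u d i j + complex_of_real s * H i j) \<longrightarrow>
     \<bar>qval n v (\<lambda>k. f (e k)) x - qval n u (\<lambda>k. f (d k)) x - s * dk_form n f u d x H\<bar> \<le> \<epsilon> * \<bar>s\<bar>"
proof -
  define B where "B = (\<Sum>i<n. \<Sum>j<n. cmod (H i j))"
  define X where "X = (\<Sum>i<n. cmod (cip n (u i) x))"
  define N where "N = real n * (real n * real n)"
  have B0: "B \<ge> 0" and X0: "X \<ge> 0" and N0: "N \<ge> 0"
    by (auto simp: B_def X_def N_def intro!: sum_nonneg)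
  \<comment> \<open>The remainder has \<open>N\<close> terms, each at most
    \<open>|s| * B * X^2 * (\<eta> + D * |s| * B)\<close>. Half of \<open>\<epsilon>\<close> is
    reserved for either summand; this fixes \<open>\<eta>\<close> now, and \<open>\<delta>\<close>
    once \<open>D\<close> is known.\<close>
  define P where "P = N * B * X\<^sup>2"
  have P0: "P \<ge> 0" using B0 X0 N0 by (simp add: P_def)
  define \<eta> where "\<eta> = \<epsilon> / (2 * (P + 1))"
  have \<eta>: "\<eta> > 0" using \<epsilon> P0 by (simp add: \<eta>_def)
  have P\<eta>: "P * \<eta> \<le> \<epsilon> / 2" using \<epsilon> P0 by (simp add: \<eta>_def field_simps)
  have "\<exists>C\<ge>0. \<forall>t\<in>{a..b}. \<bar>div_diff f t (d i) - div_diff f (d j) (d i)\<bar> \<le> \<eta> + C * \<bar>t - d j\<bar>"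
    if "i < n" "j < n" for i j
  proof (rule continuous_on_linear_modulus[OF _ d[OF that(2)] \<eta>])
    have "d i > 0" using d[OF that(1)] a by simp
    then show "continuous_on {a..b} (\<lambda>t. div_diff f t (d i))"
      using a by (intro continuous_on_subset[OF continuous_on_div_diff[OF diff]]) auto
  qed
  then obtain C where C0: "\<And>i j. i < n \<Longrightarrow> j < n \<Longrightarrow> C i j \<ge> 0"
    and C: "\<And>i j t. i < n \<Longrightarrow> j < n \<Longrightarrow> t \<in> {a..b} \<Longrightarrow>
      \<bar>div_diff f t (d i) - div_diff f (d j) (d i)\<bar> \<le> \<eta> + C i j * \<bar>t - d j\<bar>"
    by metis
  define D where "D = (\<Sum>i<n. \<Sum>j<n. C i j)"
  have D0: "D \<ge> 0" using C0 by (auto simp: D_def intro!: sum_nonneg)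
  have CD: "C i j \<le> D" if "i < n" "j < n" for i j
  proof -
    have "C i j \<le> (\<Sum>j<n. C i j)" using C0 that by (intro member_le_sum) auto
    also have "\<dots> \<le> D" unfolding D_def using C0 that by (intro member_le_sum) (auto intro!: sum_nonneg)
    finally show ?thesis .
  qed
  define \<delta> where "\<delta> = \<epsilon> / (2 * (P * D * B + 1))"
  have PDB: "P * D * B \<ge> 0" using P0 D0 B0 by simp
  have \<delta>: "\<delta> > 0" using \<epsilon> PDB by (simp add: \<delta>_def add_nonneg_pos)
  have P\<delta>: "P * D * B * \<delta> \<le> \<epsilon> / 2"
  proof -
    have "P * D * B * \<delta> = \<epsilon> / 2 * (P * D * B / (P * D * B + 1))" by (simp add: \<delta>_def)
    also have "\<dots> \<le> \<epsilon> / 2 * 1" using PDB \<epsilon> by (intro mult_left_mono) (auto simp: divide_le_eq)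
    finally show ?thesis by simp
  qed
  show ?thesis
  proof (intro exI[of _ \<delta>] conjI \<delta> allI impI)
    fix v e s
    assume v: "orthonormal n v" and e: "\<forall>k<n. e k \<in> {a..b}" and s: "\<bar>s\<bar> < \<delta>"
      and eq: "\<forall>i<n. \<forall>j<n. spmat n v e i j = spmat n u d i j + complex_of_real s * H i j"
    define \<zeta> where "\<zeta> k i = cip n (v k) (u i) * cip n (u i) x" for k i
    define W where "W i k = cmod (cip n (u i) (v k))" for i k
    have W1: "W i k \<le> 1" if "i < n" "k < n" for i k
    proof -
      have "(W i k)\<^sup>2 \<le> (\<Sum>i<n. (cmod (cip n (u i) (v k)))\<^sup>2)"
        unfolding W_def using that by (intro member_le_sum) auto
      also have "\<dots> = 1"
        using qval_const[OF u, of 1 "v k"] norm_orthonormal[OF v that(2)] by (simp add: qval_def)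
      finally show ?thesis by (simp add: W_def power2_le_iff_abs_le abs_square_le_1)
    qed
    have WB: "\<bar>e k - d i\<bar> * W i k \<le> \<bar>s\<bar> * B" if "i < n" "k < n" for i k
    proof -
      have "of_real (e k) * cip n (u i) (v k) = sform n (spmat n v e) (u i) (v k)"
        using sform_eigenvector_right[OF v that(2)] by simp
      also have "\<dots> = sform n (\<lambda>i j. spmat n u d i j + complex_of_real s * H i j) (u i) (v k)"
        using eq by (intro sform_cong) blast
      also have "\<dots> = of_real (d i) * cip n (u i) (v k) + of_real s * sform n H (u i) (v k)"
        unfolding sform_add sform_scale sform_eigenvector_left[OF u that(1)] ..
      finally have "of_real (e k - d i) * cip n (u i) (v k) = of_real s * sform n H (u i) (v k)"
        by (simp add: algebra_simps)
      then have "\<bar>e k - d i\<bar> * W i k = \<bar>s\<bar> * cmod (sform n H (u i) (v k))"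
        unfolding W_def by (metis norm_mult norm_of_real)
      also have "\<dots> \<le> \<bar>s\<bar> * B"
        unfolding B_def by (intro mult_left_mono cmod_sform_orthonormal_le u v that) auto
      finally show ?thesis .
    qed
    have xX: "cmod (cip n (u i) x) \<le> X" if "i < n" for i
      unfolding X_def using that by (intro member_le_sum) auto
    have \<zeta>: "cmod (\<zeta> k i) \<le> W i k * X" if "i < n" for k i
    proof -
      have "cmod (cip n (v k) (u i)) = W i k"
        unfolding W_def by (metis cnj_cip complex_mod_cnj)
      then show ?thesis
        using xX[OF that] by (simp add: \<zeta>_def norm_mult W_def mult_left_mono)
    qed
    have rem: "\<bar>chord_rem f (e k) (d i) (d j) * Re (cnj (\<zeta> k i) * \<zeta> k j)\<bar>
        \<le> \<bar>s\<bar> * B * X\<^sup>2 * (\<eta> + D * (\<bar>s\<bar> * B))" if "i < n" "j < n" "k < n" for i j k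
    proof -
      have W0: "W i k \<ge> 0" "W j k \<ge> 0" by (simp_all add: W_def)
      define h where "h = \<bar>div_diff f (e k) (d i) - div_diff f (d j) (d i)\<bar>"
      have "chord_rem f (e k) (d i) (d j) = (e k - d i) * (div_diff f (e k) (d i) - div_diff f (d j) (d i))"
      proof -
        have "(e k - d i) * div_diff f (e k) (d i) = f (e k) - f (d i)"
          by (simp add: div_diff_def)
        then show ?thesis
          by (simp add: chord_rem_def div_diff_commute[of f "d i" "d j"] right_diff_distrib mult.commute)
      qed
      then have K: "\<bar>chord_rem f (e k) (d i) (d j)\<bar> = \<bar>e k - d i\<bar> * h"
        by (simp add: abs_mult h_def)
      \<comment> \<open>The overlap \<open>W i k\<close> is spent on the factor
        \<open>e k - d i\<close> of \<open>chord_rem\<close>; the other overlap \<open>W j k\<close>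
        is kept for the factor \<open>e k - d j\<close> that the modulus of continuity
        produces.\<close>
      have "h \<le> \<eta> + C i j * \<bar>e k - d j\<bar>"
        unfolding h_def using C that e by auto
      also have "\<dots> \<le> \<eta> + D * \<bar>e k - d j\<bar>"
        using CD[OF that(1,2)] by (simp add: mult_right_mono)
      finally have "h * W j k \<le> (\<eta> + D * \<bar>e k - d j\<bar>) * W j k"
        using W0 by (intro mult_right_mono) auto
      also have "\<dots> = \<eta> * W j k + D * (\<bar>e k - d j\<bar> * W j k)"
        by (simp add: algebra_simps)
      also have "\<dots> \<le> \<eta> * 1 + D * (\<bar>s\<bar> * B)"
        using W1[OF that(2,3)] WB[OF that(2,3)] \<eta> D0 by (intro add_mono mult_left_mono) auto
      finally have hW: "h * W j k \<le> \<eta> + D * (\<bar>s\<bar> * B)" by simp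
      have "\<bar>Re (cnj (\<zeta> k i) * \<zeta> k j)\<bar> \<le> cmod (\<zeta> k i) * cmod (\<zeta> k j)"
        by (metis abs_Re_le_cmod complex_mod_cnj norm_mult)
      also have "\<dots> \<le> (W i k * X) * (W j k * X)"
        using \<zeta>[OF that(1)] \<zeta>[OF that(2)] W0 X0 by (intro mult_mono) auto
      finally have "\<bar>chord_rem f (e k) (d i) (d j) * Re (cnj (\<zeta> k i) * \<zeta> k j)\<bar>
          \<le> (\<bar>e k - d i\<bar> * h) * ((W i k * X) * (W j k * X))"
        unfolding abs_mult K by (intro mult_left_mono) (auto simp: h_def)
      also have "\<dots> = X\<^sup>2 * ((\<bar>e k - d i\<bar> * W i k) * (h * W j k))"
        by (simp add: power2_eq_square algebra_simps)
      also have "\<dots> \<le> X\<^sup>2 * ((\<bar>s\<bar> * B) * (\<eta> + D * (\<bar>s\<bar> * B)))"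
        using mult_mono[OF WB[OF that(1,3)] hW] W0 B0 by (intro mult_left_mono) (auto simp: h_def)
      finally show ?thesis by (simp add: algebra_simps)
    qed
    have "dk_form n f u d x (spmat n v e) = 1 * dk_form n f u d x (spmat n u d) + s * dk_form n f u d x H"
      unfolding dk_form_combine[symmetric] using eq by (intro dk_form_cong) simp
    then have "qval n v (\<lambda>k. f (e k)) x - qval n u (\<lambda>k. f (d k)) x - s * dk_form n f u d x H
        = (\<Sum>k<n. \<Sum>i<n. \<Sum>j<n. chord_rem f (e k) (d i) (d j) * Re (cnj (\<zeta> k i) * \<zeta> k j))"
      unfolding \<zeta>_def qval_diff_eq[OF u v, symmetric] by simp
    then have "\<bar>qval n v (\<lambda>k. f (e k)) x - qval n u (\<lambda>k. f (d k)) x - s * dk_form n f u d x H\<bar>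
        \<le> (\<Sum>k<n. \<Sum>i<n. \<Sum>j<n. \<bar>chord_rem f (e k) (d i) (d j) * Re (cnj (\<zeta> k i) * \<zeta> k j)\<bar>)"
      by (auto intro!: order_trans[OF sum_abs] sum_mono)
    also have "\<dots> \<le> (\<Sum>k<n. \<Sum>i<n. \<Sum>j<n. \<bar>s\<bar> * B * X\<^sup>2 * (\<eta> + D * (\<bar>s\<bar> * B)))"
      using rem by (intro sum_mono) auto
    also have "\<dots> = \<bar>s\<bar> * (P * \<eta> + P * D * B * \<bar>s\<bar>)"
      by (simp add: P_def N_def algebra_simps)
    also have "\<dots> \<le> \<bar>s\<bar> * (\<epsilon> / 2 + \<epsilon> / 2)"
    proof (intro mult_left_mono add_mono P\<eta>)
      have "P * D * B * \<bar>s\<bar> \<le> P * D * B * \<delta>" using s PDB by (intro mult_left_mono) auto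
      then show "P * D * B * \<bar>s\<bar> \<le> \<epsilon> / 2" using P\<delta> by linarith
    qed auto
    finally show "\<bar>qval n v (\<lambda>k. f (e k)) x - qval n u (\<lambda>k. f (d k)) x - s * dk_form n f u d x H\<bar> \<le> \<epsilon> * \<bar>s\<bar>"
      by (simp add: mult.commute)
  qed
qed

lemma qval_combine:
  assumes "\<And>i j. i < n \<Longrightarrow> j < n \<Longrightarrow>
    spmat n w c i j = complex_of_real a * spmat n u d i j + complex_of_real b * spmat n v e i j"
  shows "qval n w c x = a * qval n u d x + b * qval n v e x"
proof -
  have "complex_of_real (qval n w c x) = sform n (\<lambda>i j. of_real a * spmat n u d i j + of_real b * spmat n v e i j) x x"
    unfolding sform_spmat_self[symmetric] by (rule sform_cong) (rule assms)
  also have "\<dots> = complex_of_real (a * qval n u d x + b * qval n v e x)"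
    by (simp add: sform_add sform_scale sform_spmat_self)
  finally show ?thesis
    unfolding of_real_eq_iff .
qed

lemma qval_between:
  assumes "orthonormal n u" "\<And>k. k < n \<Longrightarrow> d k \<in> {a..b}"
  shows "qval n u d x \<in> {a * (\<Sum>i<n. (cmod (x i))\<^sup>2)..b * (\<Sum>i<n. (cmod (x i))\<^sup>2)}"
  using qval_mono[of n "\<lambda>_. a" d u x] qval_mono[of n d "\<lambda>_. b" u x] assms(2)
  by (simp add: qval_const[OF assms(1)])

text \<open>Each eigenvalue \<open>c k\<close> is the quadratic form of the combination at the unit
  vector \<open>w k\<close>, hence an average of two numbers in \<open>{a..b}\<close>. The whole
  segment thus stays in one compact interval, as \<open>qval_perturbation\<close> demands.\<close>

lemma spectral_theorem_segment:
  assumes u: "orthonormal n u" "\<forall>k<n. d k \<in> {a..b}"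
    and v: "orthonormal n v" "\<forall>k<n. e k \<in> {a..b}"
    and s: "s \<in> {0..1}"
  shows "\<exists>w c. orthonormal n w \<and> (\<forall>k<n. c k \<in> {a..b}) \<and>
    (\<forall>i<n. \<forall>j<n. spmat n w c i j = complex_of_real (1 - s) * spmat n u d i j + complex_of_real s * spmat n v e i j)"
proof -
  obtain w c where w: "orthonormal n w"
    and c: "\<And>i j. i < n \<Longrightarrow> j < n \<Longrightarrow>
      spmat n w c i j = complex_of_real (1 - s) * spmat n u d i j + complex_of_real s * spmat n v e i j"
    using spectral_theorem[of n "\<lambda>i j. complex_of_real (1 - s) * spmat n u d i j + complex_of_real s * spmat n v e i j"]
    by (auto simp: spmat_hermitian)
  have "c k \<in> {a..b}" if "k < n" for k
  proof -
    have ab: "qval n u d (w k) \<in> {a..b}" "qval n v e (w k) \<in> {a..b}"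
      using qval_between[of n u d a b "w k"] qval_between[of n v e a b "w k"] norm_orthonormal[OF w that] u v by auto
    have "c k = (1 - s) * qval n u d (w k) + s * qval n v e (w k)"
      using qval_combine[OF c] qval_eigenvector[OF w that, of c] by simp
    moreover have "(1 - s) * a + s * a \<le> (1 - s) * qval n u d (w k) + s * qval n v e (w k)"
      using ab s by (intro add_mono mult_left_mono) auto
    moreover have "(1 - s) * qval n u d (w k) + s * qval n v e (w k) \<le> (1 - s) * b + s * b"
      using ab s by (intro add_mono mult_left_mono) auto
    ultimately show ?thesis by (simp add: algebra_simps)
  qed
  then show ?thesis using w c by blast
qed

lemma positive_bounds_exist:
  fixes d e :: "nat \<Rightarrow> real"
  assumes "\<And>k. k < n \<Longrightarrow> 0 < d k" "\<And>k. k < n \<Longrightarrow> 0 < e k"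
  shows "\<exists>a b. 0 < a \<and> (\<forall>k<n. d k \<in> {a..b} \<and> e k \<in> {a..b})"
proof -
  \<comment> \<open>The element 1 keeps the set nonempty when \<open>n = 0\<close>.\<close>
  define S where "S = insert 1 (d ` {..<n} \<union> e ` {..<n})"
  have "finite S" "S \<noteq> {}" by (auto simp: S_def)
  moreover have "\<forall>x\<in>S. 0 < x" using assms by (auto simp: S_def)
  ultimately have S: "0 < Min S" "\<And>x. x \<in> S \<Longrightarrow> x \<in> {Min S..Max S}"
    by auto
  have "d k \<in> S \<and> e k \<in> S" if "k < n" for k
    using that by (auto simp: S_def)
  then show ?thesis using S by blast
qed

text \<open>Along the segment from \<open>A\<close> to \<open>B\<close> convexity bounds the
  increment at \<open>s\<close> by \<open>s\<close> times the full increment; dividing by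
  \<open>s\<close> leaves the derivative at \<open>A\<close> on the left, up to an arbitrary
  \<open>\<epsilon>\<close>.\<close>

lemma spectral_convex_tangent:
  assumes conv: "spectral_convex n f"
    and diff: "\<And>t. t > 0 \<Longrightarrow> (f has_real_derivative deriv f t) (at t)"
    and u: "orthonormal n u" "\<And>k. k < n \<Longrightarrow> 0 < d k"
    and v: "orthonormal n v" "\<And>k. k < n \<Longrightarrow> 0 < e k"
  shows "dk_form n f u d x (spmat n v e) - dk_form n f u d x (spmat n u d)
    \<le> qval n v (\<lambda>k. f (e k)) x - qval n u (\<lambda>k. f (d k)) x"
proof -
  obtain a b where a: "0 < a" and "\<forall>k<n. d k \<in> {a..b} \<and> e k \<in> {a..b}"
    using positive_bounds_exist[of n d e] u(2) v(2) by blast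
  then have d: "d k \<in> {a..b}" and e: "e k \<in> {a..b}" if "k < n" for k
    using that by blast+
  define H where "H i j = spmat n v e i j - spmat n u d i j" for i j
  define L where "L = dk_form n f u d x H"
  have "L = 1 * dk_form n f u d x (spmat n v e) + (-1) * dk_form n f u d x (spmat n u d)"
    unfolding L_def dk_form_combine[symmetric] by (rule dk_form_cong) (simp add: H_def)
  then have L: "dk_form n f u d x (spmat n v e) - dk_form n f u d x (spmat n u d) = L"
    by simp
  show ?thesis
    unfolding L
  proof (rule field_le_epsilon)
    fix \<epsilon> :: real assume "0 < \<epsilon>"
    then have "\<exists>\<delta>>0. \<forall>w c s. orthonormal n w \<longrightarrow> (\<forall>k<n. c k \<in> {a..b}) \<longrightarrow> \<bar>s\<bar> < \<delta> \<longrightarrow>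
       (\<forall>i<n. \<forall>j<n. spmat n w c i j = spmat n u d i j + complex_of_real s * H i j) \<longrightarrow>
       \<bar>qval n w (\<lambda>k. f (c k)) x - qval n u (\<lambda>k. f (d k)) x - s * L\<bar> \<le> \<epsilon> * \<bar>s\<bar>"
      unfolding L_def by (intro qval_perturbation diff u(1) a d)
    then obtain \<delta> where \<delta>: "\<delta> > 0" and pert: "\<forall>w c s. orthonormal n w \<longrightarrow> (\<forall>k<n. c k \<in> {a..b}) \<longrightarrow> \<bar>s\<bar> < \<delta> \<longrightarrow>
       (\<forall>i<n. \<forall>j<n. spmat n w c i j = spmat n u d i j + complex_of_real s * H i j) \<longrightarrow>
       \<bar>qval n w (\<lambda>k. f (c k)) x - qval n u (\<lambda>k. f (d k)) x - s * L\<bar> \<le> \<epsilon> * \<bar>s\<bar>"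
      by (elim exE conjE) (rule that)
    define s where "s = min (\<delta> / 2) (1 / 2)"
    have s: "0 < s" "s < \<delta>" "s < 1" using \<delta> by (auto simp: s_def)
    then have "s \<in> {0..1}" by simp
    obtain w c where w: "orthonormal n w" and c: "\<forall>k<n. c k \<in> {a..b}"
      and eq: "\<forall>i<n. \<forall>j<n. spmat n w c i j = complex_of_real (1 - s) * spmat n u d i j + complex_of_real s * spmat n v e i j"
      using spectral_theorem_segment[of n u d a b v e s] u v d e \<open>s \<in> {0..1}\<close> by blast
    have "\<bar>qval n w (\<lambda>k. f (c k)) x - qval n u (\<lambda>k. f (d k)) x - s * L\<bar> \<le> \<epsilon> * \<bar>s\<bar>"
      using s eq by (intro pert[rule_format] w c[rule_format]) (simp_all add: H_def algebra_simps)
    moreover have "qval n w (\<lambda>k. f (c k)) x \<le> (1 - s) * qval n u (\<lambda>k. f (d k)) x + (1 - (1 - s)) * qval n v (\<lambda>k. f (e k)) x"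
    proof (rule conv[unfolded spectral_convex_def, rule_format], intro conjI)
      have "0 < c k" if "k < n" for k
        using c[rule_format, OF that] a by simp
      then show "\<forall>k<n. 0 < d k \<and> 0 < e k \<and> 0 < c k"
        using u v by blast
    qed (use u v w eq s in auto)
    ultimately have "s * L \<le> s * (qval n v (\<lambda>k. f (e k)) x - qval n u (\<lambda>k. f (d k)) x + \<epsilon>)"
      using s(1) by (simp add: algebra_simps)
    then show "L \<le> qval n v (\<lambda>k. f (e k)) x - qval n u (\<lambda>k. f (d k)) x + \<epsilon>"
      using s(1) by simp
  qed
qed

section \<open>Positivity of the remainder kernel from convexity\<close>

lemma chord_rem_eq_0 [simp]: "chord_rem f s s t = 0" "chord_rem f t s t = 0"
  by (auto simp: chord_rem_def div_diff_def field_simps)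

lemma cip_unit_right: "i < n \<Longrightarrow> cip n x (\<lambda>j. if j = i then 1 else 0) = cnj (x i)"
  by (simp add: cip_def sum_delta_lessThan)

lemma cip_unit_left: "i < n \<Longrightarrow> cip n (\<lambda>j. if j = i then 1 else 0) x = x i"
  using cip_unit_right[of i n x] cnj_cip[of n x "\<lambda>j. if j = i then 1 else 0"] by simp

lemma orthonormal_unit: "orthonormal n (\<lambda>k i. if i = k then 1 else 0)"
  unfolding orthonormal_def by (simp add: cip_unit_right)

text \<open>The remainder is applied to \<open>A = diag (d 0, \<dots>, d (n-1), a)\<close> and to \<open>B\<close>, the conjugate of \<open>A\<close> by
  the reflection along \<open>(\<theta> z, 1)\<close>. To leading order \<open>\<theta>\<^sup>2\<close> only the eigenvalue \<open>a\<close> contributes, since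
  \<open>chord_rem f (d k) (d i) (d j)\<close> vanishes as soon as \<open>k = i\<close> or \<open>k = j\<close>.\<close>

lemma chord_rem_psd_if_spectral_convex:
  assumes conv: "spectral_convex (Suc n) f"
    and diff: "\<And>t. t > 0 \<Longrightarrow> (f has_real_derivative deriv f t) (at t)"
  shows "chord_rem_psd n f"
  unfolding chord_rem_psd_def
proof (intro allI impI, elim conjE)
  fix d :: "nat \<Rightarrow> real" and a :: real and z :: "nat \<Rightarrow> complex"
  assume d: "\<forall>i<n. 0 < d i" and a: "0 < a"
  define P where "P b = (\<Sum>i<n. \<Sum>j<n. chord_rem f b (d i) (d j) * Re (cnj (z i) * z j))" for b
  define d' where "d' i = (if i < n then d i else a)" for i
  define e :: "nat \<Rightarrow> nat \<Rightarrow> complex" where "e = (\<lambda>k i. if i = k then 1 else 0)"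
  \<comment> \<open>The last coordinate is 0, so the eigenvalue \<open>a\<close> of \<open>A\<close>
    drops out of both inner indices and only the points \<open>d i\<close> remain there.\<close>
  define x :: "nat \<Rightarrow> complex" where "x i = (if i < n then 1 else 0)" for i
  \<comment> \<open>The contribution of the eigenvalues \<open>d k\<close> of \<open>B\<close>:
    their coordinates in the reflection vector carry one more factor \<open>\<theta>\<close>, so it
    disappears in the limit.\<close>
  define C where "C = (\<Sum>k<n. (cmod (z k))\<^sup>2 * P (d k))"
  have "0 \<le> P a + \<theta>\<^sup>2 * C" if \<theta>: "\<theta> > 0" for \<theta> :: real
  proof -
    define w where "w i = (if i < n then of_real \<theta> * z i else 1)" for i
    define v where "v = householder (Suc n) w"
    define r where "r = (\<Sum>i<Suc n. (cmod (w i))\<^sup>2)"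
    have cww: "cip (Suc n) w w = of_real r" unfolding r_def by (rule cip_self)
    have "r \<ge> (cmod (w n))\<^sup>2" unfolding r_def by (intro member_le_sum) auto
    then have r: "r > 0" by (simp add: w_def)
    have v: "orthonormal (Suc n) v" unfolding v_def by (rule orthonormal_householder)
    have e: "orthonormal (Suc n) e" unfolding e_def by (rule orthonormal_unit)
    have d': "0 < d' k" if "k < Suc n" for k using d a by (simp add: d'_def)
    define \<zeta> where "\<zeta> k i = cip (Suc n) (v k) (e i) * cip (Suc n) (e i) x" for k i
    have \<zeta>: "\<zeta> k i = cnj (v k i) * x i" if "i < Suc n" for k i
      using that by (simp add: \<zeta>_def e_def cip_unit_right cip_unit_left del: sum.lessThan_Suc)
    have "0 \<le> (\<Sum>k<Suc n. \<Sum>i<Suc n. \<Sum>j<Suc n. chord_rem f (d' k) (d' i) (d' j) * Re (cnj (\<zeta> k i) * \<zeta> k j))"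
      unfolding \<zeta>_def qval_diff_eq[OF e v, symmetric]
      using spectral_convex_tangent[OF conv diff e d' v d', where x = x] by simp
    also have "\<dots> = (\<Sum>k<Suc n. 4 * \<theta>\<^sup>2 / r\<^sup>2 * ((cmod (w k))\<^sup>2 * P (d' k)))"
    proof (rule sum.cong[OF refl])
      fix k assume k: "k \<in> {..<Suc n}"
      have "chord_rem f (d' k) (d' i) (d' j) * Re (cnj (\<zeta> k i) * \<zeta> k j)
          = 4 * \<theta>\<^sup>2 / r\<^sup>2 * (cmod (w k))\<^sup>2 * (chord_rem f (d' k) (d i) (d j) * Re (cnj (z i) * z j))"
        if ij: "i < n" "j < n" for i j
      proof (cases "i = k \<or> j = k")
        case True
        then show ?thesis using ij by (auto simp: d'_def)
      next
        case False
        then have "\<zeta> k i = - 2 * of_real \<theta> / of_real r * w k * cnj (z i)"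
          "\<zeta> k j = - 2 * of_real \<theta> / of_real r * w k * cnj (z j)"
          using ij by (auto simp: \<zeta> x_def v_def householder_def cww w_def)
        then have "cnj (\<zeta> k i) * \<zeta> k j = of_real (4 * \<theta>\<^sup>2 / r\<^sup>2) * ((w k * cnj (w k)) * cnj (cnj (z i) * z j))"
          by (simp add: power2_eq_square)
        then have "cnj (\<zeta> k i) * \<zeta> k j = of_real (4 * \<theta>\<^sup>2 / r\<^sup>2 * (cmod (w k))\<^sup>2) * cnj (cnj (z i) * z j)"
          unfolding complex_norm_square[symmetric] by simp
        moreover have "Re (of_real q * cnj y) = q * Re y" for q y
          by simp
        ultimately have "Re (cnj (\<zeta> k i) * \<zeta> k j) = 4 * \<theta>\<^sup>2 / r\<^sup>2 * (cmod (w k))\<^sup>2 * Re (cnj (z i) * z j)"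
          by (simp only:)
        then show ?thesis using ij by (simp only:) (simp add: d'_def)
      qed
      moreover have "\<zeta> k n = 0"
        by (simp add: \<zeta> x_def)
      ultimately show "(\<Sum>i<Suc n. \<Sum>j<Suc n. chord_rem f (d' k) (d' i) (d' j) * Re (cnj (\<zeta> k i) * \<zeta> k j))
          = 4 * \<theta>\<^sup>2 / r\<^sup>2 * ((cmod (w k))\<^sup>2 * P (d' k))"
        by (simp add: P_def sum_distrib_left mult.assoc del: complex_cnj_mult times_complex.sel)
    qed
    also have "\<dots> = 4 * \<theta>\<^sup>2 / r\<^sup>2 * (P a + \<theta>\<^sup>2 * C)"
      by (simp add: w_def d'_def C_def norm_mult power_mult_distrib sum_distrib_left algebra_simps)
    finally show ?thesis
      using r \<theta> by (auto simp: zero_le_mult_iff zero_le_divide_iff)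
  qed
  then have "\<forall>\<^sub>F \<theta> in at_right 0. 0 \<le> P a + \<theta>\<^sup>2 * C"
    by (simp add: eventually_at_filter)
  moreover have "((\<lambda>\<theta>. P a + \<theta>\<^sup>2 * C) \<longlongrightarrow> P a + 0\<^sup>2 * C) (at_right 0)"
    by (intro tendsto_intros)
  ultimately have "0 \<le> P a + 0\<^sup>2 * C"
    by (intro tendsto_lowerbound[of _ _ "at_right 0"]) auto
  then show "0 \<le> (\<Sum>i<n. \<Sum>j<n. chord_rem f a (d i) (d j) * Re (cnj (z i) * z j))"
    by (simp add: P_def)
qed

section \<open>Matrix monotone functions\<close>

definition spectral_mono :: "nat \<Rightarrow> (real \<Rightarrow> real) \<Rightarrow> bool" where
  "spectral_mono n f \<longleftrightarrow> (\<forall>u d v e. orthonormal n u \<and> orthonormal n v \<and> (\<forall>k<n. 0 < d k \<and> 0 < e k) \<and>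
     (\<forall>x. qval n u d x \<le> qval n v e x) \<longrightarrow> (\<forall>x. qval n u (\<lambda>k. f (d k)) x \<le> qval n v (\<lambda>k. f (e k)) x))"

definition loewner_psd :: "nat \<Rightarrow> (real \<Rightarrow> real) \<Rightarrow> bool" where
  "loewner_psd n f \<longleftrightarrow> (\<forall>t z. (\<forall>i<n. 0 < t i) \<longrightarrow>
     0 \<le> (\<Sum>i<n. \<Sum>j<n. div_diff f (t i) (t j) * Re (cnj (z i) * z j)))"

text \<open>Schur's product theorem for the Loewner matrix and the direction \<open>H\<close>: with
  \<open>H\<close> diagonalized, the form is a sum of values of the Loewner form with the
  nonnegative eigenvalues of \<open>H\<close> as weights.\<close>

lemma dk_form_nonneg:
  assumes psd: "loewner_psd n f" and c: "\<And>k. k < n \<Longrightarrow> 0 < c k"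
    and H: "\<And>i j. cnj (H i j) = H j i" "\<And>y. 0 \<le> Re (sform n H y y)"
  shows "0 \<le> dk_form n f w c x H"
proof -
  obtain p \<eta> where p: "orthonormal n p" and \<eta>: "\<forall>i<n. \<forall>j<n. spmat n p \<eta> i j = H i j"
    using spectral_theorem[of n H] H(1) by blast
  have sf: "sform n H y y' = sform n (spmat n p \<eta>) y y'" for y y'
    by (rule sform_cong) (simp add: \<eta>)
  have \<eta>0: "0 \<le> \<eta> k" if "k < n" for k
    using H(2)[of "p k"] qval_eigenvector[OF p that, of \<eta>] by (simp add: sf sform_spmat_self)
  define \<zeta> where "\<zeta> k i = cip n (p k) (w i) * cip n (w i) x" for k i
  have "Re (cnj (cip n (w i) x) * cip n (w j) x * sform n H (w i) (w j))
      = (\<Sum>k<n. \<eta> k * Re (cnj (\<zeta> k i) * \<zeta> k j))" for i j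
  proof -
    have "cnj (cip n (w i) x) * cip n (w j) x * (of_real (\<eta> k) * cip n (w i) (p k) * cip n (p k) (w j))
        = of_real (\<eta> k) * (cnj (\<zeta> k i) * \<zeta> k j)" for k
      by (simp add: \<zeta>_def cnj_cip mult_ac)
    moreover have "Re (of_real r * y) = r * Re y" for r y
      by simp
    ultimately show ?thesis
      by (simp only: sf sform_spmat sum_distrib_left Re_sum)
  qed
  then have "dk_form n f w c x H = (\<Sum>i<n. \<Sum>j<n. \<Sum>k<n. \<eta> k * (div_diff f (c i) (c j) * Re (cnj (\<zeta> k i) * \<zeta> k j)))"
    by (simp only: dk_form_def sum_distrib_left mult.left_commute)
  also have "\<dots> = (\<Sum>k<n. \<Sum>i<n. \<Sum>j<n. \<eta> k * (div_diff f (c i) (c j) * Re (cnj (\<zeta> k i) * \<zeta> k j)))"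
    by (rule sum_rotate[symmetric])
  also have "\<dots> = (\<Sum>k<n. \<eta> k * (\<Sum>i<n. \<Sum>j<n. div_diff f (c i) (c j) * Re (cnj (\<zeta> k i) * \<zeta> k j)))"
    by (simp only: sum_distrib_left)
  also have "\<dots> \<ge> 0"
  proof (rule sum_nonneg)
    fix k assume "k \<in> {..<n}"
    then show "0 \<le> \<eta> k * (\<Sum>i<n. \<Sum>j<n. div_diff f (c i) (c j) * Re (cnj (\<zeta> k i) * \<zeta> k j))"
      using \<eta>0 c by (intro mult_nonneg_nonneg psd[unfolded loewner_psd_def, rule_format, where z = "\<zeta> k"]) auto
  qed
  finally show ?thesis .
qed

text \<open>On the segment from \<open>A\<close> to \<open>B\<close> the quadratic form of
  \<open>f\<close> has derivative \<open>dk_form\<close> in the positive direction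
  \<open>B - A\<close>, which is nonnegative.\<close>

lemma spectral_mono_if_loewner_psd:
  assumes diff: "\<And>t. t > 0 \<Longrightarrow> (f has_real_derivative deriv f t) (at t)"
    and psd: "loewner_psd n f"
  shows "spectral_mono n f"
  unfolding spectral_mono_def
proof (intro allI impI, elim conjE)
  fix u d v e x
  assume u: "orthonormal n u" and v: "orthonormal n v" and pos: "\<forall>k<n. 0 < d k \<and> 0 < e k"
    and le: "\<forall>x. qval n u d x \<le> qval n v e x"
  obtain a b where a: "0 < a" and "\<forall>k<n. d k \<in> {a..b} \<and> e k \<in> {a..b}"
    using positive_bounds_exist[of n d e] pos by blast
  then have d: "d k \<in> {a..b}" and e: "e k \<in> {a..b}" if "k < n" for k
    using that by blast+
  define H where "H i j = spmat n v e i j - spmat n u d i j" for i j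
  \<comment> \<open>The diagonalizations are chosen separately for each \<open>s\<close>, without
    any continuity. The derivative exists all the same, since the perturbation bound holds for every
    diagonalization of the nearby matrix.\<close>
  have "\<forall>s\<in>{0..1}. \<exists>w c. orthonormal n w \<and> (\<forall>k<n. c k \<in> {a..b}) \<and>
    (\<forall>i<n. \<forall>j<n. spmat n w c i j = complex_of_real (1 - s) * spmat n u d i j + complex_of_real s * spmat n v e i j)"
    using spectral_theorem_segment[of n u d a b v e] u v d e by blast
  then obtain w c where w: "\<And>s. s \<in> {0..1} \<Longrightarrow> orthonormal n (w s)"
    and c: "\<And>s. s \<in> {0..1} \<Longrightarrow> \<forall>k<n. c s k \<in> {a..b}"
    and eq: "\<And>s i j. s \<in> {0..1} \<Longrightarrow> i < n \<Longrightarrow> j < n \<Longrightarrow>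
      spmat n (w s) (c s) i j = complex_of_real (1 - s) * spmat n u d i j + complex_of_real s * spmat n v e i j"
    unfolding bchoice_iff by metis
  define \<phi> where "\<phi> s = qval n (w s) (\<lambda>k. f (c s k)) x" for s
  have pert: "\<exists>\<delta>>0. \<forall>v' e' h. orthonormal n v' \<longrightarrow> (\<forall>k<n. e' k \<in> {a..b}) \<longrightarrow> \<bar>h\<bar> < \<delta> \<longrightarrow>
     (\<forall>i<n. \<forall>j<n. spmat n v' e' i j = spmat n (w s) (c s) i j + complex_of_real h * H i j) \<longrightarrow>
     \<bar>qval n v' (\<lambda>k. f (e' k)) x - \<phi> s - h * dk_form n f (w s) (c s) x H\<bar> \<le> \<epsilon> * \<bar>h\<bar>"
    if "s \<in> {0..1}" "\<epsilon> > 0" for s \<epsilon>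
    unfolding \<phi>_def by (intro qval_perturbation diff w a c[rule_format] that)
  have deriv: "(\<phi> has_real_derivative dk_form n f (w s) (c s) x H) (at s within {0..1})" if s: "s \<in> {0..1}" for s
    unfolding has_field_derivative_def has_derivative_within_alt
  proof (intro conjI allI impI)
    fix \<epsilon> :: real assume "0 < \<epsilon>"
    from pert[OF s this] obtain \<delta> where "\<delta> > 0" and \<delta>: "\<forall>v' e' h. orthonormal n v' \<longrightarrow> (\<forall>k<n. e' k \<in> {a..b}) \<longrightarrow> \<bar>h\<bar> < \<delta> \<longrightarrow>
     (\<forall>i<n. \<forall>j<n. spmat n v' e' i j = spmat n (w s) (c s) i j + complex_of_real h * H i j) \<longrightarrow>
     \<bar>qval n v' (\<lambda>k. f (e' k)) x - \<phi> s - h * dk_form n f (w s) (c s) x H\<bar> \<le> \<epsilon> * \<bar>h\<bar>"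
      by (elim exE conjE) (rule that)
    have "\<bar>\<phi> y - \<phi> s - (y - s) * dk_form n f (w s) (c s) x H\<bar> \<le> \<epsilon> * \<bar>y - s\<bar>" if "y \<in> {0..1}" "\<bar>y - s\<bar> < \<delta>" for y
      unfolding \<phi>_def[of y] using that by (intro \<delta>[rule_format] w c[rule_format]) (simp_all add: eq[OF that(1)] eq[OF s] H_def algebra_simps)
    then show "\<exists>\<delta>>0. \<forall>y\<in>{0..1}. norm (y - s) < \<delta> \<longrightarrow>
        norm (\<phi> y - \<phi> s - dk_form n f (w s) (c s) x H * (y - s)) \<le> \<epsilon> * norm (y - s)"
      using \<open>\<delta> > 0\<close> by (auto simp: mult.commute)
  qed (rule bounded_linear_mult_right)
  have nonneg: "0 \<le> dk_form n f (w s) (c s) x H" if "s \<in> {0..1}" for s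
  proof (rule dk_form_nonneg[OF psd])
    show "0 < c s k" if "k < n" for k
      using c[OF \<open>s \<in> {0..1}\<close>] a that by force
    show "cnj (H i j) = H j i" for i j
      by (simp add: H_def spmat_hermitian)
    fix y
    have "sform n H y y = sform n (\<lambda>i j. spmat n v e i j + (- 1) * spmat n u d i j) y y"
      by (rule sform_cong) (simp add: H_def)
    also have "\<dots> = of_real (qval n v e y) - of_real (qval n u d y)"
      unfolding sform_add sform_scale sform_spmat_self by simp
    finally show "0 \<le> Re (sform n H y y)"
      using le by simp
  qed
  have "\<phi> 0 \<le> \<phi> 1"
  proof (rule DERIV_nonneg_imp_increasing_open[of 0 1])
    show "continuous_on {0..1} \<phi>"
      unfolding continuous_on_eq_continuous_within using DERIV_continuous[OF deriv] by blast
    fix s :: real assume "0 < s" "s < 1"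
    then show "\<exists>y. DERIV \<phi> s :> y \<and> 0 \<le> y"
      using deriv[of s] nonneg[of s] by (auto simp: at_within_Icc_at)
  qed simp
  \<comment> \<open>For increment 0 the perturbation bound says that the value is independent of the
    diagonalization, so the chosen data at the ends can be exchanged for the given ones.\<close>
  moreover have end_point: "qval n v' (\<lambda>k. f (e' k)) x = \<phi> s"
    if "s \<in> {0..1}" "orthonormal n v'" "\<forall>k<n. e' k \<in> {a..b}" "\<forall>i<n. \<forall>j<n. spmat n v' e' i j = spmat n (w s) (c s) i j" for s v' e'
  proof -
    have "(0::real) < 1" by simp
    from pert[OF that(1) this]
    obtain \<delta> where "\<delta> > 0" and \<delta>: "\<forall>v' e' h. orthonormal n v' \<longrightarrow> (\<forall>k<n. e' k \<in> {a..b}) \<longrightarrow> \<bar>h\<bar> < \<delta> \<longrightarrow>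
     (\<forall>i<n. \<forall>j<n. spmat n v' e' i j = spmat n (w s) (c s) i j + complex_of_real h * H i j) \<longrightarrow>
     \<bar>qval n v' (\<lambda>k. f (e' k)) x - \<phi> s - h * dk_form n f (w s) (c s) x H\<bar> \<le> 1 * \<bar>h\<bar>"
      by (elim exE conjE) (rule that)
    show ?thesis
      using \<delta>[rule_format, OF that(2) that(3)[rule_format], where h = 0] that(4) \<open>\<delta> > 0\<close> by simp
  qed
  moreover have "qval n u (\<lambda>k. f (d k)) x = \<phi> 0"
    using u d eq[of 0] by (intro end_point) auto
  moreover have "qval n v (\<lambda>k. f (e k)) x = \<phi> 1"
    using v e eq[of 1] by (intro end_point) auto
  ultimately show "qval n u (\<lambda>k. f (d k)) x \<le> qval n v (\<lambda>k. f (e k)) x"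
    by simp
qed

section \<open>From monotone functions to convex functions and back\<close>

lemma sum_lessThan_add:
  fixes g :: "nat \<Rightarrow> 'a::comm_monoid_add"
  shows "(\<Sum>r<n + m. g r) = (\<Sum>r<n. g r) + (\<Sum>r<m. g (n + r))"
  by (induction m) (simp_all add: add.assoc)

text \<open>\<open>T\<^sup>* f(T T\<^sup>*) T = C f(C)\<close> for \<open>C = T\<^sup>* T\<close>.\<close>

lemma qval_gram:
  assumes w: "orthonormal n w" and h: "orthonormal N h"
    and C: "\<And>p q. p < n \<Longrightarrow> q < n \<Longrightarrow> spmat n w c p q = (\<Sum>r<N. cnj (T r p) * T r q)"
    and G: "\<And>r s. r < N \<Longrightarrow> s < N \<Longrightarrow> spmat N h g r s = (\<Sum>p<n. T r p * cnj (T s p))"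
  shows "qval N h (\<lambda>m. f (g m)) (\<lambda>r. \<Sum>p<n. T r p * x p) = qval n w (\<lambda>k. c k * f (c k)) x"
proof -
  define y where "y = (\<lambda>r. \<Sum>p<n. T r p * x p)"
  define \<xi> where "\<xi> k = cip n (w k) x" for k
  \<comment> \<open>The images \<open>T w_k\<close> are orthogonal eigenvectors of
    \<open>T T*\<close> with eigenvalues \<open>c k\<close> and squared norms \<open>c k\<close>;
    these norms are the source of the factor \<open>c k\<close> in the result.\<close>
  define Tw where "Tw k r = (\<Sum>p<n. T r p * w k p)" for k r
  define y' where "y' = (\<lambda>r. \<Sum>k<n. (\<xi> k * of_real (f (c k))) * Tw k r)"
  have y: "y = (\<lambda>r. \<Sum>k<n. \<xi> k * Tw k r)"
  proof
    fix r
    have "y r = (\<Sum>p<n. \<Sum>k<n. T r p * (w k p * \<xi> k))"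
      unfolding y_def \<xi>_def sum_distrib_left[symmetric] using orthonormal_expand[OF w] by (intro sum.cong refl) simp
    also have "\<dots> = (\<Sum>k<n. \<xi> k * Tw k r)"
      unfolding Tw_def sum_distrib_left by (subst sum.swap) (simp add: mult_ac)
    finally show "y r = (\<Sum>k<n. \<xi> k * Tw k r)" .
  qed
  have GTw: "(\<Sum>s<N. spmat N h g r s * Tw k s) = of_real (c k) * Tw k r" if "r < N" "k < n" for r k
  proof -
    have "(\<Sum>s<N. spmat N h g r s * Tw k s) = (\<Sum>s<N. \<Sum>p<n. \<Sum>q<n. T r p * cnj (T s p) * T s q * w k q)"
      using G that by (intro sum.cong refl) (simp add: Tw_def sum_product mult.assoc)
    also have "\<dots> = (\<Sum>p<n. \<Sum>q<n. \<Sum>s<N. T r p * cnj (T s p) * T s q * w k q)"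
      by (rule sum_rotate)
    also have "\<dots> = (\<Sum>p<n. T r p * (\<Sum>q<n. spmat n w c p q * w k q))"
      unfolding sum_distrib_left
    proof (intro sum.cong refl)
      fix p q assume "p \<in> {..<n}" "q \<in> {..<n}"
      then have "spmat n w c p q = (\<Sum>r<N. cnj (T r p) * T r q)" using C by simp
      then show "(\<Sum>s<N. T r p * cnj (T s p) * T s q * w k q) = T r p * (spmat n w c p q * w k q)"
        by (simp add: sum_distrib_left sum_distrib_right mult.assoc)
    qed
    also have "\<dots> = of_real (c k) * Tw k r"
      unfolding spmat_apply_eigenvector[OF w that(2)] Tw_def sum_distrib_left
      by (intro sum.cong refl) (simp add: mult_ac)
    finally show ?thesis .
  qed
  have TwTw: "cip N (Tw k) (Tw l) = (if k = l then of_real (c l) else 0)" if "k < n" "l < n" for k l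
  proof -
    have "cip N (Tw k) (Tw l) = (\<Sum>r<N. \<Sum>p<n. \<Sum>q<n. cnj (w k p) * (cnj (T r p) * T r q) * w l q)"
      unfolding cip_def Tw_def cnj_sum sum_product by (intro sum.cong refl) (simp add: mult_ac)
    also have "\<dots> = (\<Sum>p<n. \<Sum>q<n. \<Sum>r<N. cnj (w k p) * (cnj (T r p) * T r q) * w l q)"
      by (rule sum_rotate)
    also have "\<dots> = sform n (spmat n w c) (w k) (w l)"
      unfolding sform_def using C by (intro sum.cong refl) (simp add: sum_distrib_left sum_distrib_right)
    also have "\<dots> = of_real (c l) * cip n (w k) (w l)"
      by (rule sform_eigenvector_right[OF w that(2)])
    finally show ?thesis
      using w that by (simp add: orthonormal_def)
  qed
  \<comment> \<open>Either \<open>g m = c k\<close> or the overlap vanishes, so equality of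
    eigenvalues passes to their images under \<open>f\<close>.\<close>
  have intertwine: "of_real (f (g m)) * cip N (h m) (Tw k) = of_real (f (c k)) * cip N (h m) (Tw k)"
    if "m < N" "k < n" for m k
  proof -
    have "of_real (g m) * cip N (h m) (Tw k) = sform N (spmat N h g) (h m) (Tw k)"
      using sform_eigenvector_left[OF h that(1)] by simp
    also have "\<dots> = cip N (h m) (\<lambda>r. of_real (c k) * Tw k r)"
      unfolding sform_eq_cip using GTw that by (intro cip_cong) auto
    finally have "of_real (g m) * cip N (h m) (Tw k) = of_real (c k) * cip N (h m) (Tw k)"
      unfolding cip_scale_right .
    then show ?thesis by auto
  qed
  have hy: "of_real (f (g m)) * cip N (h m) y = cip N (h m) y'" if "m < N" for m
    unfolding y y'_def cip_sum_right sum_distrib_left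
  proof (rule sum.cong[OF refl])
    fix k assume "k \<in> {..<n}"
    then have *: "of_real (f (g m)) * cip N (h m) (Tw k) = of_real (f (c k)) * cip N (h m) (Tw k)"
      using intertwine that by simp
    have "of_real (f (g m)) * (\<xi> k * cip N (h m) (Tw k)) = \<xi> k * (of_real (f (g m)) * cip N (h m) (Tw k))"
      by (rule mult.left_commute)
    then show "of_real (f (g m)) * (\<xi> k * cip N (h m) (Tw k)) = \<xi> k * of_real (f (c k)) * cip N (h m) (Tw k)"
      unfolding * by (simp add: mult.assoc)
  qed
  have "complex_of_real (qval N h (\<lambda>m. f (g m)) y) = (\<Sum>m<N. cip N y (h m) * (of_real (f (g m)) * cip N (h m) y))"
    unfolding sform_spmat_self[symmetric] sform_spmat by (intro sum.cong refl) (simp add: mult_ac)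
  also have "\<dots> = (\<Sum>m<N. cip N y (h m) * cip N (h m) y')"
    using hy by (intro sum.cong refl) simp
  also have "\<dots> = cip N y y'"
    by (rule parseval[OF h])
  also have "\<dots> = (\<Sum>k<n. \<xi> k * of_real (f (c k)) * (\<Sum>l<n. cnj (\<xi> l) * cip N (Tw l) (Tw k)))"
    unfolding y'_def cip_sum_right unfolding y cip_sum_left ..
  also have "\<dots> = (\<Sum>k<n. \<xi> k * of_real (f (c k)) * (cnj (\<xi> k) * of_real (c k)))"
  proof (rule sum.cong[OF refl])
    fix k assume k: "k \<in> {..<n}"
    have "(\<Sum>l<n. cnj (\<xi> l) * cip N (Tw l) (Tw k)) = (\<Sum>l<n. cnj (\<xi> l) * of_real (c k) * (if l = k then 1 else 0))"
      using TwTw k by (intro sum.cong refl) auto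
    then show "\<xi> k * of_real (f (c k)) * (\<Sum>l<n. cnj (\<xi> l) * cip N (Tw l) (Tw k)) = \<xi> k * of_real (f (c k)) * (cnj (\<xi> k) * of_real (c k))"
      using k by (simp add: sum_delta_lessThan)
  qed
  also have "\<dots> = complex_of_real (qval n w (\<lambda>k. c k * f (c k)) x)"
    unfolding sform_spmat_self[symmetric] sform_spmat \<xi>_def by (intro sum.cong refl) (simp add: cnj_cip mult_ac)
  finally show ?thesis
    unfolding of_real_eq_iff y_def .
qed

lemma norm_orthonormal_combination:
  assumes "orthonormal n u"
  shows "(\<Sum>p<n. (cmod (\<Sum>r<n. c r * u r p))\<^sup>2) = (\<Sum>r<n. (cmod (c r))\<^sup>2)"
proof -
  let ?y = "\<lambda>p. \<Sum>r<n. c r * u r p"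
  have "complex_of_real (\<Sum>p<n. (cmod (?y p))\<^sup>2) = cip n ?y ?y"
    by (rule cip_self[symmetric])
  also have "\<dots> = (\<Sum>l<n. c l * (\<Sum>k<n. cnj (c k) * cip n (u k) (u l)))"
    unfolding cip_sum_left cip_sum_right sum_distrib_left by (subst sum.swap) (simp add: mult_ac)
  also have "\<dots> = (\<Sum>l<n. c l * (\<Sum>k<n. cnj (c k) * (if k = l then 1 else 0)))"
    using assms by (intro sum.cong refl arg_cong2[where f = "(*)"]) (auto simp: orthonormal_def)
  also have "\<dots> = complex_of_real (\<Sum>r<n. (cmod (c r))\<^sup>2)"
    unfolding of_real_sum complex_norm_square by (intro sum.cong refl) (simp add: sum_delta_lessThan)
  finally show ?thesis
    unfolding of_real_eq_iff .
qed

text \<open>Cauchy-Schwarz against the unit vector with entries \<open>sqrt l\<close> and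
  \<open>sqrt (1 - l)\<close>, in the form of Lagrange's identity.\<close>

lemma cmod_convex_combination_le:
  assumes "0 \<le> l" "l \<le> 1"
  shows "(cmod (of_real (sqrt l) * a + of_real (sqrt (1 - l)) * b))\<^sup>2 \<le> (cmod a)\<^sup>2 + (cmod b)\<^sup>2"
proof -
  define p q where "p = sqrt l" and "q = sqrt (1 - l)"
  have pq: "p\<^sup>2 + q\<^sup>2 = 1" "p \<ge> 0" "q \<ge> 0" using assms by (auto simp: p_def q_def)
  have "cmod (of_real p * a + of_real q * b) \<le> p * cmod a + q * cmod b"
    using norm_triangle_ineq[of "of_real p * a" "of_real q * b"] pq by (simp add: norm_mult)
  then have "(cmod (of_real p * a + of_real q * b))\<^sup>2 \<le> (p * cmod a + q * cmod b)\<^sup>2"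
    by (rule power_mono) simp
  also have "\<dots> = (p\<^sup>2 + q\<^sup>2) * ((cmod a)\<^sup>2 + (cmod b)\<^sup>2) - (p * cmod b - q * cmod a)\<^sup>2"
    by (simp add: power2_eq_square algebra_simps)
  also have "\<dots> \<le> (cmod a)\<^sup>2 + (cmod b)\<^sup>2"
    by (simp add: pq)
  finally show ?thesis by (simp add: p_def q_def)
qed

lemma qval_shift:
  assumes "orthonormal n u"
  shows "qval n u (\<lambda>k. d k + c) x = qval n u d x + c * (\<Sum>i<n. (cmod (x i))\<^sup>2)"
  by (simp add: qval_add qval_const[OF assms])

lemma tendsto_qval:
  assumes "\<And>k. k < n \<Longrightarrow> ((\<lambda>j. d j k) \<longlongrightarrow> e k) F"
  shows "((\<lambda>j. qval n u (d j) x) \<longlongrightarrow> qval n u e x) F"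
  unfolding qval_def using assms by (intro tendsto_intros) auto

text \<open>Let \<open>C = l A + (1 - l) B\<close> and let \<open>T\<close> be the \<open>2n \<times> n\<close> matrix with blocks \<open>\<surd>(l A)\<close> and
  \<open>\<surd>((1 - l) B)\<close>. Then \<open>C = T\<^sup>* T\<close> and \<open>T T\<^sup>* \<le> diag (A, B)\<close>, so that
  \<open>C f(C) = T\<^sup>* f(T T\<^sup>*) T \<le> T\<^sup>* f(diag (A, B)) T = l A f(A) + (1 - l) B f(B)\<close>. The kernel of
  \<open>T T\<^sup>*\<close> is the reason for the shift by \<open>\<epsilon>\<close>.\<close>

lemma spectral_convex_if_spectral_mono:
  assumes mono: "spectral_mono (2 * n) f" and cont: "continuous_on {0<..} f"
  shows "spectral_convex n (\<lambda>t. t * f t)"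
  unfolding spectral_convex_def
proof (intro allI impI, elim conjE)
  fix u d v e w c and l :: real and x
  assume u: "orthonormal n u" and v: "orthonormal n v" and w: "orthonormal n w"
    and pos: "\<forall>k<n. 0 < d k \<and> 0 < e k \<and> 0 < c k" and l: "0 < l" "l < 1"
    and eq: "\<forall>i<n. \<forall>j<n. spmat n w c i j = complex_of_real l * spmat n u d i j + complex_of_real (1 - l) * spmat n v e i j"
  define N where "N = n + n"
  define \<xi> where "\<xi> r = (if r < n then d r else e (r - n))" for r
  define \<omega> where "\<omega> r = (if r < n then l else 1 - l)" for r
  define E where "E r = (if r < n then u r else v (r - n))" for r
  \<comment> \<open>The rows are taken in the eigenbases of \<open>A\<close> and \<open>B\<close>,
    which multiplies the block matrix from the left by a unitary and makes
    \<open>diag (A, B)\<close> literally diagonal with entries \<open>\<xi>\<close>.\<close>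
  define T where "T r p = complex_of_real (sqrt (\<omega> r * \<xi> r)) * cnj (E r p)" for r p
  have \<xi>: "\<xi> r > 0" if "r < N" for r using that pos by (auto simp: \<xi>_def N_def)
  have \<omega>: "\<omega> r > 0" for r using l by (auto simp: \<omega>_def)
  have C: "spmat n w c p q = (\<Sum>r<N. cnj (T r p) * T r q)" if "p < n" "q < n" for p q
  proof -
    have "cnj (T r p) * T r q = of_real (\<omega> r * \<xi> r) * E r p * cnj (E r q)" if "r < N" for r
    proof -
      have "cnj (T r p) * T r q = of_real (sqrt (\<omega> r * \<xi> r) * sqrt (\<omega> r * \<xi> r)) * E r p * cnj (E r q)"
        by (simp only: T_def complex_cnj_mult complex_cnj_complex_of_real of_real_mult complex_cnj_cnj mult_ac)
      moreover have "sqrt (\<omega> r * \<xi> r) * sqrt (\<omega> r * \<xi> r) = \<omega> r * \<xi> r"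
        using \<xi>[OF that] \<omega>[of r] by simp
      ultimately show ?thesis by (simp only:)
    qed
    then have "(\<Sum>r<N. cnj (T r p) * T r q) = (\<Sum>r<N. of_real (\<omega> r * \<xi> r) * E r p * cnj (E r q))"
      by (intro sum.cong refl) auto
    also have "\<dots> = of_real l * spmat n u d p q + of_real (1 - l) * spmat n v e p q"
      unfolding N_def sum_lessThan_add spmat_def sum_distrib_left
      by (intro arg_cong2[where f = "(+)"] sum.cong refl) (auto simp: \<omega>_def \<xi>_def E_def mult_ac)
    finally show ?thesis using eq that by simp
  qed
  define G where "G r s = (\<Sum>p<n. T r p * cnj (T s p))" for r s
  have "cnj (G r s) = G s r" for r s
    by (simp add: G_def mult.commute)
  then obtain h g where h: "orthonormal N h" and g: "\<And>r s. r < N \<Longrightarrow> s < N \<Longrightarrow> spmat N h g r s = G r s"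
    using spectral_theorem[of N G] by blast
  define S where "S y = (\<Sum>p<n. (cmod (\<Sum>s<N. cnj (T s p) * y s))\<^sup>2)" for y
  have qS: "qval N h g y = S y" for y
  proof -
    have "complex_of_real (S y) = (\<Sum>p<n. \<Sum>r<N. \<Sum>s<N. cnj (y r) * (T r p * cnj (T s p)) * y s)"
      unfolding S_def of_real_sum complex_norm_square cnj_sum sum_product
      by (rule sum.cong[OF refl], subst sum.swap, intro sum.cong refl) (simp add: mult_ac)
    also have "\<dots> = (\<Sum>r<N. \<Sum>s<N. \<Sum>p<n. cnj (y r) * (T r p * cnj (T s p)) * y s)"
      by (rule sum_rotate)
    also have "\<dots> = sform N (spmat N h g) y y"
      unfolding sform_def using g by (intro sum.cong refl) (simp add: G_def sum_distrib_left sum_distrib_right)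
    finally show ?thesis
      unfolding sform_spmat_self of_real_eq_iff by simp
  qed
  have g0: "0 \<le> g m" if "m < N" for m
    unfolding qval_eigenvector[OF h that, of g, symmetric] qS S_def by (intro sum_nonneg) simp
  \<comment> \<open>As \<open>S\<close> is the quadratic form of \<open>T T*\<close>, this is the
    comparison with \<open>diag (A, B)\<close>. The image of \<open>y\<close> under
    \<open>T*\<close> splits into two blocks, whose norms are computed in the eigenbases.\<close>
  have SD: "S y \<le> (\<Sum>r<N. \<xi> r * (cmod (y r))\<^sup>2)" for y
  proof -
    define a where "a p = (\<Sum>r<n. of_real (sqrt (d r)) * y r * u r p)" for p
    define b where "b p = (\<Sum>r<n. of_real (sqrt (e r)) * y (n + r) * v r p)" for p
    have "(\<Sum>s<N. cnj (T s p) * y s) = of_real (sqrt l) * a p + of_real (sqrt (1 - l)) * b p" for p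
      unfolding N_def sum_lessThan_add a_def b_def sum_distrib_left
      by (intro arg_cong2[where f = "(+)"] sum.cong refl) (auto simp: T_def \<omega>_def \<xi>_def E_def real_sqrt_mult mult_ac)
    then have "(cmod (\<Sum>s<N. cnj (T s p) * y s))\<^sup>2 \<le> (cmod (a p))\<^sup>2 + (cmod (b p))\<^sup>2" for p
      using cmod_convex_combination_le[of l "a p" "b p"] l by simp
    then have "S y \<le> (\<Sum>p<n. (cmod (a p))\<^sup>2 + (cmod (b p))\<^sup>2)"
      unfolding S_def by (rule sum_mono)
    also have "\<dots> = (\<Sum>r<n. (cmod (of_real (sqrt (d r)) * y r))\<^sup>2) + (\<Sum>r<n. (cmod (of_real (sqrt (e r)) * y (n + r)))\<^sup>2)"
      unfolding sum.distrib a_def b_def norm_orthonormal_combination[OF u] norm_orthonormal_combination[OF v] ..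
    also have "\<dots> = (\<Sum>r<N. \<xi> r * (cmod (y r))\<^sup>2)"
      unfolding N_def sum_lessThan_add using pos
      by (intro arg_cong2[where f = "(+)"] sum.cong refl) (auto simp: \<xi>_def norm_mult power_mult_distrib)
    finally show ?thesis .
  qed
  define \<iota> :: "nat \<Rightarrow> nat \<Rightarrow> complex" where "\<iota> = (\<lambda>k i. if i = k then 1 else 0)"
  have \<iota>: "orthonormal N \<iota>" unfolding \<iota>_def by (rule orthonormal_unit)
  have q\<iota>: "qval N \<iota> \<eta> y = (\<Sum>r<N. \<eta> r * (cmod (y r))\<^sup>2)" for \<eta> y
    unfolding qval_def \<iota>_def by (intro sum.cong refl) (simp add: cip_unit_left)
  define y where "y = (\<lambda>r. \<Sum>p<n. T r p * x p)"
  have yr: "(cmod (y r))\<^sup>2 = \<omega> r * \<xi> r * (cmod (cip n (E r) x))\<^sup>2" if "r < N" for r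
  proof -
    have "y r = of_real (sqrt (\<omega> r * \<xi> r)) * cip n (E r) x"
      by (simp add: y_def T_def cip_def sum_distrib_left mult.assoc)
    then show ?thesis using \<xi>[OF that] \<omega>[of r] by (simp add: norm_mult power_mult_distrib)
  qed
  have monoN: "spectral_mono N f"
    using mono by (simp add: N_def mult_2)
  have main: "qval n w (\<lambda>k. c k * f (c k + \<epsilon>)) x
      \<le> l * qval n u (\<lambda>k. d k * f (d k + \<epsilon>)) x + (1 - l) * qval n v (\<lambda>k. e k * f (e k + \<epsilon>)) x" if \<epsilon>: "0 < \<epsilon>" for \<epsilon>
  proof -
    have "qval N h (\<lambda>m. g m + \<epsilon>) z \<le> qval N \<iota> (\<lambda>r. \<xi> r + \<epsilon>) z" for z
      unfolding qval_shift[OF h] qval_shift[OF \<iota>] qS q\<iota> using SD by simp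
    moreover have "\<forall>k<N. 0 < g k + \<epsilon> \<and> 0 < \<xi> k + \<epsilon>"
      using g0 \<xi> \<epsilon> by (auto intro: add_nonneg_pos add_pos_pos)
    ultimately have "qval N h (\<lambda>m. f (g m + \<epsilon>)) y \<le> qval N \<iota> (\<lambda>r. f (\<xi> r + \<epsilon>)) y"
      using h \<iota> by (intro monoN[unfolded spectral_mono_def, rule_format]) auto
    also have "\<dots> = (\<Sum>r<N. f (\<xi> r + \<epsilon>) * (\<omega> r * \<xi> r * (cmod (cip n (E r) x))\<^sup>2))"
      unfolding q\<iota> using yr by (intro sum.cong refl) simp
    also have "\<dots> = l * qval n u (\<lambda>k. d k * f (d k + \<epsilon>)) x + (1 - l) * qval n v (\<lambda>k. e k * f (e k + \<epsilon>)) x"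
      unfolding N_def sum_lessThan_add qval_def sum_distrib_left
      by (intro arg_cong2[where f = "(+)"] sum.cong refl) (auto simp: \<omega>_def \<xi>_def E_def mult_ac)
    also have "qval N h (\<lambda>m. f (g m + \<epsilon>)) y = qval n w (\<lambda>k. c k * f (c k + \<epsilon>)) x"
      unfolding y_def by (rule qval_gram[OF w h C, where f = "\<lambda>t. f (t + \<epsilon>)"]) (simp_all add: g G_def)
    finally show ?thesis .
  qed
  have lim: "((\<lambda>\<epsilon>. qval n u' (\<lambda>k. d' k * f (d' k + \<epsilon>)) x) \<longlongrightarrow> qval n u' (\<lambda>k. d' k * f (d' k)) x) (at_right 0)"
    if "\<And>k. k < n \<Longrightarrow> 0 < d' k" for u' d'
  proof (intro tendsto_qval tendsto_mult tendsto_const)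
    fix k assume "k < n"
    then have "isCont f (d' k)"
      using cont that by (simp add: continuous_on_eq_continuous_at)
    moreover have "((\<lambda>\<epsilon>. d' k + \<epsilon>) \<longlongrightarrow> d' k) (at_right 0)"
      by (rule tendsto_eq_intros refl)+ simp
    ultimately show "((\<lambda>\<epsilon>. f (d' k + \<epsilon>)) \<longlongrightarrow> f (d' k)) (at_right 0)"
      by (rule isCont_tendsto_compose)
  qed
  show "qval n w (\<lambda>k. c k * f (c k)) x \<le> l * qval n u (\<lambda>k. d k * f (d k)) x + (1 - l) * qval n v (\<lambda>k. e k * f (e k)) x"
  proof (rule tendsto_le[of "at_right 0"])
    show "((\<lambda>\<epsilon>. l * qval n u (\<lambda>k. d k * f (d k + \<epsilon>)) x + (1 - l) * qval n v (\<lambda>k. e k * f (e k + \<epsilon>)) x) \<longlongrightarrow>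
        l * qval n u (\<lambda>k. d k * f (d k)) x + (1 - l) * qval n v (\<lambda>k. e k * f (e k)) x) (at_right 0)"
      using pos by (intro tendsto_intros lim) auto
    show "((\<lambda>\<epsilon>. qval n w (\<lambda>k. c k * f (c k + \<epsilon>)) x) \<longlongrightarrow> qval n w (\<lambda>k. c k * f (c k)) x) (at_right 0)"
      using pos by (intro lim) auto
    show "\<forall>\<^sub>F \<epsilon> in at_right 0. qval n w (\<lambda>k. c k * f (c k + \<epsilon>)) x
        \<le> l * qval n u (\<lambda>k. d k * f (d k + \<epsilon>)) x + (1 - l) * qval n v (\<lambda>k. e k * f (e k + \<epsilon>)) x"
      unfolding eventually_at_filter using main by simp
  qed simp
qed

text \<open>For \<open>A < B\<close> and \<open>0 < t < 1\<close>, \<open>t B = t A + (1 - t) D\<close> with \<open>D = t (B - A) / (1 - t) > 0\<close>; convexity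
  gives \<open>f(t B) \<le> t f(A) + (1 - t) f(D)\<close>, where the last term vanishes as \<open>t \<longrightarrow> 1\<close>.\<close>

lemma spectral_mono_uminus_if_convex_bounded:
  assumes conv: "spectral_convex n f" and cont: "continuous_on {0<..} f"
    and bdd: "\<And>t. t > 0 \<Longrightarrow> f t \<le> B"
  shows "spectral_mono n (\<lambda>t. - f t)"
  unfolding spectral_mono_def
proof (intro allI impI, elim conjE)
  fix u d v e x
  assume u: "orthonormal n u" and v: "orthonormal n v" and pos: "\<forall>k<n. 0 < d k \<and> 0 < e k"
    and le: "\<forall>x. qval n u d x \<le> qval n v e x"
  define R where "R = (\<Sum>i<n. (cmod (x i))\<^sup>2)"
  \<comment> \<open>The spectrum of \<open>B\<close> is shifted by \<open>1 - t\<close>, which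
    vanishes in the limit: only \<open>A \<le> B\<close> is given, while the auxiliary matrix must
    be strictly positive.\<close>
  have main: "qval n v (\<lambda>k. f (t * (e k + (1 - t)))) x \<le> t * qval n u (\<lambda>k. f (d k)) x + (1 - t) * (B * R)"
    if t: "0 < t" "t < 1" for t
  proof -
    define c where "c k = t * (e k + (1 - t))" for k
    define D where "D i j = complex_of_real (t / (1 - t)) * (spmat n v (\<lambda>k. e k + (1 - t)) i j - spmat n u d i j)" for i j
    have "cnj (D i j) = D j i" for i j
      by (simp add: D_def spmat_hermitian)
    then obtain p \<eta> where p: "orthonormal n p" and \<eta>: "\<And>i j. i < n \<Longrightarrow> j < n \<Longrightarrow> spmat n p \<eta> i j = D i j"
      using spectral_theorem[of n D] by blast
    have \<eta>0: "0 < \<eta> k" if "k < n" for k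
    proof -
      have "spmat n p \<eta> i j = complex_of_real (t / (1 - t)) * spmat n v (\<lambda>k. e k + (1 - t)) i j
          + complex_of_real (- (t / (1 - t))) * spmat n u d i j" if "i < n" "j < n" for i j
        unfolding \<eta>[OF that] D_def by (simp add: algebra_simps)
      from qval_combine[OF this, of "p k"] have "\<eta> k = t / (1 - t) * (qval n v e (p k) + (1 - t) - qval n u d (p k))"
        unfolding qval_eigenvector[OF p that] qval_shift[OF v] norm_orthonormal[OF p that] by (simp add: algebra_simps)
      moreover have "0 < qval n v e (p k) + (1 - t) - qval n u d (p k)"
        using le[rule_format, of "p k"] t by linarith
      ultimately show ?thesis using t by simp
    qed
    have "spmat n v c i j = complex_of_real t * spmat n u d i j + complex_of_real (1 - t) * spmat n p \<eta> i j"
      if "i < n" "j < n" for i j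
    proof -
      have "complex_of_real (1 - t) * complex_of_real (t / (1 - t)) = of_real t"
        using t by (simp flip: of_real_mult)
      then have "complex_of_real (1 - t) * spmat n p \<eta> i j
          = of_real t * (spmat n v (\<lambda>k. e k + (1 - t)) i j - spmat n u d i j)"
        unfolding \<eta>[OF that] D_def by (metis mult.assoc)
      moreover have "spmat n v c i j = of_real t * spmat n v (\<lambda>k. e k + (1 - t)) i j"
        by (simp add: spmat_def c_def sum_distrib_left mult_ac)
      ultimately show ?thesis by (simp add: algebra_simps)
    qed
    moreover have "\<forall>k<n. 0 < d k \<and> 0 < \<eta> k \<and> 0 < c k"
      using pos \<eta>0 t by (auto simp: c_def intro!: mult_pos_pos add_pos_pos)
    ultimately have "qval n v (\<lambda>k. f (c k)) x \<le> t * qval n u (\<lambda>k. f (d k)) x + (1 - t) * qval n p (\<lambda>k. f (\<eta> k)) x"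
      using u p v t by (intro conv[unfolded spectral_convex_def, rule_format]) auto
    also have "qval n p (\<lambda>k. f (\<eta> k)) x \<le> B * R"
      unfolding R_def qval_const[OF p, symmetric] using \<eta>0 bdd by (intro qval_mono) auto
    finally show ?thesis
      using t by (simp add: c_def mult_left_mono)
  qed
  have "qval n v (\<lambda>k. f (e k)) x \<le> 1 * qval n u (\<lambda>k. f (d k)) x + (1 - 1) * (B * R)"
  proof (rule tendsto_le[of "at_left 1"])
    show "((\<lambda>t. t * qval n u (\<lambda>k. f (d k)) x + (1 - t) * (B * R)) \<longlongrightarrow> 1 * qval n u (\<lambda>k. f (d k)) x + (1 - 1) * (B * R)) (at_left 1)"
      by (intro tendsto_intros)
    show "((\<lambda>t. qval n v (\<lambda>k. f (t * (e k + (1 - t)))) x) \<longlongrightarrow> qval n v (\<lambda>k. f (e k)) x) (at_left 1)"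
    proof (rule tendsto_qval)
      fix k assume "k < n"
      then have "isCont f (e k)"
        using cont pos by (simp add: continuous_on_eq_continuous_at)
      moreover have "((\<lambda>t. t * (e k + (1 - t))) \<longlongrightarrow> e k) (at_left 1)"
        by (rule tendsto_eq_intros refl)+ simp
      ultimately show "((\<lambda>t. f (t * (e k + (1 - t)))) \<longlongrightarrow> f (e k)) (at_left 1)"
        by (rule isCont_tendsto_compose)
    qed
    have "\<forall>\<^sub>F t in at_left 1. (t::real) \<in> {0<..<1}"
      by (rule eventually_at_leftI[of 0]) auto
    then show "\<forall>\<^sub>F t in at_left 1. qval n v (\<lambda>k. f (t * (e k + (1 - t)))) x \<le> t * qval n u (\<lambda>k. f (d k)) x + (1 - t) * (B * R)"
      by eventually_elim (use main in auto)
  qed simp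
  then show "qval n u (\<lambda>k. - f (d k)) x \<le> qval n v (\<lambda>k. - f (e k)) x"
    using qval_scale[of n u "-1" "\<lambda>k. f (d k)" x] qval_scale[of n v "-1" "\<lambda>k. f (e k)" x] by simp
qed

section \<open>Conditionally definite Loewner matrices\<close>

definition loewner_cpd :: "nat \<Rightarrow> (real \<Rightarrow> real) \<Rightarrow> bool" where
  "loewner_cpd n g \<longleftrightarrow> (\<forall>t z. (\<forall>i<n. 0 < t i) \<and> (\<Sum>i<n. z i) = 0 \<longrightarrow>
     0 \<le> (\<Sum>i<n. \<Sum>j<n. div_diff g (t i) (t j) * Re (cnj (z i) * z j)))"

text \<open>For \<open>s > 0\<close> this is the second divided difference of \<open>g\<close> at
  \<open>a\<close>, \<open>a\<close>, \<open>a + s\<close>; times \<open>s\<close> it is the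
  difference quotient of \<open>g\<close> at \<open>a\<close> up to the constant
  \<open>deriv g a\<close>.\<close>

definition taylor_quot :: "(real \<Rightarrow> real) \<Rightarrow> real \<Rightarrow> real \<Rightarrow> real" where
  "taylor_quot g a s = (g (a + s) - g a - deriv g a * s) / s\<^sup>2"

lemma taylor_quot_has_derivative:
  assumes diff: "\<forall>t>0. (g has_real_derivative deriv g t) (at t)" and "a > 0" "s > 0"
  shows "(taylor_quot g a has_real_derivative
    ((deriv g (a + s) - deriv g a) * s\<^sup>2 - (g (a + s) - g a - deriv g a * s) * (2 * s)) / (s\<^sup>2 * s\<^sup>2)) (at s)"
proof -
  have g: "((\<lambda>s. g (a + s)) has_real_derivative deriv g (a + s)) (at s)"
  proof -
    have "(g has_real_derivative deriv g (a + s)) (at (a + s))"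
      using diff assms(2,3) by simp
    moreover have "((\<lambda>s. a + s) has_real_derivative 1) (at s)"
      by (rule derivative_eq_intros refl)+ simp
    ultimately show ?thesis
      using DERIV_chain2 by fastforce
  qed
  have num: "((\<lambda>s. g (a + s) - g a - deriv g a * s) has_real_derivative (deriv g (a + s) - deriv g a)) (at s)"
    by (rule derivative_eq_intros g refl)+ simp
  have den: "((\<lambda>s. s\<^sup>2) has_real_derivative 2 * s) (at s)"
    by (rule derivative_eq_intros refl)+ simp
  show ?thesis
    unfolding taylor_quot_def using DERIV_divide[OF num den] assms(3) by simp
qed

text \<open>The numerator is the double difference of \<open>div_diff g\<close> from the base point
  \<open>a\<close>, which is how a kernel acts on sum-zero vectors. The denominator is a diagonal
  congruence. The diagonal case is the quotient rule.\<close>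

lemma div_diff_taylor_quot:
  assumes diff: "\<forall>t>0. (g has_real_derivative deriv g t) (at t)" and a: "a > 0" and st: "s > 0" "t > 0"
  shows "div_diff (taylor_quot g a) s t =
    (div_diff g (a + s) (a + t) - div_diff g (a + s) a - div_diff g a (a + t) + deriv g a) / (s * t)"
proof (cases "s = t")
  case True
  have "deriv (taylor_quot g a) t =
      ((deriv g (a + t) - deriv g a) * t\<^sup>2 - (g (a + t) - g a - deriv g a * t) * (2 * t)) / (t\<^sup>2 * t\<^sup>2)"
    using taylor_quot_has_derivative[OF diff a st(2)] by (rule DERIV_imp_deriv)
  moreover have "div_diff g (a + t) a = (g (a + t) - g a) / t" "div_diff g a (a + t) = (g (a + t) - g a) / t"
    "div_diff g (a + t) (a + t) = deriv g (a + t)" "div_diff (taylor_quot g a) t t = deriv (taylor_quot g a) t"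
    using st by (simp_all add: div_diff_def field_simps)
  ultimately show ?thesis
    unfolding True using st by (simp only:) (simp add: field_simps power2_eq_square)
next
  case False
  define G G' where "G = g (a + s) - g a" and "G' = g (a + t) - g a"
  have 1: "div_diff g (a + s) (a + t) = (G - G') / (s - t)" "div_diff g (a + s) a = G / s" "div_diff g a (a + t) = G' / t"
    using st False by (simp_all add: div_diff_def G_def G'_def field_simps)
  have "div_diff (taylor_quot g a) s t = ((G - deriv g a * s) / s\<^sup>2 - (G' - deriv g a * t) / t\<^sup>2) / (s - t)"
    using False by (simp add: div_diff_def taylor_quot_def G_def G'_def)
  also have "\<dots> = ((G - G') / (s - t) - G / s - G' / t + deriv g a) / (s * t)"
    using st False by (simp add: divide_simps power2_eq_square) (simp add: algebra_simps)
  finally show ?thesis by (simp only: 1)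
qed

text \<open>By \<open>div_diff_taylor_quot\<close> the Loewner matrix of \<open>taylor_quot g a\<close> is congruent to what the Loewner
  matrix of \<open>g\<close> at \<open>a + t 0, \<dots>, a + t (m-1), a\<close> induces on vectors with sum zero, once the last
  coordinate is eliminated.\<close>

lemma loewner_psd_taylor_quot:
  assumes diff: "\<forall>t>0. (g has_real_derivative deriv g t) (at t)" and a: "a > 0"
    and cpd: "loewner_cpd (Suc m) g"
  shows "loewner_psd m (taylor_quot g a)"
  unfolding loewner_psd_def
proof (intro allI impI)
  fix t :: "nat \<Rightarrow> real" and z :: "nat \<Rightarrow> complex"
  assume t: "\<forall>i<m. 0 < t i"
  \<comment> \<open>Dividing by \<open>t i\<close> absorbs the factor \<open>1 / (s * t)\<close> of
    \<open>div_diff_taylor_quot\<close>; the extra coordinate of \<open>Y\<close>, at the point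
    \<open>a\<close>, makes the sum zero.\<close>
  define y where "y i = z i / of_real (t i)" for i
  define Y where "Y i = (if i < m then y i else - (\<Sum>i<m. y i))" for i
  define T where "T i = (if i < m then a + t i else a)" for i
  define R where "R i j = Re (cnj (y i) * y j)" for i j
  have "(\<Sum>i<Suc m. Y i) = 0"
    by (simp add: Y_def)
  moreover have "\<forall>i<Suc m. 0 < T i"
    using t a by (auto simp: T_def intro: add_pos_pos)
  ultimately have "0 \<le> (\<Sum>i<Suc m. \<Sum>j<Suc m. div_diff g (T i) (T j) * Re (cnj (Y i) * Y j))"
    using cpd unfolding loewner_cpd_def by blast
  also have "\<dots> = (\<Sum>i<m. \<Sum>j<m. div_diff g (a + t i) (a + t j) * R i j)
      + (\<Sum>i<m. div_diff g (a + t i) a * Re (cnj (y i) * Y m))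
      + (\<Sum>j<m. div_diff g a (a + t j) * Re (cnj (Y m) * y j))
      + deriv g a * Re (cnj (Y m) * Y m)"
    by (simp add: T_def Y_def R_def sum.distrib sum_subtractf sum_negf div_diff_def[of g a a]
      del: complex_cnj_mult times_complex.sel)
  also have "(\<Sum>i<m. div_diff g (a + t i) a * Re (cnj (y i) * Y m)) = (\<Sum>i<m. \<Sum>j<m. - div_diff g (a + t i) a * R i j)"
  proof (rule sum.cong[OF refl])
    fix i
    have "cnj (y i) * Y m = - (\<Sum>j<m. cnj (y i) * y j)"
      by (simp add: Y_def sum_distrib_left)
    then show "div_diff g (a + t i) a * Re (cnj (y i) * Y m) = (\<Sum>j<m. - div_diff g (a + t i) a * R i j)"
      unfolding R_def by (simp only: uminus_complex.sel Re_sum sum_distrib_left sum_negf mult_minus_left mult_minus_right)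
  qed
  also have "(\<Sum>j<m. div_diff g a (a + t j) * Re (cnj (Y m) * y j)) = (\<Sum>i<m. \<Sum>j<m. - div_diff g a (a + t j) * R i j)"
  proof (subst sum.swap, rule sum.cong[OF refl])
    fix j
    have "cnj (Y m) * y j = - (\<Sum>i<m. cnj (y i) * y j)"
      by (simp add: Y_def sum_distrib_right)
    then show "div_diff g a (a + t j) * Re (cnj (Y m) * y j) = (\<Sum>i<m. - div_diff g a (a + t j) * R i j)"
      unfolding R_def by (simp only: uminus_complex.sel Re_sum sum_distrib_left sum_negf mult_minus_left mult_minus_right)
  qed
  also have "Re (cnj (Y m) * Y m) = (\<Sum>i<m. \<Sum>j<m. R i j)"
    unfolding R_def cmod_sum_square[symmetric] Re_cnj_mult_self by (simp add: Y_def)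
  also have "(\<Sum>i<m. \<Sum>j<m. div_diff g (a + t i) (a + t j) * R i j)
      + (\<Sum>i<m. \<Sum>j<m. - div_diff g (a + t i) a * R i j)
      + (\<Sum>i<m. \<Sum>j<m. - div_diff g a (a + t j) * R i j)
      + deriv g a * (\<Sum>i<m. \<Sum>j<m. R i j)
    = (\<Sum>i<m. \<Sum>j<m. (div_diff g (a + t i) (a + t j) - div_diff g (a + t i) a - div_diff g a (a + t j) + deriv g a) * R i j)"
    unfolding sum_distrib_left sum.distrib[symmetric] by (intro sum.cong refl) (simp add: algebra_simps)
  also have "\<dots> = (\<Sum>i<m. \<Sum>j<m. div_diff (taylor_quot g a) (t i) (t j) * Re (cnj (z i) * z j))"
  proof (intro sum.cong refl)
    fix i j assume "i \<in> {..<m}" "j \<in> {..<m}"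
    then have ij: "t i > 0" "t j > 0" using t by auto
    have "cnj (y i) * y j = of_real (1 / (t i * t j)) * (cnj (z i) * z j)"
      by (simp add: y_def)
    moreover have "Re (of_real r * w) = r * Re w" for r w by simp
    ultimately have "R i j = 1 / (t i * t j) * Re (cnj (z i) * z j)"
      unfolding R_def by (simp only:)
    then show "(div_diff g (a + t i) (a + t j) - div_diff g (a + t i) a - div_diff g a (a + t j) + deriv g a) * R i j
        = div_diff (taylor_quot g a) (t i) (t j) * Re (cnj (z i) * z j)"
      unfolding div_diff_taylor_quot[OF diff a ij] by (simp only: times_divide_eq_left times_divide_eq_right mult_1)
  qed
  finally show "0 \<le> (\<Sum>i<m. \<Sum>j<m. div_diff (taylor_quot g a) (t i) (t j) * Re (cnj (z i) * z j))" .
qed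

section \<open>Stability of convexity and the converse implications\<close>

lemma spectral_convex_cong:
  assumes "spectral_convex n f" "\<And>t. t > 0 \<Longrightarrow> f t = g t"
  shows "spectral_convex n g"
  unfolding spectral_convex_def
proof (intro allI impI, elim conjE)
  fix u d v e w c and l :: real and x
  assume *: "orthonormal n u" "orthonormal n v" "orthonormal n w"
    "\<forall>k<n. 0 < d k \<and> 0 < e k \<and> 0 < c k" "0 < l" "l < 1"
    "\<forall>i<n. \<forall>j<n. spmat n w c i j = complex_of_real l * spmat n u d i j + complex_of_real (1 - l) * spmat n v e i j"
  have "qval n w (\<lambda>k. f (c k)) x \<le> l * qval n u (\<lambda>k. f (d k)) x + (1 - l) * qval n v (\<lambda>k. f (e k)) x"
    by (intro assms(1)[unfolded spectral_convex_def, rule_format] conjI *)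
  moreover have "qval n u' (\<lambda>k. f (d' k)) x = qval n u' (\<lambda>k. g (d' k)) x" if "\<forall>k<n. 0 < d' k" for u' d'
    unfolding qval_def using that assms(2) by (intro sum.cong refl) simp
  ultimately show "qval n w (\<lambda>k. g (c k)) x \<le> l * qval n u (\<lambda>k. g (d k)) x + (1 - l) * qval n v (\<lambda>k. g (e k)) x"
    using *(4) by simp
qed

lemma spectral_convex_add:
  assumes "spectral_convex n f" "spectral_convex n g"
  shows "spectral_convex n (\<lambda>t. f t + g t)"
  unfolding spectral_convex_def
proof (intro allI impI, elim conjE)
  fix u d v e w c and l :: real and x
  assume *: "orthonormal n u" "orthonormal n v" "orthonormal n w"
    "\<forall>k<n. 0 < d k \<and> 0 < e k \<and> 0 < c k" "0 < l" "l < 1"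
    "\<forall>i<n. \<forall>j<n. spmat n w c i j = complex_of_real l * spmat n u d i j + complex_of_real (1 - l) * spmat n v e i j"
  have "qval n w (\<lambda>k. f (c k)) x \<le> l * qval n u (\<lambda>k. f (d k)) x + (1 - l) * qval n v (\<lambda>k. f (e k)) x"
    by (intro assms(1)[unfolded spectral_convex_def, rule_format] conjI *)
  moreover have "qval n w (\<lambda>k. g (c k)) x \<le> l * qval n u (\<lambda>k. g (d k)) x + (1 - l) * qval n v (\<lambda>k. g (e k)) x"
    by (intro assms(2)[unfolded spectral_convex_def, rule_format] conjI *)
  ultimately show "qval n w (\<lambda>k. f (c k) + g (c k)) x \<le>
      l * qval n u (\<lambda>k. f (d k) + g (d k)) x + (1 - l) * qval n v (\<lambda>k. f (e k) + g (e k)) x"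
    unfolding qval_add by (simp add: algebra_simps)
qed

lemma spectral_convex_const: "spectral_convex n (\<lambda>_. b)"
  unfolding spectral_convex_def by (auto simp: qval_const algebra_simps)

text \<open>The remainder kernel of \<open>c / t\<close> has rank one: it is \<open>c / a\<close>
  times the product of \<open>1 - a / s\<close> and \<open>1 - a / t\<close>.\<close>

lemma spectral_convex_inverse:
  assumes "c \<ge> 0"
  shows "spectral_convex n (\<lambda>t. c / t)"
proof (rule spectral_convex_if_chord_rem_psd)
  have K: "chord_rem (\<lambda>t. c / t) a s t = c / a * ((1 - a / s) * (1 - a / t))" if "a > 0" "s > 0" "t > 0" for a s t
  proof -
    have "div_diff (\<lambda>t. c / t) s t = - c / (s * t)"
    proof (cases "s = t")
      case True
      have "((\<lambda>t. c / t) has_real_derivative - c / (t * t)) (at t)"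
        using that by (auto intro!: derivative_eq_intros)
      then show ?thesis using True by (simp add: div_diff_def DERIV_imp_deriv)
    next
      case False
      then show ?thesis using that by (simp add: div_diff_def divide_simps) (simp add: algebra_simps)
    qed
    then show ?thesis
      using that by (simp add: chord_rem_def divide_simps) (simp add: algebra_simps)
  qed
  show "chord_rem_psd n (\<lambda>t. c / t)"
    unfolding chord_rem_psd_def
  proof (intro allI impI, elim conjE)
    fix d :: "nat \<Rightarrow> real" and a :: real and z :: "nat \<Rightarrow> complex"
    assume d: "\<forall>i<n. 0 < d i" and a: "0 < a"
    define y where "y i = of_real (1 - a / d i) * z i" for i
    have "chord_rem (\<lambda>t. c / t) a (d i) (d j) * Re (cnj (z i) * z j) = c / a * Re (cnj (y i) * y j)"
      if "i < n" "j < n" for i j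
    proof -
      have "cnj (y i) * y j = of_real ((1 - a / d i) * (1 - a / d j)) * (cnj (z i) * z j)"
        by (simp add: y_def)
      moreover have "Re (of_real r * w) = r * Re w" for r w by simp
      ultimately have "Re (cnj (y i) * y j) = ((1 - a / d i) * (1 - a / d j)) * Re (cnj (z i) * z j)"
        by (simp only:)
      then show ?thesis
        using K[OF a] d that by (simp only: mult.assoc)
    qed
    then have "(\<Sum>i<n. \<Sum>j<n. chord_rem (\<lambda>t. c / t) a (d i) (d j) * Re (cnj (z i) * z j))
        = (\<Sum>i<n. \<Sum>j<n. c / a * Re (cnj (y i) * y j))"
      by (intro sum.cong refl) simp
    also have "\<dots> = c / a * (cmod (\<Sum>i<n. y i))\<^sup>2"
      unfolding cmod_sum_square sum_distrib_left ..
    also have "\<dots> \<ge> 0" using assms a by simp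
    finally show "0 \<le> (\<Sum>i<n. \<Sum>j<n. chord_rem (\<lambda>t. c / t) a (d i) (d j) * Re (cnj (z i) * z j))" .
  qed
qed

text \<open>Pointwise convergence is enough because \<open>qval\<close> is a finite sum. The filter
  is arbitrary so that limits may run along selected base points only.\<close>

lemma spectral_convex_limit:
  assumes "\<forall>\<^sub>F j in F. spectral_convex n (f j)" and "\<And>t. t > 0 \<Longrightarrow> ((\<lambda>j. f j t) \<longlongrightarrow> g t) F" and "F \<noteq> bot"
  shows "spectral_convex n g"
  unfolding spectral_convex_def
proof (intro allI impI, elim conjE)
  fix u d v e w c and l :: real and x
  assume *: "orthonormal n u" "orthonormal n v" "orthonormal n w"
    "\<forall>k<n. 0 < d k \<and> 0 < e k \<and> 0 < c k" "0 < l" "l < 1"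
    "\<forall>i<n. \<forall>j<n. spmat n w c i j = complex_of_real l * spmat n u d i j + complex_of_real (1 - l) * spmat n v e i j"
  show "qval n w (\<lambda>k. g (c k)) x \<le> l * qval n u (\<lambda>k. g (d k)) x + (1 - l) * qval n v (\<lambda>k. g (e k)) x"
  proof (rule tendsto_le[OF assms(3)])
    show "((\<lambda>j. l * qval n u (\<lambda>k. f j (d k)) x + (1 - l) * qval n v (\<lambda>k. f j (e k)) x) \<longlongrightarrow>
        l * qval n u (\<lambda>k. g (d k)) x + (1 - l) * qval n v (\<lambda>k. g (e k)) x) F"
      using *(4) by (intro tendsto_add tendsto_mult tendsto_const tendsto_qval assms(2)) auto
    show "((\<lambda>j. qval n w (\<lambda>k. f j (c k)) x) \<longlongrightarrow> qval n w (\<lambda>k. g (c k)) x) F"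
      using *(4) by (intro tendsto_qval assms(2)) auto
    show "\<forall>\<^sub>F j in F. qval n w (\<lambda>k. f j (c k)) x \<le> l * qval n u (\<lambda>k. f j (d k)) x + (1 - l) * qval n v (\<lambda>k. f j (e k)) x"
      using assms(1)
    proof eventually_elim
      case (elim j)
      show ?case
        by (intro elim[unfolded spectral_convex_def, rule_format] conjI *)
    qed
  qed
qed

text \<open>One of the \<open>2 * n + 1\<close> points is \<open>a\<close>; the others make
  \<open>taylor_quot g a\<close> monotone of order \<open>2 * n\<close>. Multiplication by
  \<open>s\<close> halves the order, and the constant \<open>deriv g a\<close> is added
  back.\<close>

lemma spectral_convex_difference_quotient:
  assumes diff: "\<forall>t>0. (g has_real_derivative deriv g t) (at t)" and a: "a > 0"
    and cpd: "loewner_cpd (2 * n + 1) g"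
  shows "spectral_convex n (\<lambda>s. (g (a + s) - g a) / s)"
proof -
  have d: "(taylor_quot g a has_real_derivative deriv (taylor_quot g a) s) (at s)" if "s > 0" for s
    using taylor_quot_has_derivative[OF diff a that] by (metis DERIV_imp_deriv)
  then have "spectral_mono (2 * n) (taylor_quot g a)"
    using loewner_psd_taylor_quot[OF diff a] cpd by (intro spectral_mono_if_loewner_psd) simp_all
  moreover have "continuous_on {0<..} (taylor_quot g a)"
    using d DERIV_isCont by (intro continuous_at_imp_continuous_on) blast
  ultimately have "spectral_convex n (\<lambda>s. s * taylor_quot g a s)"
    by (rule spectral_convex_if_spectral_mono)
  then have "spectral_convex n (\<lambda>s. s * taylor_quot g a s + deriv g a)"
    using spectral_convex_const by (rule spectral_convex_add)
  then show ?thesis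
    by (rule spectral_convex_cong) (simp add: taylor_quot_def power2_eq_square field_simps)
qed

text \<open>As \<open>a\<close> tends to 0, the term \<open>- g a / s\<close> of the difference
  quotient need not converge. Adding \<open>(g a + \<epsilon>) / s\<close> cancels it and preserves
  convexity whenever \<open>g a > - \<epsilon>\<close>; what remains is
  \<open>f s + \<epsilon> / s\<close>.\<close>

lemma spectral_convex_if_loewner_cpd_times:
  assumes diff: "\<forall>t>0. ((\<lambda>t. t * f t) has_real_derivative deriv (\<lambda>t. t * f t) t) (at t)"
    and low: "\<And>\<epsilon>. \<epsilon> > 0 \<Longrightarrow> \<exists>\<^sub>F a in at_right 0. - \<epsilon> < a * f a"
    and cpd: "loewner_cpd (2 * n + 1) (\<lambda>t. t * f t)"
  shows "spectral_convex n f"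
proof -
  define g where "g t = t * f t" for t
  have g: "(\<lambda>t. t * f t) = g" by (simp add: g_def fun_eq_iff)
  have cont: "isCont g s" if "s > 0" for s
    using diff that DERIV_isCont unfolding g by blast
  have shifted: "spectral_convex n (\<lambda>s. f s + \<epsilon> / s)" if \<epsilon>: "\<epsilon> > 0" for \<epsilon>
  proof (rule spectral_convex_limit)
    \<comment> \<open>The bound \<open>g a > - \<epsilon>\<close> is only known for arbitrarily
      small \<open>a\<close>, not for all of them, so the limit is taken along those
      \<open>a\<close>.\<close>
    define F where "F = inf (at_right 0) (principal {a. - \<epsilon> < g a})"
    show "F \<noteq> bot"
      using low[OF \<epsilon>] unfolding F_def trivial_limit_def eventually_inf_principal frequently_def g_def by simp
    have "\<forall>\<^sub>F a in F. 0 < a \<and> - \<epsilon> < g a"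
      unfolding F_def eventually_inf_principal by (simp add: eventually_at_filter)
    then show "\<forall>\<^sub>F a in F. spectral_convex n (\<lambda>s. (g (a + s) - g a) / s + (g a + \<epsilon>) / s)"
    proof eventually_elim
      case (elim a)
      then show ?case
        using diff cpd unfolding g
        by (intro spectral_convex_add spectral_convex_difference_quotient spectral_convex_inverse) auto
    qed
    fix s :: real assume s: "s > 0"
    have "((\<lambda>a. a + s) \<longlongrightarrow> s) (at_right 0)"
      by (rule tendsto_eq_intros refl)+ simp
    from isCont_tendsto_compose[OF cont[OF s] this]
    have "((\<lambda>a. (g (a + s) + \<epsilon>) / s) \<longlongrightarrow> (g s + \<epsilon>) / s) (at_right 0)"
      using s by (intro tendsto_intros) auto
    moreover have "(g s + \<epsilon>) / s = f s + \<epsilon> / s"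
      using s by (simp add: g_def add_divide_distrib)
    moreover have "(\<lambda>a. (g (a + s) + \<epsilon>) / s) = (\<lambda>a. (g (a + s) - g a) / s + (g a + \<epsilon>) / s)"
      by (simp add: fun_eq_iff diff_divide_distrib add_divide_distrib)
    ultimately have "((\<lambda>a. (g (a + s) - g a) / s + (g a + \<epsilon>) / s) \<longlongrightarrow> f s + \<epsilon> / s) (at_right 0)"
      by simp
    then show "((\<lambda>a. (g (a + s) - g a) / s + (g a + \<epsilon>) / s) \<longlongrightarrow> f s + \<epsilon> / s) F"
      unfolding F_def by (rule tendsto_mono[OF inf_le1])
  qed
  show ?thesis
  proof (rule spectral_convex_limit)
    show "\<forall>\<^sub>F \<epsilon> in at_right 0. spectral_convex n (\<lambda>s. f s + \<epsilon> / s)"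
      unfolding eventually_at_filter using shifted by simp
    fix s :: real assume "s > 0"
    then show "((\<lambda>\<epsilon>. f s + \<epsilon> / s) \<longlongrightarrow> f s) (at_right 0)"
      by (auto intro!: tendsto_eq_intros)
  qed simp
qed

text \<open>For small \<open>s\<close> the quotient is a value of \<open>div_diff f\<close>, which
  stays continuous down to \<open>s = 0\<close> and is bounded on a compact interval; for large
  \<open>s\<close> the growth of \<open>f\<close> takes over.\<close>

lemma difference_quotient_bounded_below:
  assumes diff: "\<forall>t>0. (f has_real_derivative deriv f t) (at t)" and a: "a > 0"
    and low: "\<forall>\<^sub>F t in at_top. m < f t / t"
  shows "\<exists>B. \<forall>s>0. B \<le> (f (a + s) - f a) / s"
proof -
  obtain S where S: "\<And>t. t \<ge> S \<Longrightarrow> m < f t / t"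
    using low by (auto simp: eventually_at_top_linorder)
  define T where "T = max S 1"
  have "continuous_on {a..a + T} (\<lambda>t. div_diff f t a)"
    using a diff by (intro continuous_on_subset[OF continuous_on_div_diff]) auto
  then have "bounded ((\<lambda>t. div_diff f t a) ` {a..a + T})"
    by (intro compact_imp_bounded compact_continuous_image) auto
  then obtain C where C: "\<forall>t\<in>{a..a + T}. \<bar>div_diff f t a\<bar> \<le> C"
    by (auto simp: bounded_iff)
  \<comment> \<open>For \<open>s \<ge> 1\<close> the loss \<open>|f a| + |m| * (a + s)\<close> is at
    most \<open>(|f a| + |m| * (a + 1)) * s\<close>; this is why \<open>T\<close> is at least
    1.\<close>
  define B where "B = - \<bar>f a\<bar> - \<bar>m\<bar> * (a + 1)"
  have "min (- C) B \<le> (f (a + s) - f a) / s" if s: "s > 0" for s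
  proof (cases "s \<le> T")
    case True
    then have "\<bar>div_diff f (a + s) a\<bar> \<le> C" using C s by auto
    moreover have "div_diff f (a + s) a = (f (a + s) - f a) / s" using s by (simp add: div_diff_def)
    ultimately show ?thesis by linarith
  next
    case False
    then have s1: "s \<ge> 1" and "a + s \<ge> S" using a by (auto simp: T_def)
    then have "m < f (a + s) / (a + s)" using S by blast
    then have "m * (a + s) < f (a + s)" using s a by (simp add: field_simps)
    moreover have "- (\<bar>m\<bar> * (a + s)) \<le> m * (a + s)"
      using s a by (metis abs_ge_minus_self abs_mult abs_of_pos add_pos_pos minus_le_iff)
    moreover have "\<bar>f a\<bar> * 1 \<le> \<bar>f a\<bar> * s" "\<bar>m\<bar> * a * 1 \<le> \<bar>m\<bar> * a * s"
      using s1 a by (intro mult_left_mono; simp)+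
    ultimately have "B * s \<le> f (a + s) - f a"
      unfolding B_def by (simp add: algebra_simps)
    then have "B \<le> (f (a + s) - f a) / s" using s by (simp add: field_simps)
    then show ?thesis by linarith
  qed
  then show ?thesis by blast
qed

text \<open>One step from \<open>4n + 1\<close> to \<open>2n\<close> shows that \<open>- (f(a + s) - f(a)) / s\<close> is \<open>2n\<close>-convex in \<open>s\<close>; it is bounded
  above by the growth condition, hence \<open>(f(a + s) - f(a)) / s\<close> is \<open>2n\<close>-monotone, and a second
  halving gives the \<open>n\<close>-convexity of \<open>f(a + s)\<close>.\<close>

lemma spectral_convex_if_loewner_cpd_uminus:
  assumes diff: "\<forall>t>0. (f has_real_derivative deriv f t) (at t)"
    and low: "\<forall>\<^sub>F t in at_top. m < f t / t"
    and cpd: "loewner_cpd (4 * n + 1) (\<lambda>t. - f t)"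
  shows "spectral_convex n f"
proof (rule spectral_convex_limit)
  have cont: "isCont f s" if "s > 0" for s
    using diff that DERIV_isCont by blast
  have diff': "\<forall>t>0. ((\<lambda>t. - f t) has_real_derivative deriv (\<lambda>t. - f t) t) (at t)"
    using diff DERIV_minus DERIV_imp_deriv by metis
  have shifted: "spectral_convex n (\<lambda>s. f (a + s))" if a: "a > 0" for a
  proof -
    define F where "F s = (- f (a + s) - (- f a)) / s" for s
    obtain B where B: "\<forall>s>0. B \<le> (f (a + s) - f a) / s"
      using difference_quotient_bounded_below[OF diff a low] by blast
    have F: "- F s = (f (a + s) - f a) / s" for s
      by (simp add: F_def minus_divide_left)
    have "spectral_convex (2 * n) F"
      unfolding F_def using cpd by (intro spectral_convex_difference_quotient[OF diff' a]) simp
    moreover have contF: "continuous_on {0<..} F"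
    proof (intro continuous_at_imp_continuous_on ballI)
      fix s :: real assume "s \<in> {0<..}"
      then have s: "s > 0" by simp
      then have "isCont f (a + s)" using cont a by simp
      then have "isCont (\<lambda>s. f (a + s)) s"
        by (intro isCont_o2[where g = f and f = "\<lambda>s. a + s"]) auto
      then show "isCont F s"
        unfolding F_def using s by (intro continuous_intros) auto
    qed
    moreover have "F s \<le> - B" if "s > 0" for s
      using B that F[of s] by (metis le_minus_iff)
    ultimately have "spectral_mono (2 * n) (\<lambda>s. - F s)"
      by (rule spectral_mono_uminus_if_convex_bounded)
    then have "spectral_convex n (\<lambda>s. s * - F s)"
      using contF by (intro spectral_convex_if_spectral_mono continuous_on_minus)
    then have "spectral_convex n (\<lambda>s. s * - F s + f a)"
      using spectral_convex_const by (rule spectral_convex_add)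
    then show ?thesis
      by (rule spectral_convex_cong) (simp add: F)
  qed
  show "\<forall>\<^sub>F a in at_right 0. spectral_convex n (\<lambda>s. f (a + s))"
    unfolding eventually_at_filter using shifted by simp
  fix s :: real assume "s > 0"
  have "((\<lambda>a. a + s) \<longlongrightarrow> s) (at_right 0)"
    by (rule tendsto_eq_intros refl)+ simp
  then show "((\<lambda>a. f (a + s)) \<longlongrightarrow> f s) (at_right 0)"
    by (rule isCont_tendsto_compose[OF cont[OF \<open>s > 0\<close>]])
qed simp

text \<open>On vectors with sum zero, \<open>[chord_rem f a (t i) (t j)]\<close> acts as \<open>L - a M\<close> with the Loewner matrices
  \<open>L\<close> of \<open>t f(t)\<close> and \<open>M\<close> of \<open>f\<close>; let \<open>a \<longrightarrow> 0\<close> and \<open>a \<longrightarrow> \<infinity>\<close>.\<close>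

lemma loewner_cpd_if_chord_rem_psd:
  assumes psd: "chord_rem_psd n f" and diff: "\<forall>t>0. (f has_real_derivative deriv f t) (at t)"
  shows "loewner_cpd n (\<lambda>t. t * f t)" "loewner_cpd n (\<lambda>t. - f t)"
proof -
  have *: "0 \<le> (\<Sum>i<n. \<Sum>j<n. div_diff (\<lambda>t. t * f t) (t i) (t j) * Re (cnj (z i) * z j)) \<and>
      0 \<le> (\<Sum>i<n. \<Sum>j<n. div_diff (\<lambda>t. - f t) (t i) (t j) * Re (cnj (z i) * z j))"
    if t: "\<forall>i<n. 0 < t i" and z: "(\<Sum>i<n. z i) = 0" for t z
  proof -
    define R where "R i j = Re (cnj (z i) * z j)" for i j
    define P where "P = (\<Sum>i<n. \<Sum>j<n. div_diff (\<lambda>t. t * f t) (t i) (t j) * R i j)"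
    define Q where "Q = (\<Sum>i<n. \<Sum>j<n. div_diff (\<lambda>t. - f t) (t i) (t j) * R i j)"
    have R0: "(\<Sum>j<n. R i j) = 0" "(\<Sum>j<n. R j i) = 0" for i
      unfolding R_def Re_sum[symmetric] sum_distrib_left[symmetric] sum_distrib_right[symmetric] cnj_sum[symmetric] z
      by simp_all
    have dd: "div_diff (\<lambda>t. t * f t) p q = p * div_diff f p q + f q \<and> div_diff (\<lambda>t. - f t) p q = - div_diff f p q"
      if "p > 0" "q > 0" for p q
    proof (cases "p = q")
      case True
      have q: "(f has_real_derivative deriv f q) (at q)" using diff that by blast
      have "((\<lambda>t. t * f t) has_real_derivative 1 * f q + deriv f q * q) (at q)"
        by (rule DERIV_mult'[OF DERIV_ident q, THEN DERIV_cong]) simp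
      moreover have "((\<lambda>t. - f t) has_real_derivative - deriv f q) (at q)"
        by (rule DERIV_minus[OF q])
      ultimately show ?thesis
        using True by (simp add: div_diff_def DERIV_imp_deriv)
    next
      case False
      then show ?thesis by (simp add: div_diff_def field_simps)
    qed
    have PQ: "0 \<le> P + a * Q" if a: "a > 0" for a
    proof -
      have "0 \<le> (\<Sum>i<n. \<Sum>j<n. chord_rem f a (t i) (t j) * R i j)"
        using psd t a unfolding chord_rem_psd_def R_def by blast
      \<comment> \<open>The product rule \<open>dd\<close> splits the kernel; the last two summands
        depend on one index apart from \<open>R\<close>, and row and column sums of \<open>R\<close>
        vanish.\<close>
      also have "\<dots> = (\<Sum>i<n. \<Sum>j<n. div_diff (\<lambda>t. t * f t) (t i) (t j) * R i j + a * (div_diff (\<lambda>t. - f t) (t i) (t j) * R i j)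
          + (f a - f (t i)) * R i j - f (t j) * R i j)"
        using t dd by (intro sum.cong refl) (simp add: chord_rem_def algebra_simps)
      also have "\<dots> = P + a * Q + (\<Sum>i<n. (f a - f (t i)) * (\<Sum>j<n. R i j)) - (\<Sum>j<n. f (t j) * (\<Sum>i<n. R i j))"
        unfolding P_def Q_def sum_distrib_left sum.distrib sum_subtractf
        by (subst sum.swap[of "\<lambda>i j. f (t j) * R i j"]) simp
      finally show ?thesis by (simp add: R0)
    qed
    have "0 \<le> P + 0 * Q"
    proof (rule tendsto_lowerbound[of "\<lambda>a. P + a * Q"])
      show "((\<lambda>a. P + a * Q) \<longlongrightarrow> P + 0 * Q) (at_right 0)"
        by (intro tendsto_intros)
      show "\<forall>\<^sub>F a in at_right 0. 0 \<le> P + a * Q"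
        unfolding eventually_at_filter using PQ by simp
    qed simp
    moreover have "0 \<le> 0 * P + Q"
    proof (rule tendsto_lowerbound[of "\<lambda>a. a * P + Q"])
      show "((\<lambda>a. a * P + Q) \<longlongrightarrow> 0 * P + Q) (at_right 0)"
        by (intro tendsto_intros)
      \<comment> \<open>Rescaling by \<open>1 / a\<close> turns the limit at infinity into a limit
        at 0 from the right.\<close>
      have "0 \<le> a * P + Q" if "a > 0" for a
      proof -
        have "0 \<le> a * (P + 1 / a * Q)"
          using PQ[of "1 / a"] that by simp
        then show ?thesis using that by (simp add: algebra_simps)
      qed
      then show "\<forall>\<^sub>F a in at_right 0. 0 \<le> a * P + Q"
        unfolding eventually_at_filter by simp
    qed simp
    ultimately show ?thesis by (simp add: P_def Q_def R_def)
  qed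
  show "loewner_cpd n (\<lambda>t. t * f t)" "loewner_cpd n (\<lambda>t. - f t)"
    unfolding loewner_cpd_def using * by blast+
qed

text \<open>On the diagonal the kernel is the scalar deviation of \<open>f\<close> from its tangent
  at \<open>s\<close>; both growth conditions will come from this inequality.\<close>

lemma chord_rem_nonneg:
  assumes "chord_rem_psd n f" "n \<ge> 1" "a > 0" "s > 0"
  shows "0 \<le> chord_rem f a s s"
proof -
  define z :: "nat \<Rightarrow> complex" where "z i = (if i = 0 then 1 else 0)" for i
  have "0 \<le> (\<Sum>i<n. \<Sum>j<n. chord_rem f a s s * Re (cnj (z i) * z j))"
    using assms(1)[unfolded chord_rem_psd_def, rule_format, of "\<lambda>_. s" a z] assms(3,4) by simp
  also have "\<dots> = chord_rem f a s s * (cmod (\<Sum>i<n. z i))\<^sup>2"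
    unfolding cmod_sum_square sum_distrib_left ..
  also have "(\<Sum>i<n. z i) = 1"
    using assms(2) by (simp add: z_def)
  finally show ?thesis by simp
qed

section \<open>Complex matrices\<close>

definition cmat :: "nat \<Rightarrow> (nat \<Rightarrow> nat \<Rightarrow> complex) \<Rightarrow> complex mat" where
  "cmat n M = mat n n (\<lambda>(i, j). M i j)"

lemma cmat_carrier [simp]: "cmat n M \<in> carrier_mat n n"
  by (simp add: cmat_def)

lemma cmat_index [simp]: "i < n \<Longrightarrow> j < n \<Longrightarrow> cmat n M $$ (i, j) = M i j"
  by (simp add: cmat_def)

lemma cmat_dim [simp]: "dim_row (cmat n M) = n" "dim_col (cmat n M) = n"
  by (simp_all add: cmat_def)

lemma cmat_eqI: "A \<in> carrier_mat n n \<Longrightarrow> (\<And>i j. i < n \<Longrightarrow> j < n \<Longrightarrow> A $$ (i, j) = M i j) \<Longrightarrow> A = cmat n M"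
  by (intro eq_matI) auto

lemma cmat_mult: "cmat n A * cmat n B = cmat n (\<lambda>i j. \<Sum>k<n. A i k * B k j)"
  by (intro eq_matI) (auto simp: scalar_prod_def lessThan_atLeast0)

lemma mat_adjoint_cmat: "mat_adjoint (cmat n M) = cmat n (\<lambda>i j. cnj (M j i))"
  by (intro eq_matI) (auto simp: mat_adjoint_def mat_of_rows_index)

lemma hermitian_mat_cmat: "hermitian_mat n (cmat n M) \<longleftrightarrow> (\<forall>i<n. \<forall>j<n. cnj (M i j) = M j i)"
proof -
  have "hermitian_mat n (cmat n M) \<longleftrightarrow> cmat n (\<lambda>i j. cnj (M j i)) = cmat n M"
    by (simp add: hermitian_mat_def mat_adjoint_cmat)
  also have "\<dots> \<longleftrightarrow> (\<forall>i<n. \<forall>j<n. cnj (M j i) = M i j)"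
    by (simp add: cmat_def mat_eq_iff)
  finally show ?thesis by blast
qed

lemma mult_cmat_vec_inner:
  assumes "x \<in> carrier_vec n"
  shows "(cmat n M *\<^sub>v x) \<bullet>c x = sform n M (($) x) (($) x)"
proof -
  have "(cmat n M *\<^sub>v x) \<bullet>c x = (\<Sum>i<n. (\<Sum>j<n. M i j * x $ j) * cnj (x $ i))"
    using assms by (simp add: scalar_prod_def lessThan_atLeast0)
  then show ?thesis
    by (simp add: sform_eq_cip cip_def mult.commute)
qed

text \<open>Nonnegativity in the order on complex numbers includes being real, which the Hermitian
  property guarantees.\<close>

lemma nonneg_mult_cmat_vec_inner_iff:
  assumes "hermitian_mat n (cmat n M)" "x \<in> carrier_vec n"
  shows "0 \<le> (cmat n M *\<^sub>v x) \<bullet>c x \<longleftrightarrow> 0 \<le> Re (sform n M (($) x) (($) x))"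
proof -
  have "cnj (sform n M (($) x) (($) x)) = sform n M (($) x) (($) x)"
    using assms(1) by (intro cnj_sform) (simp add: hermitian_mat_cmat)
  then have "Im (sform n M (($) x) (($) x)) = 0"
    by (simp add: complex_eq_iff)
  then show ?thesis
    by (simp add: mult_cmat_vec_inner[OF assms(2)] less_eq_complex_def)
qed

lemma sform_cong_arg: "(\<And>i. i < n \<Longrightarrow> x i = x' i) \<Longrightarrow> sform n M x x = sform n M x' x'"
  by (simp add: sform_def)

lemma cond_positive_definite_loewner_iff:
  "cond_positive_definite n (loewner_mat n g t) \<longleftrightarrow>
    (\<forall>z. (\<Sum>i<n. z i) = 0 \<longrightarrow> 0 \<le> (\<Sum>i<n. \<Sum>j<n. div_diff g (t i) (t j) * Re (cnj (z i) * z j)))"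
proof -
  define L where "L i j = complex_of_real (div_diff g (t i) (t j))" for i j
  have L: "loewner_mat n g t = cmat n L"
    by (simp add: loewner_mat_def cmat_def L_def)
  have herm: "hermitian_mat n (cmat n L)"
    unfolding hermitian_mat_cmat by (simp add: L_def div_diff_commute)
  have Re: "Re (sform n L z z) = (\<Sum>i<n. \<Sum>j<n. div_diff g (t i) (t j) * Re (cnj (z i) * z j))" for z
  proof -
    have "Re (cnj (z i) * L i j * z j) = div_diff g (t i) (t j) * Re (cnj (z i) * z j)" for i j
      by (simp add: L_def algebra_simps)
    then show ?thesis by (simp only: sform_def Re_sum)
  qed
  show ?thesis
    unfolding cond_positive_definite_def L Re[symmetric]
  proof (intro iffI conjI allI impI ballI herm, elim conjE)
    fix z :: "nat \<Rightarrow> complex"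
    assume *: "\<forall>x\<in>carrier_vec n. (\<Sum>i<n. x $ i) = 0 \<longrightarrow> 0 \<le> (cmat n L *\<^sub>v x) \<bullet>c x" and "(\<Sum>i<n. z i) = 0"
    then have "0 \<le> (cmat n L *\<^sub>v vec n z) \<bullet>c vec n z"
      by simp
    then have "0 \<le> Re (sform n L (($) (vec n z)) (($) (vec n z)))"
      using nonneg_mult_cmat_vec_inner_iff[OF herm] by simp
    also have "sform n L (($) (vec n z)) (($) (vec n z)) = sform n L z z"
      by (rule sform_cong_arg) simp
    finally show "0 \<le> Re (sform n L z z)" .
  next
    fix x :: "complex vec"
    assume "\<forall>z. (\<Sum>i<n. z i) = 0 \<longrightarrow> 0 \<le> Re (sform n L z z)" "x \<in> carrier_vec n" "(\<Sum>i<n. x $ i) = 0"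
    then show "0 \<le> (cmat n L *\<^sub>v x) \<bullet>c x"
      using nonneg_mult_cmat_vec_inner_iff[OF herm] by simp
  qed
qed

lemma loewner_cpd_iff:
  "loewner_cpd n g \<longleftrightarrow> (\<forall>t. (\<forall>i<n. t i > 0) \<longrightarrow> cond_positive_definite n (loewner_mat n g t))"
  unfolding loewner_cpd_def cond_positive_definite_loewner_iff by blast

text \<open>Off the diagonal negation is algebra; on the diagonal differentiability makes
  \<open>deriv\<close> commute with it.\<close>

lemma loewner_cpd_uminus_iff:
  assumes diff: "\<forall>t>0. (f has_real_derivative deriv f t) (at t)"
  shows "loewner_cpd n (\<lambda>t. - f t) \<longleftrightarrow> (\<forall>t. (\<forall>i<n. t i > 0) \<longrightarrow> cond_negative_definite n (loewner_mat n f t))"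
proof -
  have "- loewner_mat n f t = loewner_mat n (\<lambda>t. - f t) t" if t: "\<forall>i<n. t i > 0" for t
  proof (rule eq_matI)
    have "deriv (\<lambda>t. - f t) q = - deriv f q" if "q > 0" for q
      using diff that by (intro DERIV_imp_deriv DERIV_minus) simp
    then show "(- loewner_mat n f t) $$ (i, j) = loewner_mat n (\<lambda>t. - f t) t $$ (i, j)"
      if "i < dim_row (loewner_mat n (\<lambda>t. - f t) t)" "j < dim_col (loewner_mat n (\<lambda>t. - f t) t)" for i j
      using that t by (auto simp: loewner_mat_def div_diff_def field_simps)
  qed (simp_all add: loewner_mat_def)
  then show ?thesis
    unfolding loewner_cpd_iff cond_negative_definite_def by metis
qed

section \<open>Functional calculus, spectrum and convexity in an eigenbasis\<close>

lemma unitary_mat_orthonormal: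
  assumes "orthonormal n u"
  shows "unitary_mat n (cmat n (\<lambda>i k. u k i))"
proof -
  have "mat_adjoint (cmat n (\<lambda>i k. u k i)) * cmat n (\<lambda>i k. u k i) = 1\<^sub>m n"
    using assms by (intro eq_matI) (auto simp: mat_adjoint_cmat cmat_mult orthonormal_def cip_def)
  moreover have "cmat n (\<lambda>i k. u k i) * mat_adjoint (cmat n (\<lambda>i k. u k i)) = 1\<^sub>m n"
    using orthonormal_rows[OF assms] by (intro eq_matI) (auto simp: mat_adjoint_cmat cmat_mult)
  ultimately show ?thesis by (simp add: unitary_mat_def)
qed

lemma cmat_spmat:
  "cmat n (spmat n u d) =
    cmat n (\<lambda>i k. u k i) * mat_diag n (\<lambda>k. complex_of_real (d k)) * mat_adjoint (cmat n (\<lambda>i k. u k i))"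
proof -
  have "cmat n (\<lambda>i k. u k i) * mat_diag n (\<lambda>k. complex_of_real (d k)) = cmat n (\<lambda>i k. u k i * of_real (d k))"
    by (rule eq_matI) (auto simp: mat_diag_mult_right[of _ n n])
  then show ?thesis
    by (simp add: mat_adjoint_cmat cmat_mult) (rule cmat_eqI, simp, simp add: spmat_def mult_ac)
qed

lemma mat_fun_cmat_spmat:
  assumes "orthonormal n u"
  shows "mat_fun f (cmat n (spmat n u d)) = cmat n (spmat n u (\<lambda>k. f (d k)))"
  unfolding cmat_spmat by (rule mat_fun_diag[OF unitary_mat_orthonormal[OF assms]])

lemma spectrum_cmat_spmat:
  assumes u: "orthonormal n u"
  shows "spectrum (cmat n (spmat n u d)) = (\<lambda>k. complex_of_real (d k)) ` {..<n}"
proof (intro equalityI subsetI)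
  fix z assume "z \<in> spectrum (cmat n (spmat n u d))"
  then obtain y where y: "y \<in> carrier_vec n" "y \<noteq> 0\<^sub>v n" "cmat n (spmat n u d) *\<^sub>v y = z \<cdot>\<^sub>v y"
    by (auto simp: spectrum_def eigenvalue_def eigenvector_def)
  have ev: "(\<Sum>j<n. spmat n u d i j * y $ j) = z * y $ i" if "i < n" for i
  proof -
    have "(cmat n (spmat n u d) *\<^sub>v y) $ i = (z \<cdot>\<^sub>v y) $ i" by (simp add: y(3))
    then show ?thesis using that y(1) by (simp add: scalar_prod_def lessThan_atLeast0)
  qed
  obtain i where i: "i < n" "y $ i \<noteq> 0"
    using y(1,2) by (auto simp: vec_eq_iff)
  \<comment> \<open>An eigenvector has a nonzero coefficient along some \<open>u k\<close>; pairing
    the eigenvalue equation with that \<open>u k\<close> identifies \<open>z\<close> with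
    \<open>d k\<close>.\<close>
  have "(\<Sum>k<n. u k i * cip n (u k) (($) y)) \<noteq> 0"
    using orthonormal_expand[OF u i(1), of "($) y"] i(2) by simp
  then obtain k where k: "k < n" "cip n (u k) (($) y) \<noteq> 0"
    by (elim sum.not_neutral_contains_not_neutral) auto
  have "of_real (d k) * cip n (u k) (($) y) = sform n (spmat n u d) (u k) (($) y)"
    using sform_eigenvector_left[OF u k(1)] by simp
  also have "\<dots> = cip n (u k) (\<lambda>i. z * y $ i)"
    unfolding sform_eq_cip using ev by (intro cip_cong) auto
  also have "\<dots> = z * cip n (u k) (($) y)"
    by (rule cip_scale_right)
  finally show "z \<in> (\<lambda>k. complex_of_real (d k)) ` {..<n}"
    using k by auto
next
  fix z assume "z \<in> (\<lambda>k. complex_of_real (d k)) ` {..<n}"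
  then obtain k where k: "k < n" "z = of_real (d k)" by auto
  have "vec n (u k) \<noteq> 0\<^sub>v n"
  proof
    assume *: "vec n (u k) = 0\<^sub>v n"
    have "u k i = 0" if "i < n" for i
      using arg_cong[OF *, of "\<lambda>v. v $ i"] that by simp
    then show False
      using norm_orthonormal[OF u k(1)] by simp
  qed
  moreover have "cmat n (spmat n u d) *\<^sub>v vec n (u k) = z \<cdot>\<^sub>v vec n (u k)"
  proof (rule eq_vecI)
    fix i assume "i < dim_vec (z \<cdot>\<^sub>v vec n (u k))"
    then have "i < n" by simp
    then show "(cmat n (spmat n u d) *\<^sub>v vec n (u k)) $ i = (z \<cdot>\<^sub>v vec n (u k)) $ i"
      using spmat_apply_eigenvector[OF u k(1), of d i] k(2) by (simp add: scalar_prod_def lessThan_atLeast0)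
  qed simp
  ultimately have "eigenvector (cmat n (spmat n u d)) (vec n (u k)) z"
    by (simp add: eigenvector_def)
  then show "z \<in> spectrum (cmat n (spmat n u d))"
    by (auto simp: spectrum_def eigenvalue_def)
qed

lemma psd_le_spmat_iff:
  "psd_le n (cmat n (spmat n w c))
      (complex_of_real l \<cdot>\<^sub>m cmat n (spmat n u d) + complex_of_real (1 - l) \<cdot>\<^sub>m cmat n (spmat n v e)) \<longleftrightarrow>
    (\<forall>x. qval n w c x \<le> l * qval n u d x + (1 - l) * qval n v e x)"
proof -
  define M where "M i j = of_real l * spmat n u d i j + of_real (1 - l) * spmat n v e i j + (- 1) * spmat n w c i j" for i j
  have M: "complex_of_real l \<cdot>\<^sub>m cmat n (spmat n u d) + complex_of_real (1 - l) \<cdot>\<^sub>m cmat n (spmat n v e) - cmat n (spmat n w c)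
      = cmat n M"
    by (rule cmat_eqI) (auto simp: M_def intro!: minus_carrier_mat)
  have herm: "hermitian_mat n (cmat n M)"
    unfolding hermitian_mat_cmat by (simp add: M_def spmat_hermitian)
  have Re: "Re (sform n M x x) = l * qval n u d x + (1 - l) * qval n v e x - qval n w c x" for x
    unfolding M_def sform_add sform_scale by (simp add: sform_spmat_self)
  have "psd_le n (cmat n (spmat n w c))
      (complex_of_real l \<cdot>\<^sub>m cmat n (spmat n u d) + complex_of_real (1 - l) \<cdot>\<^sub>m cmat n (spmat n v e)) \<longleftrightarrow>
    psd_mat n (cmat n M)"
    by (simp only: psd_le_def M)
  also have "\<dots> \<longleftrightarrow> (\<forall>x\<in>carrier_vec n. 0 \<le> (cmat n M *\<^sub>v x) \<bullet>c x)"
    by (simp only: psd_mat_def herm simp_thms)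
  also have "\<dots> \<longleftrightarrow> (\<forall>x\<in>carrier_vec n. 0 \<le> Re (sform n M (($) x) (($) x)))"
    by (rule ball_cong[OF refl]) (rule nonneg_mult_cmat_vec_inner_iff[OF herm])
  also have "\<dots> \<longleftrightarrow> (\<forall>x. 0 \<le> Re (sform n M x x))"
  proof (intro iffI allI ballI)
    fix x :: "nat \<Rightarrow> complex"
    assume "\<forall>x\<in>carrier_vec n. 0 \<le> Re (sform n M (($) x) (($) x))"
    then have "0 \<le> Re (sform n M (($) (vec n x)) (($) (vec n x)))"
      by simp
    then show "0 \<le> Re (sform n M x x)"
      using sform_cong_arg[of n "($) (vec n x)" x M] by simp
  qed simp
  finally show ?thesis
    unfolding Re by simp
qed

lemma spectral_convex_if_matrix_convex_on:
  assumes "matrix_convex_on n {0<..} f"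
  shows "spectral_convex n f"
  unfolding spectral_convex_def
proof (intro allI impI, elim conjE)
  fix u d v e w c and l :: real and x
  assume u: "orthonormal n u" and v: "orthonormal n v" and w: "orthonormal n w"
    and pos: "\<forall>k<n. 0 < d k \<and> 0 < e k \<and> 0 < c k" and l: "0 < l" "l < 1"
    and eq: "\<forall>i<n. \<forall>j<n. spmat n w c i j = complex_of_real l * spmat n u d i j + complex_of_real (1 - l) * spmat n v e i j"
  have "complex_of_real l \<cdot>\<^sub>m cmat n (spmat n u d) + complex_of_real (1 - l) \<cdot>\<^sub>m cmat n (spmat n v e) = cmat n (spmat n w c)"
    by (rule cmat_eqI) (use eq in auto)
  moreover have "hermitian_mat n (cmat n (spmat n u' d'))" for u' d'
    by (simp add: hermitian_mat_cmat spmat_hermitian)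
  moreover have "spectrum (cmat n (spmat n u d)) \<subseteq> complex_of_real ` {0<..}" "spectrum (cmat n (spmat n v e)) \<subseteq> complex_of_real ` {0<..}"
    unfolding spectrum_cmat_spmat[OF u] spectrum_cmat_spmat[OF v] using pos by auto
  ultimately have "psd_le n (mat_fun f (cmat n (spmat n w c)))
      (complex_of_real l \<cdot>\<^sub>m mat_fun f (cmat n (spmat n u d)) + complex_of_real (1 - l) \<cdot>\<^sub>m mat_fun f (cmat n (spmat n v e)))"
    using assms l unfolding matrix_convex_on_def by metis
  then show "qval n w (\<lambda>k. f (c k)) x \<le> l * qval n u (\<lambda>k. f (d k)) x + (1 - l) * qval n v (\<lambda>k. f (e k)) x"
    unfolding mat_fun_cmat_spmat[OF u] mat_fun_cmat_spmat[OF v] mat_fun_cmat_spmat[OF w] psd_le_spmat_iff by blast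
qed

lemma hermitian_mat_diagonalization:
  assumes "hermitian_mat n A" "spectrum A \<subseteq> complex_of_real ` {0<..}"
  shows "\<exists>u d. orthonormal n u \<and> A = cmat n (spmat n u d) \<and> (\<forall>k<n. 0 < d k)"
proof -
  have A: "A = cmat n (\<lambda>i j. A $$ (i, j))"
    using assms(1) by (intro cmat_eqI) (auto simp: hermitian_mat_def)
  have "hermitian_mat n (cmat n (\<lambda>i j. A $$ (i, j)))"
    using assms(1) A by metis
  then obtain u d where u: "orthonormal n u" and d: "\<forall>i<n. \<forall>j<n. spmat n u d i j = A $$ (i, j)"
    unfolding hermitian_mat_cmat using spectral_theorem[of n "\<lambda>i j. A $$ (i, j)"] by blast
  have A': "A = cmat n (spmat n u d)"
    using assms(1) d by (intro cmat_eqI) (auto simp: hermitian_mat_def)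
  have "0 < d k" if "k < n" for k
  proof -
    have "complex_of_real (d k) \<in> spectrum A"
      unfolding A' spectrum_cmat_spmat[OF u] using that by simp
    then show ?thesis using assms(2) by auto
  qed
  then show ?thesis using u A' by blast
qed

lemma matrix_convex_on_if_spectral_convex:
  assumes conv: "spectral_convex n f" and cont: "continuous_on {0<..} f"
  shows "matrix_convex_on n {0<..} f"
  unfolding matrix_convex_on_def
proof (intro conjI cont allI impI, elim conjE)
  fix A B and l :: real
  assume A: "hermitian_mat n A" "spectrum A \<subseteq> complex_of_real ` {0<..}"
    and B: "hermitian_mat n B" "spectrum B \<subseteq> complex_of_real ` {0<..}" and l: "0 < l" "l < 1"
  obtain u d where u: "orthonormal n u" and A': "A = cmat n (spmat n u d)" and d: "\<forall>k<n. 0 < d k"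
    using hermitian_mat_diagonalization[OF A] by blast
  obtain v e where v: "orthonormal n v" and B': "B = cmat n (spmat n v e)" and e: "\<forall>k<n. 0 < e k"
    using hermitian_mat_diagonalization[OF B] by blast
  obtain w c where w: "orthonormal n w"
    and c: "\<And>i j. i < n \<Longrightarrow> j < n \<Longrightarrow>
      spmat n w c i j = complex_of_real l * spmat n u d i j + complex_of_real (1 - l) * spmat n v e i j"
    using spectral_theorem[of n "\<lambda>i j. complex_of_real l * spmat n u d i j + complex_of_real (1 - l) * spmat n v e i j"]
    by (auto simp: spmat_hermitian)
  have C: "complex_of_real l \<cdot>\<^sub>m A + complex_of_real (1 - l) \<cdot>\<^sub>m B = cmat n (spmat n w c)"
    unfolding A' B' by (rule cmat_eqI) (use c in auto)
  \<comment> \<open>A common positive lower bound \<open>a\<close> of both spectra bounds the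
    eigenvalues of the combination as well, which supplies the positivity that
    \<open>spectral_convex\<close> presupposes.\<close>
  obtain a b where a: "0 < a" and ab: "\<forall>k<n. d k \<in> {a..b} \<and> e k \<in> {a..b}"
    using positive_bounds_exist[of n d e] d e by blast
  have "0 < c k" if k: "k < n" for k
  proof -
    have "a \<le> qval n u d (w k)" "a \<le> qval n v e (w k)"
      using qval_between[OF u, of d a b "w k"] qval_between[OF v, of e a b "w k"] ab norm_orthonormal[OF w k] by auto
    then have "0 < l * qval n u d (w k) + (1 - l) * qval n v e (w k)"
      using a l by (intro add_pos_pos mult_pos_pos) auto
    then show ?thesis
      using qval_combine[OF c, of "w k"] qval_eigenvector[OF w k, of c] by simp
  qed
  then have "qval n w (\<lambda>k. f (c k)) x \<le> l * qval n u (\<lambda>k. f (d k)) x + (1 - l) * qval n v (\<lambda>k. f (e k)) x" for x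
    using u v w d e l c by (intro conv[unfolded spectral_convex_def, rule_format]) auto
  then show "psd_le n (mat_fun f (complex_of_real l \<cdot>\<^sub>m A + complex_of_real (1 - l) \<cdot>\<^sub>m B))
      (complex_of_real l \<cdot>\<^sub>m mat_fun f A + complex_of_real (1 - l) \<cdot>\<^sub>m mat_fun f B)"
    unfolding C unfolding A' B' mat_fun_cmat_spmat[OF u] mat_fun_cmat_spmat[OF v] mat_fun_cmat_spmat[OF w] psd_le_spmat_iff
    by blast
qed

section \<open>Growth conditions and the four implications\<close>

text \<open>An affine minorant divided by \<open>t\<close> is bounded below for
  \<open>t \<ge> 1\<close>: its slope changes by at most \<open>|b - m| / t\<close>.\<close>

lemma liminf_ratio_if_tangent:
  assumes "\<And>t. t > 0 \<Longrightarrow> b + m * (t - 1) \<le> f t"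
  shows "Liminf at_top (\<lambda>t. ereal (f t / t)) > -\<infinity>"
proof -
  have "m - \<bar>b - m\<bar> \<le> f t / t" if "t \<ge> 1" for t
  proof -
    have "\<bar>b - m\<bar> * 1 \<le> \<bar>b - m\<bar> * t" using that by (intro mult_left_mono) auto
    then have "(m - \<bar>b - m\<bar>) * t \<le> f t"
      using assms[of t] that by (simp add: algebra_simps)
    then show ?thesis using that by (simp add: field_simps)
  qed
  then have "\<forall>\<^sub>F t in at_top. ereal (m - \<bar>b - m\<bar>) \<le> ereal (f t / t)"
    unfolding eventually_at_top_linorder by auto
  then have "ereal (m - \<bar>b - m\<bar>) \<le> Liminf at_top (\<lambda>t. ereal (f t / t))"
    by (rule Liminf_bounded)
  then show ?thesis
    by (rule less_le_trans[rotated]) simp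
qed

text \<open>An affine minorant is bounded near 0, so its product with \<open>t\<close> tends to
  0.\<close>

lemma limsup_times_if_tangent:
  assumes "\<And>t. t > 0 \<Longrightarrow> b + m * (t - 1) \<le> f t"
  shows "Limsup (at_right 0) (\<lambda>t. ereal (t * f t)) \<ge> 0"
proof -
  have "((\<lambda>t. ereal (t * (b + m * (t - 1)))) \<longlongrightarrow> ereal (0 * (b + m * (0 - 1)))) (at_right 0)"
    by (intro tendsto_intros)
  then have "Limsup (at_right 0) (\<lambda>t. ereal (t * (b + m * (t - 1)))) = ereal (0 * (b + m * (0 - 1)))"
    by (intro lim_imp_Limsup) auto
  moreover have "Limsup (at_right 0) (\<lambda>t. ereal (t * (b + m * (t - 1)))) \<le> Limsup (at_right 0) (\<lambda>t. ereal (t * f t))"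
    using assms by (intro Limsup_mono) (auto simp: eventually_at_filter intro!: mult_left_mono)
  ultimately show ?thesis by (simp add: zero_ereal_def)
qed

lemma chord_rem_psd_imp_cond_bc:
  assumes psd: "chord_rem_psd n f" and n: "n \<ge> 1" and diff: "\<forall>t>0. (f has_real_derivative deriv f t) (at t)"
  shows "cond_b f n" "cond_c f n"
proof -
  have tangent: "f 1 + deriv f 1 * (t - 1) \<le> f t" if "t > 0" for t
    using chord_rem_nonneg[OF psd n that, of 1] by (simp add: chord_rem_def div_diff_def)
  show "cond_b f n"
    unfolding cond_b_def loewner_cpd_uminus_iff[OF diff, symmetric]
    using liminf_ratio_if_tangent[OF tangent] loewner_cpd_if_chord_rem_psd(2)[OF psd diff] by blast
  show "cond_c f n"
    unfolding cond_c_def loewner_cpd_iff[symmetric]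
    using limsup_times_if_tangent[OF tangent] loewner_cpd_if_chord_rem_psd(1)[OF psd diff] by blast
qed

lemma chord_rem_psd_le:
  assumes "chord_rem_psd m f" "n \<le> m"
  shows "chord_rem_psd n f"
  unfolding chord_rem_psd_def
proof (intro allI impI, elim conjE)
  fix d :: "nat \<Rightarrow> real" and a :: real and z :: "nat \<Rightarrow> complex"
  assume d: "\<forall>i<n. 0 < d i" and a: "0 < a"
  \<comment> \<open>The points are padded with 1, an arbitrary point of the domain, and the vector
    with zeros.\<close>
  define d' where "d' i = (if i < n then d i else 1)" for i
  define z' where "z' i = (if i < n then z i else 0)" for i
  have m: "{..<m} = {..<n} \<union> {n..<m}" using assms(2) by auto
  have "0 \<le> (\<Sum>i<m. \<Sum>j<m. chord_rem f a (d' i) (d' j) * Re (cnj (z' i) * z' j))"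
    using d a by (intro assms(1)[unfolded chord_rem_psd_def, rule_format]) (simp add: d'_def)
  also have "\<dots> = (\<Sum>i<n. \<Sum>j<m. chord_rem f a (d' i) (d' j) * Re (cnj (z' i) * z' j))"
    using assms(2) by (intro sum.mono_neutral_right) (auto simp: z'_def)
  also have "\<dots> = (\<Sum>i<n. \<Sum>j<n. chord_rem f a (d' i) (d' j) * Re (cnj (z' i) * z' j))"
    using assms(2) by (intro sum.cong refl sum.mono_neutral_right) (auto simp: z'_def)
  also have "\<dots> = (\<Sum>i<n. \<Sum>j<n. chord_rem f a (d i) (d j) * Re (cnj (z i) * z j))"
    by (intro sum.cong refl) (simp add: d'_def z'_def)
  finally show "0 \<le> (\<Sum>i<n. \<Sum>j<n. chord_rem f a (d i) (d j) * Re (cnj (z i) * z j))" .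
qed

theorem theorem2p1:
  fixes f :: "real \<Rightarrow> real" and n :: nat
  assumes "f C1_differentiable_on {0<..}"
    and "n \<ge> 1"
  shows "(cond_a f (2 * n + 1) \<longrightarrow> cond_b f n) \<and>
         (cond_b f (4 * n + 1) \<longrightarrow> cond_a f n) \<and>
         (cond_a f (n + 1) \<longrightarrow> cond_c f n) \<and>
         (cond_c f (2 * n + 1) \<longrightarrow> cond_a f n)"
proof -
  have diff: "(f has_real_derivative deriv f t) (at t)" if "t > 0" for t
  proof -
    have "f differentiable (at t)"
      using assms(1) that by (simp add: C1_differentiable_on_eq)
    then show ?thesis
      using DERIV_deriv_iff_real_differentiable by blast
  qed
  have diff_times: "((\<lambda>t. t * f t) has_real_derivative deriv (\<lambda>t. t * f t) t) (at t)" if "t > 0" for t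
  proof -
    have "((\<lambda>t. t * f t) has_real_derivative t * deriv f t + 1 * f t) (at t)"
      by (rule DERIV_mult'[OF DERIV_ident diff[OF that]])
    then show ?thesis by (metis DERIV_imp_deriv)
  qed
  have cont: "continuous_on {0<..} f"
    using diff DERIV_isCont by (intro continuous_at_imp_continuous_on) blast
  have a: "cond_a f m \<longleftrightarrow> spectral_convex m f" for m
    unfolding cond_a_def
    using spectral_convex_if_matrix_convex_on matrix_convex_on_if_spectral_convex[OF _ cont] by blast
  have psd: "chord_rem_psd m f" if "cond_a f (m + 1)" for m
    using that unfolding a by (intro chord_rem_psd_if_spectral_convex diff) simp_all
  show ?thesis
  proof (intro conjI impI)
    assume "cond_a f (2 * n + 1)"
    then have "chord_rem_psd n f"
      using chord_rem_psd_le[OF psd, of "2 * n" n] by simp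
    then show "cond_b f n"
      using chord_rem_psd_imp_cond_bc(1) assms(2) diff by blast
  next
    assume b: "cond_b f (4 * n + 1)"
    \<comment> \<open>A real number strictly below the limit inferior, which may itself be
      infinite.\<close>
    then obtain m where "- \<infinity> < ereal m" "ereal m < Liminf at_top (\<lambda>t. ereal (f t / t))"
      unfolding cond_b_def using ereal_dense2 by blast
    then have "\<forall>\<^sub>F t in at_top. m < f t / t"
      using less_LiminfD by fastforce
    then show "cond_a f n"
      unfolding a using b diff loewner_cpd_uminus_iff[of f "4 * n + 1"] unfolding cond_b_def
      by (intro spectral_convex_if_loewner_cpd_uminus) blast+
  next
    assume "cond_a f (n + 1)"
    then show "cond_c f n"
      using chord_rem_psd_imp_cond_bc(2)[OF psd assms(2)] diff by blast
  next
    assume c: "cond_c f (2 * n + 1)"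
    \<comment> \<open>If this failed, \<open>t * f t\<close> would eventually be at most
      \<open>- \<epsilon>\<close> near 0, and so would its limit superior.\<close>
    have "\<exists>\<^sub>F a in at_right 0. - \<epsilon> < a * f a" if "\<epsilon> > 0" for \<epsilon>
    proof (rule ccontr)
      assume "\<not> ?thesis"
      then have "\<forall>\<^sub>F a in at_right 0. ereal (a * f a) \<le> ereal (- \<epsilon>)"
        by (simp add: not_frequently not_less)
      then have "Limsup (at_right 0) (\<lambda>t. ereal (t * f t)) \<le> ereal (- \<epsilon>)"
        by (rule Limsup_bounded)
      then have "0 \<le> ereal (- \<epsilon>)"
        using c unfolding cond_c_def by (meson order_trans)
      then show False using that by simp
    qed
    then show "cond_a f n"
      unfolding a using c diff_times unfolding cond_c_def loewner_cpd_iff[symmetric]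
      by (intro spectral_convex_if_loewner_cpd_times) blast+
  qed
qed

end
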